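(* Let $\{\mathcal T_h\}_h$ be a sequence of meshes resolving the geometry of $\Gamma$ (in the sense of the context), with $h\to0$, such that (i) $\|P_h\|_{\mathcal L(H^1_* )}$ and $C_{\mathrm{inv},h}$ are bounded uniformly in $h$; (ii) $\inf_{z_h\in\mathbb U_h}\mathbf E[w,z_h]\to0$ as $h\to0$ for all $w\in\mathbb U$. Let $(u_0,f)\in L^2_\Gamma\times L^2(I;H^{-1}_\Gamma)$. Then the solution $u_h\in\mathbb U_h$ of $b_h(u_h,v_h)=\ell(v_h)$ for all $v_h\in\mathbb V_h$ converges strongly to the weak solution $u\in\mathbb U$ of $b(u,v)=\ell(v)$ for all $v\in\mathbb V$ as $h\to0$, namely $$\mathbf E[u,u_h]\to0 .$$
   Context: Geometry and finite elements. $\Gamma\subset\mathbb R^n$ is a closed (compact, boundaryless) hypersurface of class $C^2$ with principal curvatures $\kappa_1,\dots,\kappa_{n-1}$ and unit normal $\mathbf n$; integration and evaluation on $\Gamma$ are exact. $\mathcal T_h$ is the set of those elements $T$ (of diameter $h_T$) of a mesh of a region of $\mathbb R^n$ surrounding $\Gamma$ that intersect $\Gamma$; $\Omega_h$ is the union of the $T\in\mathcal T_h$, and $h=\max_T h_T$. Resolution of the geometry: $h_T\le C(\max_i\|\kappa_i\|_{L^\infty(\Gamma\cap T)})^{-1}$ for all $T\in\mathcal T_h$, with a generic constant $C$ such that the closest point projection $\mathbf p$ onto $\Gamma$ is well defined on $\Omega_h$. The normal is extended to $\Omega_h$ by $\mathbf n\circ\mathbf p$ (still denoted $\mathbf n$)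 and $\nabla_{\mathbf n}:=\mathbf n\cdot\nabla$. $V_h$ is a finite element space of continuous functions on $\Omega_h$, piecewise polynomial over $\mathcal T_h$, so that $V_h|_\Gamma\subset H^1(\Gamma)$. No shape-regularity or quasi-uniformity is assumed. Stabilized forms and norms. Write $L^2_\Gamma=L^2(\Gamma)$, $H^1_\Gamma=H^1(\Gamma)$, $|v|_{H^1_\Gamma}=\|\nabla_\Gamma v\|_{L^2_\Gamma}$, $\|v\|_{H^1_\Gamma}^2=\|v\|_{L^2_\Gamma}^2+|v|_{H^1_\Gamma}^2$; $H^{-1}_\Gamma$ is the dual of $H^1_\Gamma$ (no mean value constraint), with pairing $\langle\cdot,\cdot\rangle_\Gamma$ extending the inner product $(\cdot,\cdot)_\Gamma$ of $L^2_\Gamma$. For $j\in\{-1,0,1\}$ and $v_h,w_h\in V_h$ let $$s_{j,T}(v_h,w_h)=h_T^{1-2j}\int_T(\nabla_{\mathbf n}v_h)(\nabla_{\mathbf n}w_h)\,dx,\qquad s_j=\sum_{T\in\mathcal T_h}s_{j,T}.$$ Set $(v_h,w_h)_*=\langle v_h,w_h\rangle_*=(v_h,w_h)_\Gamma+s_0(v_h,w_h)$, $a(v,w)=(\nabla_\Gamma v,\nabla_\Gamma w)_\Gamma$, $a_*(v_h,w_h)=a(v_h,w_h)+s_1(v_h,w_h)$, $\|v_h\|_{H^1_*}^2=\|v_h\|_{H^1_\Gamma}^2+s_1(v_h,v_h)$, and $\|v_h\|_{L^2_*(T)}^2=\|v_h\|_{L^2(\Gamma\cap T)}^2+s_{0,T}(v_h,v_h)$.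 The method is assumed well defined, i.e. $(\cdot,\cdot)_*$ is an inner product on $V_h$. Stabilized $L^2$-projection: $P_h:H^{-1}_\Gamma\to V_h$, $(P_hu,v_h)_*=\langle u,v_h\rangle_\Gamma$ for all $v_h\in V_h$; $\|P_h\|_{\mathcal L(H^1_* )}=\sup_{0\ne v\in H^1_\Gamma}\|P_hv\|_{H^1_*}/\|v\|_{H^1_\Gamma}$. Discrete dual norm and inverse parameter: $$\|v_h\|_{V_h^{-1}}=\sup_{0\ne w_h\in V_h}\frac{(v_h,w_h)_*}{\|w_h\|_{H^1_*}},\qquad C_{\mathrm{inv},h}=\sup_{0\ne v_h\in V_h}\frac{\big(\sum_{T\in\mathcal T_h}h_T^2\|v_h\|_{L^2_*(T)}^2\big)^{1/2}}{\|v_h\|_{V_h^{-1}}}.$$ Parabolic setting. $I=(0,T)$ with $0<T<\infty$ (the letter $T$ is also used for elements); integrals over $I$ are in $t$. $\mathbb U=L^2(I;H^1_\Gamma)\cap H^1(I;H^{-1}_\Gamma)$, $\mathbb V=L^2_\Gamma\times L^2(I;H^1_\Gamma)$, $\mathbb U_h=H^1(I;V_h)$, $\mathbb V_h=V_h\times L^2(I;V_h)$. For $v=(v_0,v_1)\in\mathbb V$ and $v_h=(v_{h,0},v_{h,1})\in\mathbb V_h$: $$b(u,v)=(u(0),v_0)_\Gamma+\int_I\big(\langle\partial_tu,v_1\rangle_\Gamma+a(u,v_1)\big),\qquad \ell(v)=(u_0,v_0)_\Gamma+\int_I\langle f,v_1\rangle_\Gamma$$ (and $\ell(v_h)$ by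 the same formula with traces on $\Gamma$), $$b_h(u_h,v_h)=(u_h(0),v_{h,0})_*+\int_I\big(\langle\partial_tu_h,v_{h,1}\rangle_*+a_*(u_h,v_{h,1})\big).$$ Error functionals. For $v$ on $\Gamma$ and $v_h\in V_h$: $\mathbf E_{H^{-1}_*}[v,v_h]^2=\|v-v_h\|_{H^{-1}_\Gamma}^2+s_{-1}(v_h,v_h)$, $\mathbf E_{L^2_*}[v,v_h]^2=\|v-v_h\|_{L^2_\Gamma}^2+s_0(v_h,v_h)$, $\mathbf E_{H^1_*}[v,v_h]^2=|v-v_h|_{H^1_\Gamma}^2+s_1(v_h,v_h)$. For $v\in\mathbb U$, $v_h\in\mathbb U_h$: $$\mathbf E[v,v_h]^2=\mathbf E_{L^2_*}[v(0),v_h(0)]^2+\int_I\big(\mathbf E_{H^{-1}_*}[\partial_tv,\partial_tv_h]^2+\mathbf E_{H^1_*}[v,v_h]^2\big).$$ *)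

theory Defs
  imports "HOL-Analysis.Analysis" "HOL-Library.Function_Algebras"
begin

section \<open>Closed hypersurfaces of class \<open>C\<^sup>2\<close>\<close>

text \<open>A closed hypersurface is compact and locally a regular level set of a \<open>C\<^sup>2\<close> function;
  \<open>G\<close> is the gradient of the level function and \<open>H\<close> its Hessian.\<close>

definition closed_C2_hypersurface :: "'a::euclidean_space set \<Rightarrow> bool" where
  "closed_C2_hypersurface \<Gamma> \<longleftrightarrow> compact \<Gamma> \<and> \<Gamma> \<noteq> {} \<and>
     (\<forall>x\<in>\<Gamma>. \<exists>U (\<phi>::'a \<Rightarrow> real) (G::'a \<Rightarrow> 'a) (H::'a \<Rightarrow> 'a \<Rightarrow>\<^sub>L 'a).
        open U \<and> x \<in> U \<and>
        (\<forall>y\<in>U. (\<phi> has_derivative (\<lambda>v. G y \<bullet> v)) (at y) \<and> G y \<noteq> 0 \<and>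
                (G has_derivative blinfun_apply (H y)) (at y)) \<and>
        continuous_on U H \<and>
        \<Gamma> \<inter> U = {y \<in> U. \<phi> y = 0})"

definition tangent_space :: "'a::euclidean_space set \<Rightarrow> 'a \<Rightarrow> 'a set" where
  "tangent_space \<Gamma> x =
     {v. \<exists>c. c 0 = x \<and> (\<forall>\<^sub>F s in at 0. c s \<in> \<Gamma>) \<and> (c has_vector_derivative v) (at (0::real))}"

definition unit_normal_field :: "'a::euclidean_space set \<Rightarrow> ('a \<Rightarrow> 'a) \<Rightarrow> bool" where
  "unit_normal_field \<Gamma> \<nu> \<longleftrightarrow> continuous_on \<Gamma> \<nu> \<and>
     (\<forall>x\<in>\<Gamma>. norm (\<nu> x) = 1 \<and> (\<forall>v\<in>tangent_space \<Gamma> x. \<nu> x \<bullet> v = 0))"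

text \<open>Principal curvatures are the eigenvalues of the shape operator \<open>- d\<nu>\<close> on the tangent
  space; the derivative within \<open>\<Gamma>\<close> is determined on tangent vectors only.\<close>

definition principal_curvatures :: "'a::euclidean_space set \<Rightarrow> ('a \<Rightarrow> 'a) \<Rightarrow> 'a \<Rightarrow> real set" where
  "principal_curvatures \<Gamma> \<nu> x =
     {\<kappa>. \<exists>W v. (\<nu> has_derivative W) (at x within \<Gamma>) \<and> v \<in> tangent_space \<Gamma> x \<and> v \<noteq> 0 \<and>
             - W v = \<kappa> *\<^sub>R v}"

definition max_curvature :: "'a::euclidean_space set \<Rightarrow> ('a \<Rightarrow> 'a) \<Rightarrow> 'a \<Rightarrow> ennreal" where
  "max_curvature \<Gamma> \<nu> x = (SUP \<kappa>\<in>principal_curvatures \<Gamma> \<nu> x. ennreal \<bar>\<kappa>\<bar>)"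


section \<open>Surface measure\<close>

text \<open>The \<open>m\<close>-dimensional Hausdorff outer measure, normalised so that it agrees with Lebesgue
  measure on \<open>m\<close>-planes. It is countably additive on Borel sets (Caratheodory's criterion for
  metric outer measures), so that \<open>measure_of\<close> below returns its restriction to Borel sets.
  Empty sets are treated separately because of \<open>0 ^ 0 = 1\<close> in the case \<open>m = 0\<close>.\<close>

definition hausdorff_content :: "nat \<Rightarrow> real \<Rightarrow> 'a::metric_space set \<Rightarrow> ennreal" where
  "hausdorff_content m \<delta> A =
     (INF U \<in> {U::nat \<Rightarrow> 'a set. A \<subseteq> (\<Union>i. U i) \<and> (\<forall>i. bounded (U i) \<and> diameter (U i) \<le> \<delta>)}.
        \<Sum>i. if U i = {} then 0
            else ennreal (unit_ball_vol (real m) * (diameter (U i) / 2) ^ m))"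

definition hausdorff_outer :: "nat \<Rightarrow> 'a::metric_space set \<Rightarrow> ennreal" where
  "hausdorff_outer m A = (SUP \<delta>\<in>{0<..}. hausdorff_content m \<delta> A)"

definition hausdorff_measure :: "nat \<Rightarrow> 'a::metric_space measure" where
  "hausdorff_measure m = measure_of UNIV (sets borel) (hausdorff_outer m)"

definition surface_measure :: "'a::euclidean_space set \<Rightarrow> 'a measure" where
  "surface_measure \<Gamma> = restrict_space (hausdorff_measure (DIM('a) - 1)) \<Gamma>"

definition ip\<Gamma> :: "'a::euclidean_space set \<Rightarrow> ('a \<Rightarrow> real) \<Rightarrow> ('a \<Rightarrow> real) \<Rightarrow> real" where
  "ip\<Gamma> \<Gamma> v w = (LINT x|surface_measure \<Gamma>. v x * w x)"

definition L2\<Gamma> :: "'a::euclidean_space set \<Rightarrow> ('a \<Rightarrow> real) set" where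
  "L2\<Gamma> \<Gamma> = {v \<in> borel_measurable (surface_measure \<Gamma>). integrable (surface_measure \<Gamma>) (\<lambda>x. (v x)\<^sup>2)}"

definition normL2\<Gamma> :: "'a::euclidean_space set \<Rightarrow> ('a \<Rightarrow> real) \<Rightarrow> real" where
  "normL2\<Gamma> \<Gamma> v = sqrt (ip\<Gamma> \<Gamma> v v)"

text \<open>\<open>L\<^sup>\<infinity>\<close> norm on \<open>\<Gamma> \<inter> T\<close> of a nonnegative function.\<close>

definition Linf_norm_on :: "'a::euclidean_space set \<Rightarrow> 'a set \<Rightarrow> ('a \<Rightarrow> ennreal) \<Rightarrow> ennreal" where
  "Linf_norm_on \<Gamma> T k = Inf {c. AE x in surface_measure \<Gamma>. x \<in> T \<longrightarrow> k x \<le> c}"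


section \<open>\<open>H\<^sup>1(\<Gamma>)\<close> and its dual\<close>

definition fscale :: "real \<Rightarrow> ('a \<Rightarrow> 'b::real_vector) \<Rightarrow> 'a \<Rightarrow> 'b" where
  "fscale c f = (\<lambda>x. c *\<^sub>R f x)"

interpretation fun_space: vector_space "fscale :: real \<Rightarrow> ('a \<Rightarrow> 'b::real_vector) \<Rightarrow> 'a \<Rightarrow> 'b"
  by unfold_locales (auto simp: fscale_def fun_eq_iff algebra_simps)

text \<open>Surface divergence at \<open>x\<close> of a vector field with derivative \<open>D\<close> at \<open>x\<close>: the trace of \<open>D\<close>
  over the tangent space.\<close>

definition surface_div :: "('a::euclidean_space \<Rightarrow> 'a) \<Rightarrow> ('a \<Rightarrow>\<^sub>L 'a) \<Rightarrow> 'a \<Rightarrow> real" where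
  "surface_div \<nu> D x = (\<Sum>b\<in>Basis. blinfun_apply D b \<bullet> b) - blinfun_apply D (\<nu> x) \<bullet> \<nu> x"

text \<open>\<open>g\<close> is the weak tangential gradient of \<open>v\<close>:
  \<open>\<integral> v div\<^sub>\<Gamma> \<phi> = - \<integral> g \<bullet> \<phi>\<close> over \<open>\<Gamma>\<close> for all tangential \<open>C\<^sup>1\<close> fields \<open>\<phi>\<close>
  (no boundary or curvature terms, as \<open>\<Gamma>\<close> is closed and \<open>\<phi>\<close> tangential). The real \<open>c\<close> is the
  common value; the integrals exist since \<open>\<Gamma>\<close> is compact.\<close>

definition weak_tgrad ::
  "'a::euclidean_space set \<Rightarrow> ('a \<Rightarrow> 'a) \<Rightarrow> ('a \<Rightarrow> real) \<Rightarrow> ('a \<Rightarrow> 'a) \<Rightarrow> bool" where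
  "weak_tgrad \<Gamma> \<nu> v g \<longleftrightarrow>
     g \<in> borel_measurable (surface_measure \<Gamma>) \<and>
     integrable (surface_measure \<Gamma>) (\<lambda>x. (norm (g x))\<^sup>2) \<and>
     (AE x in surface_measure \<Gamma>. g x \<bullet> \<nu> x = 0) \<and>
     (\<forall>\<phi> D. (\<forall>x. (\<phi> has_derivative blinfun_apply (D x)) (at x)) \<and> continuous_on UNIV D \<and>
            (\<forall>x\<in>\<Gamma>. \<phi> x \<bullet> \<nu> x = 0) \<longrightarrow>
        (\<exists>c. has_bochner_integral (surface_measure \<Gamma>) (\<lambda>x. v x * surface_div \<nu> (D x) x) c \<and>
             has_bochner_integral (surface_measure \<Gamma>) (\<lambda>x. g x \<bullet> \<phi> x) (- c)))"

definition H1\<Gamma> :: "'a::euclidean_space set \<Rightarrow> ('a \<Rightarrow> 'a) \<Rightarrow> ('a \<Rightarrow> real) set" where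
  "H1\<Gamma> \<Gamma> \<nu> = {v \<in> L2\<Gamma> \<Gamma>. \<exists>g. weak_tgrad \<Gamma> \<nu> v g}"

text \<open>The weak gradient is unique only almost everywhere; the operator \<open>\<nabla>\<^sub>\<Gamma>\<close> picks
  representatives linearly, which is possible by \<open>ex_linear_tgrad\<close> below. Arguments outside
  \<open>H\<^sup>1(\<Gamma>)\<close> are irrelevant.\<close>

definition tgrad ::
  "'a::euclidean_space set \<Rightarrow> ('a \<Rightarrow> 'a) \<Rightarrow> ('a \<Rightarrow> real) \<Rightarrow> 'a \<Rightarrow> 'a" where
  "tgrad \<Gamma> \<nu> = (SOME G. Vector_Spaces.linear fscale fscale G \<and>
                        (\<forall>v\<in>H1\<Gamma> \<Gamma> \<nu>. weak_tgrad \<Gamma> \<nu> v (G v)))"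

definition a_form ::
  "'a::euclidean_space set \<Rightarrow> ('a \<Rightarrow> 'a) \<Rightarrow> ('a \<Rightarrow> real) \<Rightarrow> ('a \<Rightarrow> real) \<Rightarrow> real" where
  "a_form \<Gamma> \<nu> v w = (LINT x|surface_measure \<Gamma>. tgrad \<Gamma> \<nu> v x \<bullet> tgrad \<Gamma> \<nu> w x)"

definition seminormH1\<Gamma> :: "'a::euclidean_space set \<Rightarrow> ('a \<Rightarrow> 'a) \<Rightarrow> ('a \<Rightarrow> real) \<Rightarrow> real" where
  "seminormH1\<Gamma> \<Gamma> \<nu> v = sqrt (LINT x|surface_measure \<Gamma>. (norm (tgrad \<Gamma> \<nu> v x))\<^sup>2)"

definition normH1\<Gamma> :: "'a::euclidean_space set \<Rightarrow> ('a \<Rightarrow> 'a) \<Rightarrow> ('a \<Rightarrow> real) \<Rightarrow> real" where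
  "normH1\<Gamma> \<Gamma> \<nu> v = sqrt ((normL2\<Gamma> \<Gamma> v)\<^sup>2 + (seminormH1\<Gamma> \<Gamma> \<nu> v)\<^sup>2)"

text \<open>The pairing of \<open>F \<in> H\<^sup>-\<^sup>1(\<Gamma>)\<close> with \<open>v \<in> H\<^sup>1(\<Gamma>)\<close> is the application \<open>F v\<close>, and
  \<open>w \<in> L\<^sup>2(\<Gamma>)\<close> is identified with \<open>ip\<Gamma> \<Gamma> w\<close>.\<close>

definition Hm1\<Gamma> :: "'a::euclidean_space set \<Rightarrow> ('a \<Rightarrow> 'a) \<Rightarrow> (('a \<Rightarrow> real) \<Rightarrow> real) set" where
  "Hm1\<Gamma> \<Gamma> \<nu> = {F.
     (\<forall>v\<in>H1\<Gamma> \<Gamma> \<nu>. \<forall>w\<in>H1\<Gamma> \<Gamma> \<nu>. F (v + w) = F v + F w) \<and>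
     (\<forall>v\<in>H1\<Gamma> \<Gamma> \<nu>. \<forall>c. F (fscale c v) = c * F v) \<and>
     (\<exists>B. \<forall>v\<in>H1\<Gamma> \<Gamma> \<nu>. \<bar>F v\<bar> \<le> B * normH1\<Gamma> \<Gamma> \<nu> v)}"

text \<open>As in the library's \<open>onorm\<close>, the supremum may include \<open>v\<close> of norm zero because of
  \<open>x / 0 = 0\<close>.\<close>

definition normHm1\<Gamma> :: "'a::euclidean_space set \<Rightarrow> ('a \<Rightarrow> 'a) \<Rightarrow> (('a \<Rightarrow> real) \<Rightarrow> real) \<Rightarrow> real" where
  "normHm1\<Gamma> \<Gamma> \<nu> F = (SUP v\<in>H1\<Gamma> \<Gamma> \<nu>. \<bar>F v\<bar> / normH1\<Gamma> \<Gamma> \<nu> v)"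


section \<open>Meshes and finite element spaces\<close>

text \<open>Elements are arbitrary regular closed bounded sets with null boundary (in particular
  simplices and other polytopes, without any shape condition).\<close>

definition mesh_around :: "'a::euclidean_space set \<Rightarrow> 'a set set \<Rightarrow> bool" where
  "mesh_around \<Gamma> \<M> \<longleftrightarrow> finite \<M> \<and>
     (\<forall>T\<in>\<M>. T \<noteq> {} \<and> compact T \<and> T = closure (interior T) \<and> negligible (frontier T)) \<and>
     pairwise (\<lambda>S T. interior S \<inter> interior T = {}) \<M> \<and>
     \<Gamma> \<subseteq> interior (\<Union>\<M>)"

definition cut_elements :: "'a set \<Rightarrow> 'a set set \<Rightarrow> 'a set set" where
  "cut_elements \<Gamma> \<M> = {T\<in>\<M>. T \<inter> \<Gamma> \<noteq> {}}"

definition mesh_size :: "'a::metric_space set set \<Rightarrow> real" where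
  "mesh_size \<T> = Max (diameter ` \<T>)"

text \<open>\<open>h\<^sub>T \<le> C (max\<^sub>i \<parallel>\<kappa>\<^sub>i\<parallel>)\<^sup>-\<^sup>1\<close>, no restriction if all curvatures vanish (in
  \<open>ennreal\<close>, \<open>C * inverse 0 = \<infinity>\<close> for \<open>C > 0\<close>), and a well defined closest point projection
  (the library's \<open>closest_point \<Gamma>\<close>) on the union of the elements.\<close>

definition resolves_geometry ::
  "real \<Rightarrow> 'a::euclidean_space set \<Rightarrow> ('a \<Rightarrow> 'a) \<Rightarrow> 'a set set \<Rightarrow> bool" where
  "resolves_geometry C \<Gamma> \<nu> \<T> \<longleftrightarrow>
     (\<forall>T\<in>\<T>. ennreal (diameter T)
              \<le> ennreal C * inverse (Linf_norm_on \<Gamma> T (max_curvature \<Gamma> \<nu>))) \<and>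
     (\<forall>x\<in>\<Union>\<T>. \<exists>!y. y \<in> \<Gamma> \<and> (\<forall>z\<in>\<Gamma>. dist x y \<le> dist x z))"

text \<open>Functions on \<open>\<Omega>\<^sub>h = \<Union>\<T>\<close> are represented by their extension by zero.\<close>

definition fe_space :: "'a::euclidean_space set set \<Rightarrow> ('a \<Rightarrow> real) set \<Rightarrow> bool" where
  "fe_space \<T> V \<longleftrightarrow> (\<exists>B. finite B \<and> V = fun_space.span B) \<and>
     (\<forall>v\<in>V. continuous_on (\<Union>\<T>) v \<and> (\<forall>x. x \<notin> \<Union>\<T> \<longrightarrow> v x = 0) \<and>
        (\<forall>T\<in>\<T>. \<exists>p. real_polynomial_function p \<and> (\<forall>x\<in>T. v x = p x)))"

text \<open>For \<open>v\<close> in a finite element space this is the normal derivative in the interiors of the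
  elements, that is, almost everywhere.\<close>

definition nderiv ::
  "'a::euclidean_space set \<Rightarrow> ('a \<Rightarrow> 'a) \<Rightarrow> ('a \<Rightarrow> real) \<Rightarrow> 'a \<Rightarrow> real" where
  "nderiv \<Gamma> \<nu> v x = frechet_derivative v (at x) (\<nu> (closest_point \<Gamma> x))"

definition s_elem ::
  "'a::euclidean_space set \<Rightarrow> ('a \<Rightarrow> 'a) \<Rightarrow> int \<Rightarrow> 'a set \<Rightarrow> ('a \<Rightarrow> real) \<Rightarrow> ('a \<Rightarrow> real) \<Rightarrow> real" where
  "s_elem \<Gamma> \<nu> j T v w =
     diameter T powi (1 - 2 * j) * (LINT x:T|lebesgue. nderiv \<Gamma> \<nu> v x * nderiv \<Gamma> \<nu> w x)"

definition s_form ::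
  "'a::euclidean_space set \<Rightarrow> ('a \<Rightarrow> 'a) \<Rightarrow> 'a set set \<Rightarrow> int \<Rightarrow> ('a \<Rightarrow> real) \<Rightarrow> ('a \<Rightarrow> real) \<Rightarrow> real" where
  "s_form \<Gamma> \<nu> \<T> j v w = (\<Sum>T\<in>\<T>. s_elem \<Gamma> \<nu> j T v w)"

definition ip_star ::
  "'a::euclidean_space set \<Rightarrow> ('a \<Rightarrow> 'a) \<Rightarrow> 'a set set \<Rightarrow> ('a \<Rightarrow> real) \<Rightarrow> ('a \<Rightarrow> real) \<Rightarrow> real" where
  "ip_star \<Gamma> \<nu> \<T> v w = ip\<Gamma> \<Gamma> v w + s_form \<Gamma> \<nu> \<T> 0 v w"

definition a_star ::
  "'a::euclidean_space set \<Rightarrow> ('a \<Rightarrow> 'a) \<Rightarrow> 'a set set \<Rightarrow> ('a \<Rightarrow> real) \<Rightarrow> ('a \<Rightarrow> real) \<Rightarrow> real" where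
  "a_star \<Gamma> \<nu> \<T> v w = a_form \<Gamma> \<nu> v w + s_form \<Gamma> \<nu> \<T> 1 v w"

definition norm_star ::
  "'a::euclidean_space set \<Rightarrow> ('a \<Rightarrow> 'a) \<Rightarrow> 'a set set \<Rightarrow> ('a \<Rightarrow> real) \<Rightarrow> real" where
  "norm_star \<Gamma> \<nu> \<T> v = sqrt (ip_star \<Gamma> \<nu> \<T> v v)"

definition normH1_star ::
  "'a::euclidean_space set \<Rightarrow> ('a \<Rightarrow> 'a) \<Rightarrow> 'a set set \<Rightarrow> ('a \<Rightarrow> real) \<Rightarrow> real" where
  "normH1_star \<Gamma> \<nu> \<T> v = sqrt ((normH1\<Gamma> \<Gamma> \<nu> v)\<^sup>2 + s_form \<Gamma> \<nu> \<T> 1 v v)"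

definition normL2_star_elem ::
  "'a::euclidean_space set \<Rightarrow> ('a \<Rightarrow> 'a) \<Rightarrow> 'a set \<Rightarrow> ('a \<Rightarrow> real) \<Rightarrow> real" where
  "normL2_star_elem \<Gamma> \<nu> T v =
     sqrt ((LINT x:\<Gamma> \<inter> T|surface_measure \<Gamma>. (v x)\<^sup>2) + s_elem \<Gamma> \<nu> 0 T v v)"

definition inner_product_on :: "('a \<Rightarrow> real) set \<Rightarrow> (('a \<Rightarrow> real) \<Rightarrow> ('a \<Rightarrow> real) \<Rightarrow> real) \<Rightarrow> bool" where
  "inner_product_on V B \<longleftrightarrow>
     (\<forall>u\<in>V. \<forall>v\<in>V. B u v = B v u) \<and>
     (\<forall>u\<in>V. \<forall>v\<in>V. \<forall>w\<in>V. B (u + v) w = B u w + B v w) \<and>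
     (\<forall>u\<in>V. \<forall>v\<in>V. \<forall>c. B (fscale c u) v = c * B u v) \<and>
     (\<forall>u\<in>V. u \<noteq> 0 \<longrightarrow> B u u > 0)"

definition P_h ::
  "'a::euclidean_space set \<Rightarrow> ('a \<Rightarrow> 'a) \<Rightarrow> 'a set set \<Rightarrow> ('a \<Rightarrow> real) set \<Rightarrow>
   (('a \<Rightarrow> real) \<Rightarrow> real) \<Rightarrow> ('a \<Rightarrow> real)" where
  "P_h \<Gamma> \<nu> \<T> V F = (THE p. p \<in> V \<and> (\<forall>v\<in>V. ip_star \<Gamma> \<nu> \<T> p v = F v))"

definition P_h_norm ::
  "'a::euclidean_space set \<Rightarrow> ('a \<Rightarrow> 'a) \<Rightarrow> 'a set set \<Rightarrow> ('a \<Rightarrow> real) set \<Rightarrow> ennreal" where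
  "P_h_norm \<Gamma> \<nu> \<T> V =
     (SUP v\<in>{v \<in> H1\<Gamma> \<Gamma> \<nu>. normH1\<Gamma> \<Gamma> \<nu> v \<noteq> 0}.
        ennreal (normH1_star \<Gamma> \<nu> \<T> (P_h \<Gamma> \<nu> \<T> V (ip\<Gamma> \<Gamma> v)) / normH1\<Gamma> \<Gamma> \<nu> v))"

text \<open>Negative values are cut off by \<open>ennreal\<close>, which does not change the supremum as \<open>w\<close> may
  be replaced by \<open>- w\<close>.\<close>

definition norm_Vm1 ::
  "'a::euclidean_space set \<Rightarrow> ('a \<Rightarrow> 'a) \<Rightarrow> 'a set set \<Rightarrow> ('a \<Rightarrow> real) set \<Rightarrow> ('a \<Rightarrow> real) \<Rightarrow> ennreal" where
  "norm_Vm1 \<Gamma> \<nu> \<T> V v =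
     (SUP w\<in>V - {0}. ennreal (ip_star \<Gamma> \<nu> \<T> v w / normH1_star \<Gamma> \<nu> \<T> w))"

definition C_inv ::
  "'a::euclidean_space set \<Rightarrow> ('a \<Rightarrow> 'a) \<Rightarrow> 'a set set \<Rightarrow> ('a \<Rightarrow> real) set \<Rightarrow> ennreal" where
  "C_inv \<Gamma> \<nu> \<T> V =
     (SUP v\<in>V - {0}.
        ennreal (sqrt (\<Sum>T\<in>\<T>. (diameter T)\<^sup>2 * (normL2_star_elem \<Gamma> \<nu> T v)\<^sup>2))
          / norm_Vm1 \<Gamma> \<nu> \<T> V v)"


section \<open>Bochner spaces on \<open>(0,\<tau>)\<close>\<close>

text \<open>\<open>L\<^sup>2(0,\<tau>;X)\<close> for a space \<open>X\<close> of functions with (semi)norm \<open>N\<close>; the first limit is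
  strong measurability. Elements are representatives, defined up to null sets of times.\<close>

definition L2_time ::
  "real \<Rightarrow> ('c \<Rightarrow> real) set \<Rightarrow> (('c \<Rightarrow> real) \<Rightarrow> real) \<Rightarrow> (real \<Rightarrow> 'c \<Rightarrow> real) set" where
  "L2_time \<tau> X N = {u.
     (AE t in lebesgue_on {0<..<\<tau>}. u t \<in> X) \<and>
     (\<exists>s::nat \<Rightarrow> real \<Rightarrow> 'c \<Rightarrow> real.
        (\<forall>k. simple_function (lebesgue_on {0<..<\<tau>}) (s k) \<and> s k ` {0<..<\<tau>} \<subseteq> X) \<and>
        (AE t in lebesgue_on {0<..<\<tau>}. (\<lambda>k. N (s k t - u t)) \<longlonglongrightarrow> 0)) \<and>
     integrable (lebesgue_on {0<..<\<tau>}) (\<lambda>t. (N (u t))\<^sup>2)}"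

definition continuous_in ::
  "real \<Rightarrow> ('c \<Rightarrow> real) set \<Rightarrow> (('c \<Rightarrow> real) \<Rightarrow> real) \<Rightarrow> (real \<Rightarrow> 'c \<Rightarrow> real) \<Rightarrow> bool" where
  "continuous_in \<tau> X N u \<longleftrightarrow> (\<forall>t\<in>{0..\<tau>}. u t \<in> X) \<and>
     (\<forall>t\<in>{0..\<tau>}. ((\<lambda>s. N (u s - u t)) \<longlongrightarrow> 0) (at t within {0..\<tau>}))"

text \<open>\<open>g\<close> is the weak derivative of \<open>f\<close> on \<open>(0,\<tau>)\<close>; test functions are \<open>C\<^sup>1\<close> with compact
  support.\<close>

definition weak_deriv :: "real \<Rightarrow> (real \<Rightarrow> real) \<Rightarrow> (real \<Rightarrow> real) \<Rightarrow> bool" where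
  "weak_deriv \<tau> f g \<longleftrightarrow>
     (\<forall>\<phi> \<phi>'. (\<forall>t. (\<phi> has_real_derivative \<phi>' t) (at t)) \<and> continuous_on UNIV \<phi>' \<and>
             compact (closure {t. \<phi> t \<noteq> 0}) \<and> closure {t. \<phi> t \<noteq> 0} \<subseteq> {0<..<\<tau>} \<longrightarrow>
        (LINT t|lebesgue_on {0<..<\<tau>}. \<phi>' t * f t) = - (LINT t|lebesgue_on {0<..<\<tau>}. \<phi> t * g t))"

text \<open>Weak time derivative in \<open>H\<^sup>-\<^sup>1(\<Gamma>)\<close> of a function with values in \<open>L\<^sup>2(\<Gamma>)\<close>: an identity
  of \<open>H\<^sup>-\<^sup>1(\<Gamma>)\<close>-valued integrals, that is, of their actions on all \<open>v \<in> H\<^sup>1(\<Gamma>)\<close>.\<close>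

definition is_dt ::
  "'a::euclidean_space set \<Rightarrow> ('a \<Rightarrow> 'a) \<Rightarrow> real \<Rightarrow> (real \<Rightarrow> 'a \<Rightarrow> real) \<Rightarrow>
   (real \<Rightarrow> ('a \<Rightarrow> real) \<Rightarrow> real) \<Rightarrow> bool" where
  "is_dt \<Gamma> \<nu> \<tau> u g \<longleftrightarrow>
     g \<in> L2_time \<tau> (Hm1\<Gamma> \<Gamma> \<nu>) (normHm1\<Gamma> \<Gamma> \<nu>) \<and>
     (\<forall>v\<in>H1\<Gamma> \<Gamma> \<nu>. weak_deriv \<tau> (\<lambda>t. ip\<Gamma> \<Gamma> (u t) v) (\<lambda>t. g t v))"

definition dt ::
  "'a::euclidean_space set \<Rightarrow> ('a \<Rightarrow> 'a) \<Rightarrow> real \<Rightarrow> (real \<Rightarrow> 'a \<Rightarrow> real) \<Rightarrow>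
   real \<Rightarrow> ('a \<Rightarrow> real) \<Rightarrow> real" where
  "dt \<Gamma> \<nu> \<tau> u = (SOME g. is_dt \<Gamma> \<nu> \<tau> u g)"

text \<open>\<open>L\<^sup>2(0,\<tau>;H\<^sup>1(\<Gamma>)) \<inter> H\<^sup>1(0,\<tau>;H\<^sup>-\<^sup>1(\<Gamma>))\<close> embeds into \<open>C([0,\<tau>];L\<^sup>2(\<Gamma>))\<close>; its elements are
  represented by their continuous representatives, so that \<open>u 0\<close> is the initial value.\<close>

definition U_space ::
  "'a::euclidean_space set \<Rightarrow> ('a \<Rightarrow> 'a) \<Rightarrow> real \<Rightarrow> (real \<Rightarrow> 'a \<Rightarrow> real) set" where
  "U_space \<Gamma> \<nu> \<tau> = {u.
     continuous_in \<tau> (L2\<Gamma> \<Gamma>) (normL2\<Gamma> \<Gamma>) u \<and>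
     u \<in> L2_time \<tau> (H1\<Gamma> \<Gamma> \<nu>) (normH1\<Gamma> \<Gamma> \<nu>) \<and>
     (\<exists>g. is_dt \<Gamma> \<nu> \<tau> u g)}"

text \<open>\<open>H\<^sup>1(0,\<tau>;V\<^sub>h)\<close>, again with continuous representatives. As \<open>V\<^sub>h\<close> is a finite-dimensional
  space of functions, an identity of \<open>V\<^sub>h\<close>-valued integrals is one of their point values.\<close>

definition is_dt_h ::
  "'a::euclidean_space set \<Rightarrow> ('a \<Rightarrow> 'a) \<Rightarrow> 'a set set \<Rightarrow> ('a \<Rightarrow> real) set \<Rightarrow> real \<Rightarrow>
   (real \<Rightarrow> 'a \<Rightarrow> real) \<Rightarrow> (real \<Rightarrow> 'a \<Rightarrow> real) \<Rightarrow> bool" where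
  "is_dt_h \<Gamma> \<nu> \<T> V \<tau> u g \<longleftrightarrow>
     g \<in> L2_time \<tau> V (norm_star \<Gamma> \<nu> \<T>) \<and> (\<forall>x. weak_deriv \<tau> (\<lambda>t. u t x) (\<lambda>t. g t x))"

definition dt_h ::
  "'a::euclidean_space set \<Rightarrow> ('a \<Rightarrow> 'a) \<Rightarrow> 'a set set \<Rightarrow> ('a \<Rightarrow> real) set \<Rightarrow> real \<Rightarrow>
   (real \<Rightarrow> 'a \<Rightarrow> real) \<Rightarrow> real \<Rightarrow> 'a \<Rightarrow> real" where
  "dt_h \<Gamma> \<nu> \<T> V \<tau> u = (SOME g. is_dt_h \<Gamma> \<nu> \<T> V \<tau> u g)"

definition U_h_space ::
  "'a::euclidean_space set \<Rightarrow> ('a \<Rightarrow> 'a) \<Rightarrow> 'a set set \<Rightarrow> ('a \<Rightarrow> real) set \<Rightarrow> real \<Rightarrow>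
   (real \<Rightarrow> 'a \<Rightarrow> real) set" where
  "U_h_space \<Gamma> \<nu> \<T> V \<tau> = {u.
     continuous_in \<tau> V (norm_star \<Gamma> \<nu> \<T>) u \<and>
     u \<in> L2_time \<tau> V (norm_star \<Gamma> \<nu> \<T>) \<and>
     (\<exists>g. is_dt_h \<Gamma> \<nu> \<T> V \<tau> u g)}"

definition V_space ::
  "'a::euclidean_space set \<Rightarrow> ('a \<Rightarrow> 'a) \<Rightarrow> real \<Rightarrow> (('a \<Rightarrow> real) \<times> (real \<Rightarrow> 'a \<Rightarrow> real)) set" where
  "V_space \<Gamma> \<nu> \<tau> = L2\<Gamma> \<Gamma> \<times> L2_time \<tau> (H1\<Gamma> \<Gamma> \<nu>) (normH1\<Gamma> \<Gamma> \<nu>)"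

definition V_h_space ::
  "'a::euclidean_space set \<Rightarrow> ('a \<Rightarrow> 'a) \<Rightarrow> 'a set set \<Rightarrow> ('a \<Rightarrow> real) set \<Rightarrow> real \<Rightarrow>
   (('a \<Rightarrow> real) \<times> (real \<Rightarrow> 'a \<Rightarrow> real)) set" where
  "V_h_space \<Gamma> \<nu> \<T> V \<tau> = V \<times> L2_time \<tau> V (norm_star \<Gamma> \<nu> \<T>)"


section \<open>Weak and discrete problems, error functionals\<close>

definition b_form ::
  "'a::euclidean_space set \<Rightarrow> ('a \<Rightarrow> 'a) \<Rightarrow> real \<Rightarrow> (real \<Rightarrow> 'a \<Rightarrow> real) \<Rightarrow>
   ('a \<Rightarrow> real) \<times> (real \<Rightarrow> 'a \<Rightarrow> real) \<Rightarrow> real" where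
  "b_form \<Gamma> \<nu> \<tau> u v = ip\<Gamma> \<Gamma> (u 0) (fst v) +
     (LINT t|lebesgue_on {0<..<\<tau>}. dt \<Gamma> \<nu> \<tau> u t (snd v t) + a_form \<Gamma> \<nu> (u t) (snd v t))"

definition l_form ::
  "'a::euclidean_space set \<Rightarrow> real \<Rightarrow> ('a \<Rightarrow> real) \<Rightarrow> (real \<Rightarrow> ('a \<Rightarrow> real) \<Rightarrow> real) \<Rightarrow>
   ('a \<Rightarrow> real) \<times> (real \<Rightarrow> 'a \<Rightarrow> real) \<Rightarrow> real" where
  "l_form \<Gamma> \<tau> u0 f v = ip\<Gamma> \<Gamma> u0 (fst v) + (LINT t|lebesgue_on {0<..<\<tau>}. f t (snd v t))"

definition b_h_form ::
  "'a::euclidean_space set \<Rightarrow> ('a \<Rightarrow> 'a) \<Rightarrow> 'a set set \<Rightarrow> ('a \<Rightarrow> real) set \<Rightarrow> real \<Rightarrow>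
   (real \<Rightarrow> 'a \<Rightarrow> real) \<Rightarrow> ('a \<Rightarrow> real) \<times> (real \<Rightarrow> 'a \<Rightarrow> real) \<Rightarrow> real" where
  "b_h_form \<Gamma> \<nu> \<T> V \<tau> u v = ip_star \<Gamma> \<nu> \<T> (u 0) (fst v) +
     (LINT t|lebesgue_on {0<..<\<tau>}.
        ip_star \<Gamma> \<nu> \<T> (dt_h \<Gamma> \<nu> \<T> V \<tau> u t) (snd v t) + a_star \<Gamma> \<nu> \<T> (u t) (snd v t))"

definition E_Hm1 ::
  "'a::euclidean_space set \<Rightarrow> ('a \<Rightarrow> 'a) \<Rightarrow> 'a set set \<Rightarrow>
   (('a \<Rightarrow> real) \<Rightarrow> real) \<Rightarrow> ('a \<Rightarrow> real) \<Rightarrow> real" where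
  "E_Hm1 \<Gamma> \<nu> \<T> F w = sqrt ((normHm1\<Gamma> \<Gamma> \<nu> (F - ip\<Gamma> \<Gamma> w))\<^sup>2 + s_form \<Gamma> \<nu> \<T> (- 1) w w)"

definition E_L2 ::
  "'a::euclidean_space set \<Rightarrow> ('a \<Rightarrow> 'a) \<Rightarrow> 'a set set \<Rightarrow> ('a \<Rightarrow> real) \<Rightarrow> ('a \<Rightarrow> real) \<Rightarrow> real" where
  "E_L2 \<Gamma> \<nu> \<T> v w = sqrt ((normL2\<Gamma> \<Gamma> (v - w))\<^sup>2 + s_form \<Gamma> \<nu> \<T> 0 w w)"

definition E_H1 ::
  "'a::euclidean_space set \<Rightarrow> ('a \<Rightarrow> 'a) \<Rightarrow> 'a set set \<Rightarrow> ('a \<Rightarrow> real) \<Rightarrow> ('a \<Rightarrow> real) \<Rightarrow> real" where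
  "E_H1 \<Gamma> \<nu> \<T> v w = sqrt ((seminormH1\<Gamma> \<Gamma> \<nu> (v - w))\<^sup>2 + s_form \<Gamma> \<nu> \<T> 1 w w)"

definition E_err ::
  "'a::euclidean_space set \<Rightarrow> ('a \<Rightarrow> 'a) \<Rightarrow> 'a set set \<Rightarrow> ('a \<Rightarrow> real) set \<Rightarrow> real \<Rightarrow>
   (real \<Rightarrow> 'a \<Rightarrow> real) \<Rightarrow> (real \<Rightarrow> 'a \<Rightarrow> real) \<Rightarrow> real" where
  "E_err \<Gamma> \<nu> \<T> V \<tau> v w = sqrt ((E_L2 \<Gamma> \<nu> \<T> (v 0) (w 0))\<^sup>2 +
     (LINT t|lebesgue_on {0<..<\<tau>}.
        (E_Hm1 \<Gamma> \<nu> \<T> (dt \<Gamma> \<nu> \<tau> v t) (dt_h \<Gamma> \<nu> \<T> V \<tau> w t))\<^sup>2 + (E_H1 \<Gamma> \<nu> \<T> (v t) (w t))\<^sup>2))"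


section \<open>Linear choice of weak gradients\<close>

lemma weak_tgradI:
  assumes "g \<in> borel_measurable (surface_measure \<Gamma>)"
    and "integrable (surface_measure \<Gamma>) (\<lambda>x. (norm (g x))\<^sup>2)"
    and "AE x in surface_measure \<Gamma>. g x \<bullet> \<nu> x = 0"
    and "\<And>\<phi> D. \<forall>x. (\<phi> has_derivative blinfun_apply (D x)) (at x) \<Longrightarrow> continuous_on UNIV D \<Longrightarrow>
      \<forall>x\<in>\<Gamma>. \<phi> x \<bullet> \<nu> x = 0 \<Longrightarrow>
      \<exists>c. has_bochner_integral (surface_measure \<Gamma>) (\<lambda>x. v x * surface_div \<nu> (D x) x) c \<and>
          has_bochner_integral (surface_measure \<Gamma>) (\<lambda>x. g x \<bullet> \<phi> x) (- c)"
  shows "weak_tgrad \<Gamma> \<nu> v g"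
  unfolding weak_tgrad_def
  by (intro conjI allI impI assms(1-3), elim conjE, rule assms(4))

lemma weak_tgradD:
  assumes "weak_tgrad \<Gamma> \<nu> v g"
    and "\<forall>x. (\<phi> has_derivative blinfun_apply (D x)) (at x)" "continuous_on UNIV D"
      "\<forall>x\<in>\<Gamma>. \<phi> x \<bullet> \<nu> x = 0"
  obtains c where "has_bochner_integral (surface_measure \<Gamma>) (\<lambda>x. v x * surface_div \<nu> (D x) x) c"
    "has_bochner_integral (surface_measure \<Gamma>) (\<lambda>x. g x \<bullet> \<phi> x) (- c)"
proof -
  have "\<exists>c. has_bochner_integral (surface_measure \<Gamma>) (\<lambda>x. v x * surface_div \<nu> (D x) x) c \<and>
    has_bochner_integral (surface_measure \<Gamma>) (\<lambda>x. g x \<bullet> \<phi> x) (- c)"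
    using assms(1)[unfolded weak_tgrad_def, THEN conjunct2, THEN conjunct2, THEN conjunct2,
        THEN spec[of _ \<phi>], THEN spec[of _ D]] assms(2-4)
    by (elim mp) (intro conjI)
  then show ?thesis using that by blast
qed

lemma weak_tgrad_add:
  assumes "weak_tgrad \<Gamma> \<nu> v g" "weak_tgrad \<Gamma> \<nu> w k"
  shows "weak_tgrad \<Gamma> \<nu> (v + w) (g + k)"
proof -
  let ?M = "surface_measure \<Gamma>"
  have m: "g \<in> borel_measurable ?M" "k \<in> borel_measurable ?M"
    and i: "integrable ?M (\<lambda>x. (norm (g x))\<^sup>2)" "integrable ?M (\<lambda>x. (norm (k x))\<^sup>2)"
    using assms by (auto simp: weak_tgrad_def)
  have b: "(norm (a + b))\<^sup>2 \<le> 2 * (norm a)\<^sup>2 + 2 * (norm b)\<^sup>2" for a b :: 'a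
  proof -
    have "(norm (a + b))\<^sup>2 \<le> (norm a + norm b)\<^sup>2"
      by (simp add: norm_triangle_ineq power_mono)
    also have "\<dots> \<le> 2 * (norm a)\<^sup>2 + 2 * (norm b)\<^sup>2"
      using zero_le_power2[of "norm a - norm b"] by (simp add: power2_eq_square algebra_simps)
    finally show ?thesis .
  qed
  have m': "(\<lambda>x. g x + k x) \<in> borel_measurable ?M"
    using m by simp
  have "integrable ?M (\<lambda>x. (norm (g x + k x))\<^sup>2)"
    by (rule Bochner_Integration.integrable_bound[where f = "\<lambda>x. 2 * (norm (g x))\<^sup>2 + 2 * (norm (k x))\<^sup>2"])
       (use m' i b in auto)
  moreover have "AE x in ?M. (g x + k x) \<bullet> \<nu> x = 0"
  proof -
    have "AE x in ?M. g x \<bullet> \<nu> x = 0" "AE x in ?M. k x \<bullet> \<nu> x = 0"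
      using assms by (auto simp: weak_tgrad_def)
    then show ?thesis
      by eventually_elim (simp add: inner_add_left)
  qed
  moreover have "\<exists>c. has_bochner_integral ?M (\<lambda>x. (v x + w x) * surface_div \<nu> (D x) x) c \<and>
          has_bochner_integral ?M (\<lambda>x. (g x + k x) \<bullet> \<phi> x) (- c)"
    if hyp: "\<forall>x. (\<phi> has_derivative blinfun_apply (D x)) (at x)" "continuous_on UNIV D"
       "\<forall>x\<in>\<Gamma>. \<phi> x \<bullet> \<nu> x = 0" for \<phi> D
  proof -
    obtain c where c: "has_bochner_integral ?M (\<lambda>x. v x * surface_div \<nu> (D x) x) c"
       "has_bochner_integral ?M (\<lambda>x. g x \<bullet> \<phi> x) (- c)"
      by (rule weak_tgradD[OF assms(1) hyp])
    obtain d where d: "has_bochner_integral ?M (\<lambda>x. w x * surface_div \<nu> (D x) x) d"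
       "has_bochner_integral ?M (\<lambda>x. k x \<bullet> \<phi> x) (- d)"
      by (rule weak_tgradD[OF assms(2) hyp])
    have "- (c + d) = - c + - d" by simp
    then show ?thesis
      using has_bochner_integral_add[OF c(1) d(1)] has_bochner_integral_add[OF c(2) d(2)]
      by (intro exI[of _ "c + d"]) (simp only: distrib_right inner_add_left simp_thms)
  qed
  ultimately show ?thesis
    unfolding plus_fun_def by (intro weak_tgradI m')
qed

lemma weak_tgrad_scale:
  assumes "weak_tgrad \<Gamma> \<nu> v g"
  shows "weak_tgrad \<Gamma> \<nu> (fscale r v) (fscale r g)"
proof -
  let ?M = "surface_measure \<Gamma>"
  have "\<exists>c. has_bochner_integral ?M (\<lambda>x. r * v x * surface_div \<nu> (D x) x) c \<and>
          has_bochner_integral ?M (\<lambda>x. r * (g x \<bullet> \<phi> x)) (- c)"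
    if hyp: "\<forall>x. (\<phi> has_derivative blinfun_apply (D x)) (at x)" "continuous_on UNIV D"
       "\<forall>x\<in>\<Gamma>. \<phi> x \<bullet> \<nu> x = 0" for \<phi> D
  proof -
    obtain c where c: "has_bochner_integral ?M (\<lambda>x. v x * surface_div \<nu> (D x) x) c"
       "has_bochner_integral ?M (\<lambda>x. g x \<bullet> \<phi> x) (- c)"
      by (rule weak_tgradD[OF assms hyp])
    show ?thesis
      using has_bochner_integral_mult_right[of r, OF c(1)] has_bochner_integral_mult_right[of r, OF c(2)]
      by (intro exI[of _ "r * c"]) (simp add: mult.assoc)
  qed
  moreover have "(\<lambda>x. r *\<^sub>R g x) \<in> borel_measurable ?M"
    using assms by (intro borel_measurable_scaleR) (simp_all add: weak_tgrad_def)
  moreover have "integrable ?M (\<lambda>x. (norm (r *\<^sub>R g x))\<^sup>2)"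
    using assms by (simp add: weak_tgrad_def power_mult_distrib)
  moreover have "AE x in ?M. (r *\<^sub>R g x) \<bullet> \<nu> x = 0"
  proof -
    have "AE x in ?M. g x \<bullet> \<nu> x = 0"
      using assms by (simp add: weak_tgrad_def)
    then show ?thesis by eventually_elim simp
  qed
  ultimately show ?thesis
    unfolding fscale_def by (intro weak_tgradI) simp_all
qed

lemma ex_linear_tgrad:
  "\<exists>G. Vector_Spaces.linear fscale fscale G \<and> (\<forall>v\<in>H1\<Gamma> \<Gamma> \<nu>. weak_tgrad \<Gamma> \<nu> v (G v))"
proof -
  interpret vector_space_pair "fscale :: real \<Rightarrow> ('a \<Rightarrow> real) \<Rightarrow> 'a \<Rightarrow> real"
    "fscale :: real \<Rightarrow> ('a \<Rightarrow> 'a) \<Rightarrow> 'a \<Rightarrow> 'a" ..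
  obtain B where B: "B \<subseteq> H1\<Gamma> \<Gamma> \<nu>" "fun_space.independent B" "H1\<Gamma> \<Gamma> \<nu> \<subseteq> fun_space.span B"
    using fun_space.maximal_independent_subset[of "H1\<Gamma> \<Gamma> \<nu>"] by blast
  define g where "g b = (SOME k. weak_tgrad \<Gamma> \<nu> b k)" for b
  have g: "weak_tgrad \<Gamma> \<nu> b (g b)" if bB: "b \<in> B" for b
  proof -
    obtain k where "weak_tgrad \<Gamma> \<nu> b k"
      using B(1) bB by (auto simp: H1\<Gamma>_def)
    then show ?thesis unfolding g_def by (rule someI[where P = "weak_tgrad \<Gamma> \<nu> b"])
  qed
  have lin: "Vector_Spaces.linear fscale fscale (construct B g)"
    by (rule linear_construct[OF B(2)])
  have "weak_tgrad \<Gamma> \<nu> v (construct B g v)" if "v \<in> fun_space.span B" for v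
    using that
  proof (induction rule: fun_space.span_induct_alt)
    case base
    have "weak_tgrad \<Gamma> \<nu> 0 0"
      unfolding zero_fun_def
      by (rule weak_tgradI) (auto intro!: exI[of _ 0] simp: has_bochner_integral_zero)
    then show ?case
      using linear_0[OF lin] by (simp flip: zero_fun_def)
  next
    case (step c x y)
    have "weak_tgrad \<Gamma> \<nu> (fscale c x + y) (fscale c (g x) + construct B g y)"
      by (intro weak_tgrad_add weak_tgrad_scale g step)
    also have "fscale c (g x) + construct B g y = construct B g (fscale c x + y)"
      by (simp only: linear_add[OF lin] linear_scale[OF lin] construct_basis[OF B(2) step(1)])
    finally show ?case .
  qed
  with lin B(3) show ?thesis by blast
qed

end

theory Submission
  imports Defs
begin

text \<open>The convergence follows from quasi-optimality (\<open>quasi_optimality\<close>): there is a constant \<open>K\<close>,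
  independent of the mesh, such that the error of the discrete solution \<open>u\<^sub>h\<close> is at most \<open>K\<close> times the
  error of every competitor \<open>z\<^sub>h\<close>. Taking the infimum over \<open>z\<^sub>h\<close> and using the approximability of
  the solution \<open>u\<close> itself gives the claim.

  For quasi-optimality, let \<open>e = u\<^sub>h - z\<^sub>h\<close> and \<open>d = \<partial>\<^sub>t e\<close>. Testing both problems with indicators in time
  (\<open>galerkin_AE\<close>) shows that at almost every time \<open>(d,w)\<^sub>* + a\<^sub>*(e,w) = r(w)\<close> for all \<open>w\<close> in the discrete
  space, where \<open>\<bar>r(w)\<bar> \<le> \<epsilon> \<parallel>w\<parallel>\<close> in the stabilized \<open>H\<^sup>1\<close> norm and \<open>\<epsilon>\<close> is the sum of the error
  functionals of \<open>z\<^sub>h\<close> at that time (\<open>consistency\<close>). The term \<open>s\<^sub>0(\<partial>\<^sub>t z\<^sub>h, w)\<close> in \<open>r\<close> is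
  controlled because \<open>s\<^sub>0\<close> is a duality between \<open>s\<^sub>-\<^sub>1\<close> and \<open>s\<^sub>1\<close> (\<open>s_form_duality\<close>).

  The choice \<open>w = e\<close> bounds \<open>e\<close> in the stabilized \<open>H\<^sup>1\<close> norm by \<open>\<epsilon>\<close>, up to the term
  \<open>\<parallel>e\<parallel>\<^sub>*\<^sup>2 - (d,e)\<^sub>*\<close>, whose integral with weight \<open>exp (- 2 t)\<close> is at most half the square of the
  initial error (\<open>energy_estimate\<close>). General \<open>w\<close> bounds the discrete dual norm of \<open>d\<close>. From there
  the stability of \<open>P\<^sub>h\<close> yields the \<open>H\<^sup>-\<^sup>1\<close> norm of \<open>d\<close> on \<open>\<Gamma>\<close> (\<open>dual_norm_trace\<close>) and the inverse
  inequality yields \<open>s\<^sub>-\<^sub>1(d,d)\<close> (\<open>dual_norm_stabilization\<close>). Test pairs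
  \<open>(v,0)\<close> bound the initial error (\<open>initial_estimate\<close>).

  The energy estimate needs \<open>2 \<integral> F F' = F(\<tau>)\<^sup>2 - F(0)\<^sup>2\<close> for continuous \<open>F\<close> with an integrable weak
  derivative (\<open>weak_deriv_energy\<close>). It is applied to the coordinates of \<open>e\<close>, which inherit their weak
  derivatives from the point values of \<open>e\<close> through a Lagrange basis (\<open>functional_weak_deriv\<close>).\<close>

section \<open>Weak derivatives on a time interval\<close>

abbreviation time_measure :: "real \<Rightarrow> real measure" where
  "time_measure \<tau> \<equiv> lebesgue_on {0<..<\<tau>}"

lemma finite_measure_time: "finite_measure (time_measure \<tau>)"
  by (rule finite_measure_lebesgue_on) simp

lemma continuous_imp_measurable_time:
  fixes F :: "real \<Rightarrow> real"
  assumes "continuous_on {0..\<tau>} F"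
  shows "F \<in> borel_measurable (time_measure \<tau>)"
  by (rule continuous_imp_measurable_on_sets_lebesgue)
     (auto intro: continuous_on_subset[OF assms])

lemma integrable_time_bounded:
  fixes f :: "real \<Rightarrow> real"
  assumes "f \<in> borel_measurable (time_measure \<tau>)" "\<And>t. t \<in> {0<..<\<tau>} \<Longrightarrow> \<bar>f t\<bar> \<le> B"
  shows "integrable (time_measure \<tau>) f"
  by (rule finite_measure.integrable_const_bound[OF finite_measure_time, where B = B])
     (use assms in auto)

lemma continuous_imp_integrable_time:
  fixes F :: "real \<Rightarrow> real"
  assumes "continuous_on {0..\<tau>} F"
  shows "integrable (time_measure \<tau>) F"
proof -
  have "compact (F ` {0..\<tau>})"
    by (rule compact_continuous_image[OF assms]) simp
  then obtain B where "\<forall>y\<in>F ` {0..\<tau>}. norm y \<le> B"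
    using compact_imp_bounded bounded_iff by metis
  then show ?thesis
    by (intro integrable_time_bounded[where B = B] continuous_imp_measurable_time assms) auto
qed

text \<open>Test functions have to be continuously differentiable, so the step below is assembled from
  second differences of \<open>max 0 x\<close> squared, which is differentiable everywhere.\<close>

definition pos_square :: "real \<Rightarrow> real" where
  "pos_square x = (max 0 x)\<^sup>2"

lemma pos_square_deriv: "(pos_square has_real_derivative 2 * max 0 x) (at x)"
proof (cases x "0::real" rule: linorder_cases)
  case less
  show ?thesis
    by (rule has_field_derivative_transform_within_open[where f = "\<lambda>_. 0" and S = "{..<0}"])
       (use less in \<open>auto simp: pos_square_def\<close>)
next
  case equal
  have "((\<lambda>h. (pos_square (0 + h) - pos_square 0) / h) \<longlongrightarrow> 0) (at 0)"
  proof (rule Lim_null_comparison[where g = "\<lambda>h. \<bar>h\<bar>"])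
    show "\<forall>\<^sub>F h in at 0. norm ((pos_square (0 + h) - pos_square 0) / h) \<le> \<bar>h\<bar>"
      by (intro always_eventually allI) (auto simp: pos_square_def max_def power2_eq_square)
    show "((\<lambda>h::real. \<bar>h\<bar>) \<longlongrightarrow> 0) (at 0)"
      by (auto intro!: tendsto_eq_intros)
  qed
  then show ?thesis using equal by (simp add: DERIV_def)
next
  case greater
  show ?thesis
    by (rule has_field_derivative_transform_within_open[where f = "\<lambda>x. x\<^sup>2" and S = "{0<..}"])
       (use greater in \<open>auto simp: pos_square_def intro!: derivative_eq_intros\<close>)
qed

text \<open>The step rises from 0 to 1 on \<open>[0,1]\<close>; its derivative is the hat function.\<close>

definition smooth_step :: "real \<Rightarrow> real" where
  "smooth_step x = 2 * (pos_square x - 2 * pos_square (x - 1/2) + pos_square (x - 1))"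

definition hat :: "real \<Rightarrow> real" where
  "hat x = 4 * (max 0 x - 2 * max 0 (x - 1/2) + max 0 (x - 1))"

lemma smooth_step_deriv: "(smooth_step has_real_derivative hat x) (at x)"
proof -
  have shift: "((\<lambda>x. pos_square (x - c)) has_real_derivative 2 * max 0 (x - c)) (at x)" for c
    by (rule DERIV_chain2[where f = pos_square and g = "\<lambda>x. x - c" and Db = 1 and s = UNIV, simplified])
       (auto intro!: derivative_eq_intros pos_square_deriv)
  show ?thesis
    unfolding smooth_step_def [abs_def] hat_def
    by (rule derivative_eq_intros pos_square_deriv shift refl | simp)+
qed

lemma smooth_step_eq_0: "x \<le> 0 \<Longrightarrow> smooth_step x = 0"
  by (simp add: smooth_step_def pos_square_def)

lemma smooth_step_eq_1: "x \<ge> 1 \<Longrightarrow> smooth_step x = 1"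
  by (simp add: smooth_step_def pos_square_def max_def power2_eq_square algebra_simps)

lemma hat_nonneg: "hat x \<ge> 0"
  by (auto simp: hat_def max_def)

lemma hat_eq_0: "x \<le> 0 \<or> x \<ge> 1 \<Longrightarrow> hat x = 0"
  by (auto simp: hat_def max_def)

lemma continuous_on_hat [continuous_intros]:
  "continuous_on A f \<Longrightarrow> continuous_on A (\<lambda>x. hat (f x))"
  unfolding hat_def by (intro continuous_intros)

lemma smooth_step_mono: "x \<le> y \<Longrightarrow> smooth_step x \<le> smooth_step y"
  by (rule DERIV_nonneg_imp_nondecreasing) (use smooth_step_deriv hat_nonneg in blast)+

lemma smooth_step_bounds: "0 \<le> smooth_step x" "smooth_step x \<le> 1"
  using smooth_step_mono[of "min 0 x" x] smooth_step_mono[of x "max 1 x"]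
    smooth_step_eq_0[of "min 0 x"] smooth_step_eq_1[of "max 1 x"] by auto

lemma continuous_on_smooth_step [continuous_intros]:
  "continuous_on A f \<Longrightarrow> continuous_on A (\<lambda>x. smooth_step (f x))"
  unfolding smooth_step_def pos_square_def by (intro continuous_intros)

lemma scaled_step_deriv:
  "((\<lambda>t. smooth_step (n * (t - a))) has_real_derivative n * hat (n * (t - a))) (at t)"
proof -
  have "((\<lambda>t. n * (t - a)) has_real_derivative n) (at t)"
    by (auto intro!: derivative_eq_intros)
  then have "((\<lambda>t. smooth_step (n * (t - a))) has_real_derivative hat (n * (t - a)) * n) (at t)"
    by (rule DERIV_chain2[where f = smooth_step, OF smooth_step_deriv])
  then show ?thesis by (simp add: mult.commute)
qed

lemma scaled_hat_mass:
  assumes "0 < a" "a + 1 / n \<le> \<tau>" "n > 0"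
  shows "(LINT t|time_measure \<tau>. n * hat (n * (t - a))) = 1"
proof -
  have "1 / n > 0" using assms by simp
  then have "0 < \<tau>" using assms by linarith
  have n: "n * (0 - a) \<le> 0" "n * (\<tau> - a) \<ge> 1"
    using assms by (auto simp: field_simps)
  have int: "integrable (time_measure \<tau>) (\<lambda>t. n * hat (n * (t - a)))"
    by (intro continuous_imp_integrable_time continuous_intros)
  have "((\<lambda>t. n * hat (n * (t - a))) has_integral
          (smooth_step (n * (\<tau> - a)) - smooth_step (n * (0 - a)))) {0..\<tau>}"
    by (rule fundamental_theorem_of_calculus)
       (use \<open>0 < \<tau>\<close> scaled_step_deriv in \<open>auto simp: has_real_derivative_iff_has_vector_derivative[symmetric] intro: has_field_derivative_at_within\<close>)
  then have "((\<lambda>t. n * hat (n * (t - a))) has_integral 1) {0<..<\<tau>}"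
    using smooth_step_eq_0[OF n(1)] smooth_step_eq_1[OF n(2)]
    by (simp add: has_integral_Icc_iff_Ioo)
  then show ?thesis
    by (subst lebesgue_integral_eq_integral[OF int]) (simp, rule integral_unique)
qed

text \<open>The scaled hats on \<open>[a, a + 1/n]\<close> form an approximate identity.\<close>

lemma scaled_hat_average:
  fixes F :: "real \<Rightarrow> real"
  assumes F: "continuous_on {0..\<tau>} F" and a: "0 < a" "a < \<tau>"
  shows "(\<lambda>n. LINT t|time_measure \<tau>. (real n * hat (real n * (t - a))) * F t) \<longlonglongrightarrow> F a"
proof (rule LIMSEQ_I)
  fix r :: real assume "r > 0"
  have "a \<in> {0..\<tau>}" using a by auto
  with F \<open>r > 0\<close> obtain d where d: "d > 0" "\<And>t. t \<in> {0..\<tau>} \<Longrightarrow> dist t a < d \<Longrightarrow> dist (F t) (F a) < r/2"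
    unfolding continuous_on_iff by (metis half_gt_zero)
  obtain N where N: "real N > max (1/d) (1/(\<tau> - a))" using reals_Archimedean2 by blast
  show "\<exists>no. \<forall>n\<ge>no. norm ((LINT t|time_measure \<tau>. (real n * hat (real n * (t - a))) * F t) - F a) < r"
  proof (intro exI allI impI)
    fix n assume "n \<ge> N"
    then have n: "real n > 1/d" "real n > 1/(\<tau> - a)" using N by linarith+
    moreover have "1/d > 0" using d by simp
    ultimately have n0: "real n > 0" by linarith
    have nd: "1 / real n < d" "1 / real n < \<tau> - a" using n n0 d a by (auto simp: field_simps)
    let ?k = "\<lambda>t. real n * hat (real n * (t - a))"
    have mass: "(LINT t|time_measure \<tau>. ?k t) = 1"
      using n0 a nd by (intro scaled_hat_mass) auto
    have k: "integrable (time_measure \<tau>) ?k"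
      by (intro continuous_imp_integrable_time continuous_intros)
    have kF: "integrable (time_measure \<tau>) (\<lambda>t. ?k t * F t)"
      by (intro continuous_imp_integrable_time continuous_intros F)
    have "(LINT t|time_measure \<tau>. ?k t * F t) - F a
        = (LINT t|time_measure \<tau>. ?k t * F t) - (LINT t|time_measure \<tau>. ?k t * F a)"
      using mass by simp
    also have "\<dots> = (LINT t|time_measure \<tau>. ?k t * (F t - F a))"
      using k kF by (subst Bochner_Integration.integral_diff[symmetric]) (auto simp: algebra_simps)
    finally have diff: "(LINT t|time_measure \<tau>. ?k t * F t) - F a
        = (LINT t|time_measure \<tau>. ?k t * (F t - F a))" .
    have "norm (LINT t|time_measure \<tau>. ?k t * (F t - F a)) \<le> (LINT t|time_measure \<tau>. ?k t * (r/2))"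
    proof (rule Bochner_Integration.integral_norm_bound_integral)
      show "integrable (time_measure \<tau>) (\<lambda>t. ?k t * (F t - F a))"
        by (intro continuous_imp_integrable_time continuous_intros F)
      show "integrable (time_measure \<tau>) (\<lambda>t. ?k t * (r/2))" using k by simp
      fix t assume t: "t \<in> space (time_measure \<tau>)"
      show "norm (?k t * (F t - F a)) \<le> ?k t * (r/2)"
      proof (cases "t \<in> {a..a + 1 / real n}")
        case True
        then have "dist (F t) (F a) < r/2" using nd t by (intro d) (auto simp: dist_real_def)
        then show ?thesis using hat_nonneg[of "real n * (t - a)"] n0
          by (auto simp: abs_mult dist_real_def intro!: mult_left_mono)
      next
        case False
        then have "real n * (t - a) \<le> 0 \<or> real n * (t - a) \<ge> 1"
          using n0 by (auto simp: field_simps mult_le_0_iff)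
        then show ?thesis by (simp add: hat_eq_0)
      qed
    qed
    also have "\<dots> = r/2" using mass by simp
    also have "\<dots> < r" using \<open>r > 0\<close> by simp
    finally show "norm ((LINT t|time_measure \<tau>. ?k t * F t) - F a) < r" unfolding diff .
  qed
qed

text \<open>A continuous function with weak derivative \<open>G\<close> is an antiderivative of \<open>G\<close> (du Bois-Reymond).
  The test functions are smoothed indicators of \<open>(a,b]\<close>.\<close>

lemma weak_deriv_increment_interior:
  assumes F: "continuous_on {0..\<tau>} F" and G: "integrable (time_measure \<tau>) G"
    and wd: "weak_deriv \<tau> F G" and ab: "0 < a" "a \<le> b" "b < \<tau>"
  shows "F b - F a = (LINT t|time_measure \<tau>. indicator {a<..b} t * G t)"
proof -
  define \<phi> where "\<phi> n t = smooth_step (real n * (t - a)) - smooth_step (real n * (t - b))" for n t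
  define \<psi> where "\<psi> n t = real n * hat (real n * (t - a)) - real n * hat (real n * (t - b))" for n t
  have lim1: "(\<lambda>n. LINT t|time_measure \<tau>. \<psi> n t * F t) \<longlonglongrightarrow> F a - F b"
  proof -
    have "(LINT t|time_measure \<tau>. \<psi> n t * F t) =
      (LINT t|time_measure \<tau>. (real n * hat (real n * (t - a))) * F t)
      - (LINT t|time_measure \<tau>. (real n * hat (real n * (t - b))) * F t)" for n
      unfolding \<psi>_def left_diff_distrib
      by (rule Bochner_Integration.integral_diff)
         (intro continuous_imp_integrable_time continuous_intros F)+
    then show ?thesis
      using ab by (auto intro!: tendsto_diff scaled_hat_average F)
  qed
  have pm: "\<phi> n \<in> borel_measurable (time_measure \<tau>)" for n
    unfolding \<phi>_def by (intro continuous_imp_measurable_time continuous_intros)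
  have Gm: "G \<in> borel_measurable (time_measure \<tau>)" using G by simp
  have lim2: "(\<lambda>n. LINT t|time_measure \<tau>. \<phi> n t * G t) \<longlonglongrightarrow> (LINT t|time_measure \<tau>. indicator {a<..b} t * G t)"
  proof (rule integral_dominated_convergence[where w = "\<lambda>t. \<bar>G t\<bar>"])
    show "integrable (time_measure \<tau>) (\<lambda>t. \<bar>G t\<bar>)" using G by simp
    have ev: "\<forall>\<^sub>F n in sequentially. smooth_step (real n * (t - c)) = indicator {c<..} t" for t c
    proof (cases "t \<le> c")
      case True
      then show ?thesis by (auto simp: smooth_step_eq_0 mult_le_0_iff)
    next
      case False
      obtain N where "real N > 1/(t - c)" using reals_Archimedean2 by blast
      then have N: "1 < real N * (t - c)" using False by (simp add: field_simps)
      have "real n * (t - c) \<ge> 1" if "n \<ge> N" for n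
      proof -
        have "real N * (t - c) \<le> real n * (t - c)" using that False by (intro mult_right_mono) auto
        then show ?thesis using N by linarith
      qed
      then show ?thesis using False
        by (intro eventually_sequentiallyI[of N]) (auto simp: smooth_step_eq_1)
    qed
    have "(\<lambda>n. \<phi> n t * G t) \<longlonglongrightarrow> indicator {a<..b} t * G t" for t
    proof (rule tendsto_eventually)
      show "\<forall>\<^sub>F n in sequentially. \<phi> n t * G t = indicator {a<..b} t * G t"
        using ev[of t a] ev[of t b]
        by eventually_elim (use ab in \<open>auto simp: \<phi>_def indicator_def\<close>)
    qed
    then show "AE t in time_measure \<tau>. (\<lambda>n. \<phi> n t * G t) \<longlonglongrightarrow> indicator {a<..b} t * G t" by simp
    have "\<bar>\<phi> n t\<bar> \<le> 1" for n t
      using smooth_step_bounds[of "real n * (t - a)"] smooth_step_bounds[of "real n * (t - b)"]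
      unfolding \<phi>_def by linarith
    then show "AE t in time_measure \<tau>. norm (\<phi> n t * G t) \<le> \<bar>G t\<bar>" for n
      by (simp add: abs_mult mult_left_le_one_le)
    show "(\<lambda>t. \<phi> n t * G t) \<in> borel_measurable (time_measure \<tau>)" for n
      by (intro borel_measurable_times pm Gm)
    have "indicator {a<..b} \<in> borel_measurable (time_measure \<tau>)"
      by (intro borel_measurable_indicator) (use ab in \<open>auto simp: sets_restrict_space_iff\<close>)
    then show "(\<lambda>t. indicator {a<..b} t * G t) \<in> borel_measurable (time_measure \<tau>)"
      by (intro borel_measurable_times Gm)
  qed
  \<comment> \<open>For large \<open>n\<close> the support of \<open>\<phi> n\<close>, which exceeds \<open>b\<close> by \<open>1/n\<close>, stays inside the interval.\<close>
  have eq: "\<forall>\<^sub>F n in sequentially. (LINT t|time_measure \<tau>. \<psi> n t * F t) = - (LINT t|time_measure \<tau>. \<phi> n t * G t)"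
  proof -
    obtain N where N: "real N > 1/(\<tau> - b)" using reals_Archimedean2 by blast
    show ?thesis
    proof (rule eventually_sequentiallyI[of N])
      fix n assume "N \<le> n"
      then have n: "real n > 1/(\<tau> - b)" using N by linarith
      moreover have "1/(\<tau> - b) > 0" using ab by simp
      ultimately have n0: "real n > 0" by linarith
      have "b + 1 / real n < \<tau>" using n n0 ab by (auto simp: field_simps)
      have "\<phi> n t = 0" if "t \<notin> {a..b + 1 / real n}" for t
      proof -
        have "t < a \<or> t > b + 1 / real n" using that by auto
        then show ?thesis
        proof
          assume "t < a"
          then show ?thesis using n0 ab by (simp add: \<phi>_def smooth_step_eq_0 mult_le_0_iff)
        next
          assume t: "t > b + 1 / real n"
          then have b: "real n * (t - b) \<ge> 1" using n0 by (simp add: field_simps)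
          moreover have "real n * (t - a) \<ge> real n * (t - b)" using ab n0 by (intro mult_left_mono) auto
          ultimately show ?thesis by (simp add: \<phi>_def smooth_step_eq_1)
        qed
      qed
      then have "{t. \<phi> n t \<noteq> 0} \<subseteq> {a..b + 1 / real n}" by blast
      then have cl: "closure {t. \<phi> n t \<noteq> 0} \<subseteq> {a..b + 1 / real n}"
        by (rule closure_minimal) simp
      then have "compact (closure {t. \<phi> n t \<noteq> 0})"
        by (meson bounded_closed_interval bounded_subset closed_closure compact_eq_bounded_closed)
      moreover have "closure {t. \<phi> n t \<noteq> 0} \<subseteq> {0<..<\<tau>}"
        using cl ab \<open>b + 1 / real n < \<tau>\<close> by auto
      moreover have "\<forall>t. (\<phi> n has_real_derivative \<psi> n t) (at t)"
        unfolding \<phi>_def [abs_def] \<psi>_def by (intro allI DERIV_diff scaled_step_deriv)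
      moreover have "continuous_on UNIV (\<psi> n)"
        unfolding \<psi>_def by (intro continuous_intros)
      ultimately show "(LINT t|time_measure \<tau>. \<psi> n t * F t) = - (LINT t|time_measure \<tau>. \<phi> n t * G t)"
        using wd unfolding weak_deriv_def by blast
    qed
  qed
  have "(\<lambda>n. LINT t|time_measure \<tau>. \<psi> n t * F t) \<longlonglongrightarrow> - (LINT t|time_measure \<tau>. indicator {a<..b} t * G t)"
    using tendsto_minus[OF lim2] eq by (simp add: tendsto_cong)
  with lim1 have "F a - F b = - (LINT t|time_measure \<tau>. indicator {a<..b} t * G t)"
    by (rule LIMSEQ_unique)
  then show ?thesis by simp
qed

lemma weak_deriv_increment:
  assumes F: "continuous_on {0..\<tau>} F" and G: "integrable (time_measure \<tau>) G"
    and wd: "weak_deriv \<tau> F G" and t: "0 \<le> t" "t \<le> \<tau>"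
  shows "F t - F 0 = (LINT s|time_measure \<tau>. indicator {..<t} s * G s)"
proof (cases "t = 0")
  case True
  have "(LINT s|time_measure \<tau>. indicator {..<t} s * G s) = (LINT s|time_measure \<tau>. 0)"
    using True by (intro Bochner_Integration.integral_cong) auto
  then show ?thesis using True by simp
next
  case False
  then have t0: "t > 0" using t by simp
  define a where "a n = t / (real n + 3)" for n
  define b where "b n = t - t / (real n + 3)" for n
  have ab: "0 < a n" "a n \<le> b n" "b n < \<tau>" "b n < t" for n
  proof -
    have q: "t / (real n + 3) > 0" "2 * t / (real n + 3) \<le> t" using t0 by (auto simp: field_simps)
    then show "0 < a n" "a n \<le> b n" "b n < \<tau>" "b n < t"
      using t by (simp_all add: a_def b_def)
  qed
  have "filterlim (\<lambda>n. 3 + real n) at_top sequentially"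
    by (rule filterlim_tendsto_add_at_top[OF tendsto_const filterlim_real_sequentially])
  then have a0: "a \<longlonglongrightarrow> 0"
    unfolding a_def
    by (intro real_tendsto_divide_at_top[OF tendsto_const]) (simp add: add.commute)
  have bt: "b \<longlonglongrightarrow> t"
    using tendsto_diff[OF tendsto_const[of t] a0] by (simp add: a_def b_def [abs_def])
  have cF: "(\<lambda>n. F (c n)) \<longlonglongrightarrow> F l" if "c \<longlonglongrightarrow> l" "\<And>n. c n \<in> {0..\<tau>}" "l \<in> {0..\<tau>}" for c l
    using continuous_on_tendsto_compose[OF F that(1)] that by auto
  have "b n \<in> {0..\<tau>}" "a n \<in> {0..\<tau>}" for n using ab[of n] by auto
  then have "(\<lambda>n. F (b n) - F (a n)) \<longlonglongrightarrow> F t - F 0"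
    using t by (intro tendsto_diff cF a0 bt) auto
  moreover have "(\<lambda>n. LINT s|time_measure \<tau>. indicator {a n<..b n} s * G s)
      \<longlonglongrightarrow> (LINT s|time_measure \<tau>. indicator {..<t} s * G s)"
  proof (rule integral_dominated_convergence[where w = "\<lambda>t. \<bar>G t\<bar>"])
    have Gm: "G \<in> borel_measurable (time_measure \<tau>)" using G by simp
    have m: "indicator A \<in> borel_measurable (time_measure \<tau>)" if "A \<in> sets borel" for A :: "real set"
      using that by (intro measurable_restrict_space1 borel_measurable_indicator) auto
    show "(\<lambda>s. indicator {..<t} s * G s) \<in> borel_measurable (time_measure \<tau>)"
      "(\<lambda>s. indicator {a n<..b n} s * G s) \<in> borel_measurable (time_measure \<tau>)" for n
      by (intro borel_measurable_times Gm m; simp)+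
    show "integrable (time_measure \<tau>) (\<lambda>t. \<bar>G t\<bar>)" using G by simp
    show "AE s in time_measure \<tau>. norm (indicator {a n<..b n} s * G s) \<le> \<bar>G s\<bar>" for n
      by (auto simp: indicator_def)
    show "AE s in time_measure \<tau>. (\<lambda>n. indicator {a n<..b n} s * G s) \<longlonglongrightarrow> indicator {..<t} s * G s"
    proof (rule AE_I2, rule tendsto_eventually)
      fix s assume "s \<in> space (time_measure \<tau>)"
      then have s: "s > 0" by simp
      show "\<forall>\<^sub>F n in sequentially. indicator {a n<..b n} s * G s = indicator {..<t} s * G s"
      proof (cases "s < t")
        case True
        show ?thesis
          using order_tendstoD(2)[OF a0 s] order_tendstoD(1)[OF bt True]
          by eventually_elim (use True in auto)
      next
        case False
        have "s > b n" for n using ab(4)[of n] False by linarith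
        then have "indicator {a n<..b n} s = (0::real)" for n by (simp add: indicator_def not_le)
        then show ?thesis using False by simp
      qed
    qed
  qed
  moreover have "F (b n) - F (a n) = (LINT s|time_measure \<tau>. indicator {a n<..b n} s * G s)" for n
    by (rule weak_deriv_increment_interior[OF F G wd]) (use ab in auto)
  ultimately show ?thesis by (simp add: LIMSEQ_unique)
qed

text \<open>The chain rule \<open>(F\<^sup>2)' = 2 F F'\<close> in integrated form. With \<open>F t = F 0 + \<integral>\<^sub>0\<^sup>t G\<close> it reduces to
  the fact that the double integral of \<open>G s * G t\<close> over the triangle \<open>s < t\<close> is half of the one over
  the square.\<close>

lemma weak_deriv_energy:
  assumes F: "continuous_on {0..\<tau>} F" and G: "integrable (time_measure \<tau>) G"
    and wd: "weak_deriv \<tau> F G" and "0 < \<tau>"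
  shows "2 * (LINT t|time_measure \<tau>. F t * G t) = (F \<tau>)\<^sup>2 - (F 0)\<^sup>2"
proof -
  let ?M = "time_measure \<tau>"
  interpret M: finite_measure ?M by (rule finite_measure_time)
  interpret P: pair_sigma_finite ?M ?M ..
  have Gm [measurable]: "G \<in> borel_measurable ?M" using G by simp
  have id [measurable]: "(\<lambda>x. x) \<in> borel_measurable ?M"
    by (intro continuous_imp_measurable_time continuous_intros)
  define f where "f s t = (if s < t then G s * G t else 0)" for s t
  have fm [measurable]: "(\<lambda>(s, t). f s t) \<in> borel_measurable (?M \<Otimes>\<^sub>M ?M)"
    unfolding f_def by measurable
  have GG: "integrable (?M \<Otimes>\<^sub>M ?M) (\<lambda>(s, t). G s * G t)"
  proof (rule P.Fubini_integrable)
    show "integrable ?M (\<lambda>s. LINT t|?M. norm (case (s, t) of (s, t) \<Rightarrow> G s * G t))"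
      using G by (simp add: abs_mult)
    show "AE s in ?M. integrable ?M (\<lambda>t. case (s, t) of (s, t) \<Rightarrow> G s * G t)"
      using G by simp
  qed measurable
  have fi: "integrable (?M \<Otimes>\<^sub>M ?M) (\<lambda>(s, t). f s t)"
    by (rule Bochner_Integration.integrable_bound[OF GG fm]) (auto simp: f_def)
  have fi': "integrable (?M \<Otimes>\<^sub>M ?M) (\<lambda>(t, s). f s t)"
    using P.integrable_product_swap[OF fi] by (simp add: case_prod_unfold)
  have inner: "(LINT s|?M. f s t) = G t * (F t - F 0)" if "t \<in> {0<..<\<tau>}" for t
  proof -
    have "(LINT s|?M. f s t) = (LINT s|?M. G t * (indicator {..<t} s * G s))"
      by (intro Bochner_Integration.integral_cong) (auto simp: f_def indicator_def)
    also have "\<dots> = G t * (F t - F 0)"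
      using that by (subst weak_deriv_increment[OF F G wd]) auto
    finally show ?thesis .
  qed
  have FG: "integrable ?M (\<lambda>t. G t * (F t - F 0))"
    using P.integrable_fst'[OF fi'] inner by (subst Bochner_Integration.integrable_cong[OF refl, of _ _ "\<lambda>t. LINT s|?M. f s t"]) auto
  have tot: "F \<tau> - F 0 = (LINT t|?M. G t)"
    using \<open>0 < \<tau>\<close> by (subst weak_deriv_increment[OF F G wd])
      (auto intro!: Bochner_Integration.integral_cong)
  define I where "I = (LINT t|?M. LINT s|?M. f s t)"
  have I1: "I = (LINT t|?M. G t * (F t - F 0))"
    unfolding I_def by (intro Bochner_Integration.integral_cong) (auto simp: inner)
  have I2: "I = (LINT s|?M. LINT t|?M. f s t)"
    unfolding I_def by (rule P.Fubini_integral[OF fi])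
  have "2 * I = (LINT t|?M. (LINT s|?M. f s t) + (LINT s|?M. f t s))"
    using P.integrable_fst'[OF fi'] P.integrable_fst'[OF fi] I2
    by (subst Bochner_Integration.integral_add) (auto simp: I_def)
  also have "\<dots> = (LINT t|?M. (F \<tau> - F 0) * G t)"
  proof (rule integral_cong_AE)
    show "AE t in ?M. (LINT s|?M. f s t) + (LINT s|?M. f t s) = (F \<tau> - F 0) * G t"
      using P.AE_integrable_fst'[OF fi'] P.AE_integrable_fst'[OF fi]
    proof eventually_elim
      fix t assume t: "integrable ?M (\<lambda>s. case (t, s) of (t, s) \<Rightarrow> f s t)"
        "integrable ?M (\<lambda>s. case (t, s) of (s, t) \<Rightarrow> f s t)"
      have "{t} \<in> null_sets lebesgue" using negligible_iff_null_sets negligible_sing by blast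
      then have "AE s in lebesgue. s \<noteq> t" by (rule AE_I') auto
      then have ne: "AE s in ?M. s \<noteq> t" by (subst AE_restrict_space_iff) (auto elim: eventually_mono)
      have "(LINT s|?M. f s t) + (LINT s|?M. f t s) = (LINT s|?M. f s t + f t s)"
        using t by (subst Bochner_Integration.integral_add) auto
      also have "\<dots> = (LINT s|?M. G t * G s)"
      proof (rule integral_cong_AE)
        show "AE s in ?M. f s t + f t s = G t * G s"
          using ne by eventually_elim (auto simp: f_def)
      qed (use t G in auto)
      finally show "(LINT s|?M. f s t) + (LINT s|?M. f t s) = (F \<tau> - F 0) * G t"
        by (simp add: tot)
    qed
  qed (use G in auto)
  also have "\<dots> = (F \<tau> - F 0)\<^sup>2"
    using tot by (simp add: power2_eq_square)
  finally have 2: "2 * I = (F \<tau> - F 0)\<^sup>2" .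
  have "(LINT t|?M. F t * G t) = (LINT t|?M. G t * (F t - F 0) + F 0 * G t)"
    by (intro Bochner_Integration.integral_cong) (auto simp: algebra_simps)
  also have "\<dots> = I + F 0 * (F \<tau> - F 0)"
    using FG G by (subst Bochner_Integration.integral_add) (auto simp: I1 tot)
  finally show ?thesis using 2 by (simp add: power2_eq_square algebra_simps)
qed

section \<open>Finite-dimensional spaces of functions\<close>

lemma minus_fscale: "u - v = u + fscale (- 1) v"
  by (rule ext) (simp add: fscale_def)

lemma sum_fscale_apply:
  fixes e :: "'i \<Rightarrow> 'a \<Rightarrow> real"
  shows "(\<Sum>i\<in>I. fscale (c i) (e i)) x = (\<Sum>i\<in>I. c i * e i x)"
  by (induction I rule: infinite_finite_induct) (auto simp: fscale_def)

lemma span_insert_reduced: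
  fixes b :: "'a \<Rightarrow> real"
  assumes "v \<in> fun_space.span (insert b B)" "b - b' \<in> fun_space.span B"
  obtains c w where "w \<in> fun_space.span B" "v = fscale c b' + w"
proof -
  obtain c where c: "v - fscale c b \<in> fun_space.span B"
    using assms(1) unfolding fun_space.span_insert by blast
  have "v = fscale c b' + ((v - fscale c b) + fscale c (b - b'))"
    by (auto simp: fscale_def fun_eq_iff algebra_simps)
  then show ?thesis
    using c assms(2) by (intro that[of "(v - fscale c b) + fscale c (b - b')" c])
      (auto intro: fun_space.span_add fun_space.span_scale)
qed

text \<open>A finite-dimensional space of functions has a Lagrange basis: its elements are determined,
  linearly, by their values at finitely many points.\<close>

lemma nodal_basis:
  fixes B :: "('a \<Rightarrow> real) set"
  assumes "finite B"
  shows "\<exists>P e. finite P \<and> (\<forall>p\<in>P. e p \<in> fun_space.span B) \<and>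
    (\<forall>p\<in>P. \<forall>q\<in>P. e p q = (if p = q then 1 else 0)) \<and>
    (\<forall>v\<in>fun_space.span B. v = (\<Sum>p\<in>P. fscale (v p) (e p)))"
  using assms
proof (induction B)
  case empty
  show ?case by (intro exI[of _ "{}"]) simp
next
  case (insert b B)
  from insert.IH obtain P e where fP: "finite P" and eB': "\<forall>p\<in>P. e p \<in> fun_space.span B"
    and \<delta>': "\<forall>p\<in>P. \<forall>q\<in>P. e p q = (if p = q then 1 else 0)"
    and ex': "\<forall>v\<in>fun_space.span B. v = (\<Sum>p\<in>P. fscale (v p) (e p))"
    by (elim exE conjE) (rule that)
  note eB = eB'[rule_format] and \<delta> = \<delta>'[rule_format] and ex = ex'[rule_format]
  define r where "r = (\<Sum>p\<in>P. fscale (b p) (e p))"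
  define b' where "b' = b - r"
  have r: "r \<in> fun_space.span B"
    unfolding r_def by (intro fun_space.span_sum fun_space.span_scale eB)
  have b'P: "b' q = 0" if "q \<in> P" for q
    using that fP by (simp add: b'_def r_def sum_fscale_apply \<delta> if_distrib sum.delta cong: if_cong)
  show ?case
  proof (cases "b' = 0")
    case True
    then have "b \<in> fun_space.span B" using r by (simp add: b'_def)
    then have eq: "fun_space.span (insert b B) = fun_space.span B" by (rule fun_space.span_redundant)
    show ?thesis unfolding eq by (intro exI[of _ P] exI[of _ e] conjI fP eB' \<delta>' ex')
  next
    case False
    then obtain x where x: "b' x \<noteq> 0" by (auto simp: fun_eq_iff)
    have xP: "x \<notin> P" using b'P x by blast
    \<comment> \<open>The new basis function; the old ones are corrected so that they vanish at \<open>x\<close>.\<close>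
    define k where "k = fscale (1 / b' x) b'"
    define e' where "e' p = (if p = x then k else e p - fscale (e p x) k)" for p
    have kx: "k x = 1" and kP: "\<And>p. p \<in> P \<Longrightarrow> k p = 0" using x b'P by (auto simp: k_def fscale_def)
    have "b' \<in> fun_space.span (insert b B)"
      unfolding b'_def using r fun_space.span_mono[of B "insert b B"]
      by (intro fun_space.span_diff) (auto intro: fun_space.span_base)
    then have ks: "k \<in> fun_space.span (insert b B)" unfolding k_def by (rule fun_space.span_scale)
    show ?thesis
    proof (intro exI[of _ "insert x P"] exI[of _ e'] conjI ballI)
      show "finite (insert x P)" using fP by simp
      show "e' p \<in> fun_space.span (insert b B)" if "p \<in> insert x P" for p
        using that ks eB[of p] fun_space.span_mono[of B "insert b B"] xP
        by (auto simp: e'_def intro!: fun_space.span_diff fun_space.span_scale)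
      show "e' p q = (if p = q then 1 else 0)" if "p \<in> insert x P" "q \<in> insert x P" for p q
        using that xP \<delta> kx kP by (auto simp: e'_def fscale_def)
      fix v assume v: "v \<in> fun_space.span (insert b B)"
      have "b - b' \<in> fun_space.span B" using r by (simp add: b'_def)
      with v obtain c w where w: "w \<in> fun_space.span B" and vw: "v = fscale c b' + w"
        by (rule span_insert_reduced)
      show "v = (\<Sum>p\<in>insert x P. fscale (v p) (e' p))"
      proof
        fix y
        have wy: "w z = (\<Sum>p\<in>P. w p * e p z)" for z
          by (subst ex[OF w]) (rule sum_fscale_apply)
        have "(\<Sum>p\<in>P. v p * e' p y) = (\<Sum>p\<in>P. w p * (e p y - e p x * k y))"
          using xP b'P by (intro sum.cong) (auto simp: e'_def vw fscale_def)
        also have "\<dots> = w y - w x * k y"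
          by (simp add: wy[of x] wy[of y] sum_distrib_left sum_subtractf algebra_simps)
        finally show "v y = (\<Sum>p\<in>insert x P. fscale (v p) (e' p)) y"
          using fP xP x by (simp add: sum_fscale_apply)
             (simp add: e'_def vw fscale_def k_def field_simps)
      qed
    qed
  qed
qed

section \<open>Semi-inner products on spaces of functions\<close>

text \<open>A symmetric positive semidefinite form on a subspace \<open>X\<close> of functions. All bilinear forms
  of the problem are of this kind; definiteness is not required, so that functions need not be
  identified when they agree almost everywhere.\<close>

locale psd_form =
  fixes X :: "('a \<Rightarrow> real) set" and B :: "('a \<Rightarrow> real) \<Rightarrow> ('a \<Rightarrow> real) \<Rightarrow> real"
  assumes subspace: "fun_space.subspace X"
    and sym: "\<And>u v. u \<in> X \<Longrightarrow> v \<in> X \<Longrightarrow> B u v = B v u"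
    and add: "\<And>u v w. u \<in> X \<Longrightarrow> v \<in> X \<Longrightarrow> w \<in> X \<Longrightarrow> B (u + v) w = B u w + B v w"
    and scale: "\<And>u v c. u \<in> X \<Longrightarrow> v \<in> X \<Longrightarrow> B (fscale c u) v = c * B u v"
    and nonneg: "\<And>u. u \<in> X \<Longrightarrow> 0 \<le> B u u"
begin

lemma mem: "0 \<in> X" "u \<in> X \<Longrightarrow> v \<in> X \<Longrightarrow> u + v \<in> X" "u \<in> X \<Longrightarrow> fscale c u \<in> X"
  "u \<in> X \<Longrightarrow> v \<in> X \<Longrightarrow> u - v \<in> X"
     apply (rule fun_space.subspace_0[OF subspace])
    apply (erule (1) fun_space.subspace_add[OF subspace])
   apply (erule fun_space.subspace_scale[OF subspace])
  apply (erule (1) fun_space.subspace_diff[OF subspace])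
  done

lemma add_right: "u \<in> X \<Longrightarrow> v \<in> X \<Longrightarrow> w \<in> X \<Longrightarrow> B w (u + v) = B w u + B w v"
  by (simp only: sym[of w] mem add)

lemma scale_right: "u \<in> X \<Longrightarrow> v \<in> X \<Longrightarrow> B v (fscale c u) = c * B v u"
  by (simp only: sym[of v] mem scale)

lemma diff: "u \<in> X \<Longrightarrow> v \<in> X \<Longrightarrow> w \<in> X \<Longrightarrow> B (u - v) w = B u w - B v w"
  by (simp only: minus_fscale add scale mem)

lemma zero: "w \<in> X \<Longrightarrow> B 0 w = 0"
  using scale[of w w 0] mem(1) by (simp add: fun_space.scale_zero_left)

lemma zero_right: "w \<in> X \<Longrightarrow> B w 0 = 0"
  using zero sym mem(1) by metis

lemma sum_left:
  assumes "\<And>i. i \<in> I \<Longrightarrow> e i \<in> X" "w \<in> X"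
  shows "B (\<Sum>i\<in>I. fscale (c i) (e i)) w = (\<Sum>i\<in>I. c i * B (e i) w)"
  using assms(1)
proof (induction I rule: infinite_finite_induct)
  case (insert i I)
  have "(\<Sum>i\<in>I. fscale (c i) (e i)) \<in> X"
    by (rule fun_space.subspace_sum[OF subspace], rule mem(3)) (use insert.prems in auto)
  then have eq: "B (fscale (c i) (e i) + (\<Sum>i\<in>I. fscale (c i) (e i))) w
      = c i * B (e i) w + B (\<Sum>i\<in>I. fscale (c i) (e i)) w"
    using insert.prems assms(2) by (subst add) (auto simp: scale mem)
  have "(\<Sum>i\<in>insert i I. fscale (c i) (e i)) = fscale (c i) (e i) + (\<Sum>i\<in>I. fscale (c i) (e i))"
    by (rule sum.insert) (use insert in auto)
  then show ?case using insert by (simp only: eq) simp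
qed (simp_all add: zero assms)

definition nrm :: "('a \<Rightarrow> real) \<Rightarrow> real" where "nrm v = sqrt (B v v)"

lemma nrm_nonneg: "v \<in> X \<Longrightarrow> 0 \<le> nrm v"
  by (simp add: nrm_def nonneg)

lemma nrm_sq: "v \<in> X \<Longrightarrow> (nrm v)\<^sup>2 = B v v"
  by (simp add: nrm_def nonneg)

lemma expand:
  assumes "u \<in> X" "v \<in> X"
  shows "B (u + fscale c v) (u + fscale c v) = B u u + 2 * c * B u v + c\<^sup>2 * B v v"
  using assms sym[of v u] by (simp add: add scale mem add_right scale_right power2_eq_square algebra_simps)

lemma Cauchy_Schwarz:
  assumes u: "u \<in> X" and v: "v \<in> X"
  shows "\<bar>B u v\<bar> \<le> nrm u * nrm v"
proof -
  have "(B u v)\<^sup>2 \<le> B u u * B v v"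
  proof (cases "B v v = 0")
    case True
    have "B u v = 0"
    proof (rule ccontr)
      assume "B u v \<noteq> 0"
      have "0 \<le> B u u + 2 * c * B u v" for c
        using nonneg[OF mem(2)[OF u mem(3)[OF v]], of c] unfolding expand[OF u v] True by simp
      from this[of "- (B u u + 1) / (2 * B u v)"] show False
        using \<open>B u v \<noteq> 0\<close> by (simp add: field_simps)
    qed
    then show ?thesis using True by simp
  next
    case False
    then have pos: "B v v > 0" using nonneg[OF v] by simp
    have "0 \<le> B u u + 2 * (- B u v / B v v) * B u v + (- B u v / B v v)\<^sup>2 * B v v"
      using nonneg[OF mem(2)[OF u mem(3)[OF v]]] unfolding expand[OF u v] .
    also have "\<dots> = B u u - (B u v)\<^sup>2 / B v v"
      using pos by (simp add: power2_eq_square field_simps)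
    finally show ?thesis using pos by (simp add: field_simps)
  qed
  then have "sqrt ((B u v)\<^sup>2) \<le> sqrt (B u u * B v v)" by (rule real_sqrt_le_mono)
  then show ?thesis by (simp add: nrm_def real_sqrt_mult)
qed

lemma nrm_add:
  assumes u: "u \<in> X" and v: "v \<in> X"
  shows "nrm (u + v) \<le> nrm u + nrm v"
proof (rule power2_le_imp_le)
  have "(nrm (u + v))\<^sup>2 = (nrm u)\<^sup>2 + 2 * B u v + (nrm v)\<^sup>2"
    using expand[OF u v, of 1] u v mem by (simp add: nrm_sq)
  also have "\<dots> \<le> (nrm u + nrm v)\<^sup>2"
    using Cauchy_Schwarz[OF u v] by (simp add: power2_eq_square algebra_simps)
  finally show "(nrm (u + v))\<^sup>2 \<le> (nrm u + nrm v)\<^sup>2" .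
qed (use u v nrm_nonneg in auto)

lemma nrm_scale: "v \<in> X \<Longrightarrow> nrm (fscale c v) = \<bar>c\<bar> * nrm v"
  using scale[of v "fscale c v" c] scale_right[of v v c] mem(3)[of v c]
  by (simp add: nrm_def real_sqrt_mult)

lemma nrm_diff:
  assumes "u \<in> X" "v \<in> X"
  shows "nrm (u - v) \<le> nrm u + nrm v"
  using nrm_add[OF assms(1) mem(3)[OF assms(2)], of "-1"] nrm_scale[OF assms(2), of "-1"]
  unfolding minus_fscale by linarith

lemma nrm_diff_abs:
  assumes u: "u \<in> X" and v: "v \<in> X"
  shows "\<bar>nrm u - nrm v\<bar> \<le> nrm (u - v)"
proof -
  have "nrm u \<le> nrm (u - v) + nrm v" using nrm_add[of "u - v" v] u v mem by simp
  moreover have "nrm v \<le> nrm u + nrm (u - v)" using nrm_diff[of u "u - v"] u v mem by simp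
  ultimately show ?thesis by linarith
qed

lemma restrict:
  assumes "fun_space.subspace Y" "Y \<subseteq> X"
  shows "psd_form Y B"
proof
  show "B u v = B v u" if "u \<in> Y" "v \<in> Y" for u v
    using that assms by (intro sym) auto
qed (use assms in \<open>simp_all add: add scale nonneg subset_iff\<close>)

lemma nrm_sum:
  assumes "\<And>i. i \<in> I \<Longrightarrow> e i \<in> X"
  shows "nrm (\<Sum>i\<in>I. fscale (c i) (e i)) \<le> (\<Sum>i\<in>I. \<bar>c i\<bar> * nrm (e i))"
  using assms
proof (induction I rule: infinite_finite_induct)
  case (insert i I)
  have s: "(\<Sum>i\<in>I. fscale (c i) (e i)) \<in> X"
    by (rule fun_space.subspace_sum[OF subspace], rule mem(3)) (use insert.prems in auto)
  have eq: "(\<Sum>i\<in>insert i I. fscale (c i) (e i)) = fscale (c i) (e i) + (\<Sum>i\<in>I. fscale (c i) (e i))"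
    by (rule sum.insert) (use insert in auto)
  have "nrm (fscale (c i) (e i) + (\<Sum>i\<in>I. fscale (c i) (e i)))
      \<le> \<bar>c i\<bar> * nrm (e i) + nrm (\<Sum>i\<in>I. fscale (c i) (e i))"
    using nrm_add[OF mem(3) s, of "e i" "c i"] insert.prems by (simp only: nrm_scale insertI1)
  also have "\<dots> \<le> (\<Sum>i\<in>insert i I. \<bar>c i\<bar> * nrm (e i))"
    using insert by simp
  finally show ?case by (simp only: eq)
qed (simp_all add: nrm_def zero mem)

end

lemma psd_form_add:
  assumes "psd_form X B" "psd_form X D"
  shows "psd_form X (\<lambda>u v. B u v + D u v)"
proof -
  interpret B: psd_form X B by fact
  interpret D: psd_form X D by fact
  show ?thesis
  proof (unfold_locales, goal_cases)
    case 1 show ?case by (rule B.subspace)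
  next
    case (2 u v) then show ?case by (simp only: B.sym[of u v] D.sym[of u v])
  next
    case (3 u v w) then show ?case by (simp add: B.add D.add)
  next
    case (4 u v c) then show ?case by (simp add: B.scale D.scale distrib_left)
  next
    case (5 u) then show ?case by (simp add: B.nonneg D.nonneg)
  qed
qed

lemma psd_form_cmult:
  assumes "psd_form X B" "0 \<le> (c::real)"
  shows "psd_form X (\<lambda>u v. c * B u v)"
proof -
  interpret B: psd_form X B by fact
  show ?thesis
  proof (unfold_locales, goal_cases)
    case 1 show ?case by (rule B.subspace)
  next
    case (2 u v) then show ?case by (simp only: B.sym[of u v])
  next
    case (3 u v w) then show ?case by (simp add: B.add distrib_left)
  next
    case (4 u v c) then show ?case by (simp add: B.scale)
  next
    case (5 u) then show ?case using assms(2) by (simp add: B.nonneg)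
  qed
qed

lemma psd_form_sum:
  assumes "fun_space.subspace X" "\<And>i. i \<in> I \<Longrightarrow> psd_form X (B i)"
  shows "psd_form X (\<lambda>u v. \<Sum>i\<in>I. B i u v)"
  using assms(2)
proof (induction I rule: infinite_finite_induct)
  case (insert i I)
  then show ?case using psd_form_add[of X "B i" "\<lambda>u v. \<Sum>i\<in>I. B i u v"] by simp
qed (use assms(1) in \<open>unfold_locales, auto\<close>)

lemma (in psd_form) orthonormal_basis:
  assumes def: "\<And>u. u \<in> X \<Longrightarrow> u \<noteq> 0 \<Longrightarrow> B u u > 0"
    and "finite S" "S \<subseteq> X"
  shows "\<exists>E. finite E \<and> E \<subseteq> fun_space.span S \<and>
    (\<forall>d\<in>E. \<forall>e\<in>E. B d e = (if d = e then 1 else 0)) \<and>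
    (\<forall>v\<in>fun_space.span S. v = (\<Sum>e\<in>E. fscale (B v e) e))"
  using assms(2,3)
proof (induction S)
  case empty
  show ?case by (intro exI[of _ "{}"]) simp
next
  case (insert b S)
  have "S \<subseteq> X" using insert.prems by simp
  from insert.IH[OF this] obtain E where fE: "finite E" and ES: "E \<subseteq> fun_space.span S"
    and \<delta>': "\<forall>d\<in>E. \<forall>e\<in>E. B d e = (if d = e then 1 else 0)"
    and ex': "\<forall>v\<in>fun_space.span S. v = (\<Sum>e\<in>E. fscale (B v e) e)"
    by (elim exE conjE) (rule that)
  note \<delta> = \<delta>'[rule_format] and ex = ex'[rule_format]
  have SX: "fun_space.span S \<subseteq> X" "fun_space.span (insert b S) \<subseteq> X"
    by (rule fun_space.span_minimal[OF _ subspace], use insert.prems in simp)+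
  have bX: "b \<in> X" using insert.prems by simp
  define r where "r = (\<Sum>e\<in>E. fscale (B b e) e)"
  define b' where "b' = b - r"
  have r: "r \<in> fun_space.span S"
    unfolding r_def using ES by (intro fun_space.span_sum fun_space.span_scale) auto
  have EX: "e \<in> X" if "e \<in> E" for e using that ES SX by blast
  have rX: "r \<in> X" using r SX by blast
  have b'X: "b' \<in> X" unfolding b'_def using bX rX mem by blast
  have b'E: "B b' e = 0" if "e \<in> E" for e
    using that fE EX bX rX sum_left[of E "\<lambda>e. e" e "B b"]
    by (simp add: b'_def diff) (simp add: r_def \<delta> if_distrib sum.delta cong: if_cong)
  show ?case
  proof (cases "b' = 0")
    case True
    then have "b \<in> fun_space.span S" using r by (simp add: b'_def)
    then have eq: "fun_space.span (insert b S) = fun_space.span S" by (rule fun_space.span_redundant)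
    show ?thesis unfolding eq by (intro exI[of _ E] conjI fE ES \<delta>' ex')
  next
    case False
    then have pos: "B b' b' > 0" using def b'X by blast
    define k where "k = fscale (1 / nrm b') b'"
    have np: "nrm b' > 0" using pos by (simp add: nrm_def)
    have kX: "k \<in> X" unfolding k_def using b'X mem by blast
    have kE: "B k e = 0" if "e \<in> E" for e using that EX b'X by (simp add: k_def scale b'E)
    have kE': "B e k = 0" if "e \<in> E" for e using kE[OF that] sym[OF EX[OF that] kX] by simp
    have kk: "B k k = 1"
      using np nrm_scale[OF b'X, of "1 / nrm b'"] nrm_sq[OF kX] by (simp add: k_def)
    have kn: "k \<notin> E" using kE kk by force
    have "b' \<in> fun_space.span (insert b S)"
      unfolding b'_def using r fun_space.span_mono[of S "insert b S"]
      by (intro fun_space.span_diff) (auto intro: fun_space.span_base)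
    then have ks: "k \<in> fun_space.span (insert b S)" unfolding k_def by (rule fun_space.span_scale)
    show ?thesis
    proof (intro exI[of _ "insert k E"] conjI ballI)
      show "finite (insert k E)" using fE by simp
      show "insert k E \<subseteq> fun_space.span (insert b S)"
        using ks ES fun_space.span_mono[of S "insert b S"] by auto
      show "B d e = (if d = e then 1 else 0)" if "d \<in> insert k E" "e \<in> insert k E" for d e
        using that kn \<delta> kk kE kE' by auto
      fix v assume v: "v \<in> fun_space.span (insert b S)"
      have "b - b' \<in> fun_space.span S" using r by (simp add: b'_def)
      with v obtain c w where w: "w \<in> fun_space.span S" and vw: "v = fscale c b' + w"
        by (rule span_insert_reduced)
      have wX: "w \<in> X" using w SX by blast
      have bk: "b' = fscale (nrm b') k" using np by (simp add: k_def fscale_def)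
      have wk: "B w k = 0"
        using ex[OF w] sum_left[of E "\<lambda>e. e" k "B w"] kX EX kE' by simp
      have "B b' k = nrm b'" using bk scale[OF kX kX, of "nrm b'"] kk by simp
      then have vk: "B v k = c * nrm b'" using wk b'X wX kX by (simp add: vw add scale mem)
      have "(\<Sum>e\<in>E. fscale (B v e) e) = (\<Sum>e\<in>E. fscale (B w e) e)"
        using EX b'X wX b'E by (intro sum.cong refl) (simp add: vw add scale mem)
      also have "\<dots> = w" using ex[OF w] by simp
      finally show "v = (\<Sum>e\<in>insert k E. fscale (B v e) e)"
        using fE kn by (simp add: vk) (subst vw, subst bk, simp add: fscale_def mult.assoc)
    qed
  qed
qed

section \<open>The spaces on the surface\<close>

lemma square_add_bound: "(a + b)\<^sup>2 \<le> 2 * a\<^sup>2 + 2 * (b::real)\<^sup>2"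
  using zero_le_power2[of "a - b"] by (simp add: power2_eq_square algebra_simps)

lemma integrable_product_squares:
  fixes f g :: "'b \<Rightarrow> real"
  assumes "f \<in> borel_measurable M" "g \<in> borel_measurable M"
    and "integrable M (\<lambda>x. (f x)\<^sup>2)" "integrable M (\<lambda>x. (g x)\<^sup>2)"
  shows "integrable M (\<lambda>x. f x * g x)"
proof (rule Bochner_Integration.integrable_bound)
  show "integrable M (\<lambda>x. (f x)\<^sup>2 + (g x)\<^sup>2)" using assms by simp
  show "AE x in M. norm (f x * g x) \<le> norm ((f x)\<^sup>2 + (g x)\<^sup>2)"
  proof (rule AE_I2)
    fix x
    have "2 * \<bar>f x\<bar> * \<bar>g x\<bar> \<le> (f x)\<^sup>2 + (g x)\<^sup>2"
      using sum_squares_bound[of "\<bar>f x\<bar>" "\<bar>g x\<bar>"] by simp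
    moreover have "0 \<le> \<bar>f x\<bar> * \<bar>g x\<bar>" by simp
    ultimately show "norm (f x * g x) \<le> norm ((f x)\<^sup>2 + (g x)\<^sup>2)"
      by (simp only: real_norm_def abs_mult)
  qed
qed (use assms in measurable)

lemma integrable_inner_squares:
  fixes f g :: "'b \<Rightarrow> 'c::euclidean_space"
  assumes "f \<in> borel_measurable M" "g \<in> borel_measurable M"
    and "integrable M (\<lambda>x. (norm (f x))\<^sup>2)" "integrable M (\<lambda>x. (norm (g x))\<^sup>2)"
  shows "integrable M (\<lambda>x. f x \<bullet> g x)"
proof (rule Bochner_Integration.integrable_bound)
  show "integrable M (\<lambda>x. norm (f x) * norm (g x))"
    using assms by (intro integrable_product_squares) auto
  show "AE x in M. norm (f x \<bullet> g x) \<le> norm (norm (f x) * norm (g x))"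
    using Cauchy_Schwarz_ineq2 by (intro AE_I2) (simp add: abs_mult)
qed (use assms in measurable)

lemma L2_integrable_mult:
  "v \<in> L2\<Gamma> \<Gamma> \<Longrightarrow> w \<in> L2\<Gamma> \<Gamma> \<Longrightarrow> integrable (surface_measure \<Gamma>) (\<lambda>x. v x * w x)"
  unfolding L2\<Gamma>_def by (intro integrable_product_squares) auto

lemma subspace_L2: "fun_space.subspace (L2\<Gamma> \<Gamma>)"
proof (rule fun_space.subspaceI)
  show "0 \<in> L2\<Gamma> \<Gamma>" by (simp add: L2\<Gamma>_def zero_fun_def)
  show "v + w \<in> L2\<Gamma> \<Gamma>" if v: "v \<in> L2\<Gamma> \<Gamma>" and w: "w \<in> L2\<Gamma> \<Gamma>" for v w
  proof -
    have "integrable (surface_measure \<Gamma>) (\<lambda>x. (v x)\<^sup>2 + (w x)\<^sup>2 + 2 * (v x * w x))"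
      using v w L2_integrable_mult[OF v w] by (simp add: L2\<Gamma>_def)
    then have "integrable (surface_measure \<Gamma>) (\<lambda>x. (v x + w x)\<^sup>2)"
      by (simp add: power2_sum mult.assoc)
    then show ?thesis using v w by (auto simp: L2\<Gamma>_def plus_fun_def intro!: borel_measurable_add)
  qed
  show "fscale c v \<in> L2\<Gamma> \<Gamma>" if "v \<in> L2\<Gamma> \<Gamma>" for c v
    using that by (auto simp: L2\<Gamma>_def fscale_def power_mult_distrib intro!: borel_measurable_times)
qed

lemma psd_form_ip: "psd_form (L2\<Gamma> \<Gamma>) (ip\<Gamma> \<Gamma>)"
proof (unfold_locales, goal_cases)
  case 1 show ?case by (rule subspace_L2)
next
  case (2 u v) show ?case by (simp add: ip\<Gamma>_def mult.commute)
next
  case (3 u v w)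
  then show ?case using L2_integrable_mult[of u \<Gamma> w] L2_integrable_mult[of v \<Gamma> w]
    by (simp add: ip\<Gamma>_def distrib_right)
next
  case (4 u v c)
  show ?case by (simp add: ip\<Gamma>_def fscale_def mult.assoc)
next
  case (5 u)
  show ?case unfolding ip\<Gamma>_def by (intro Bochner_Integration.integral_nonneg) simp
qed

lemma subspace_H1: "fun_space.subspace (H1\<Gamma> \<Gamma> \<nu>)"
proof (rule fun_space.subspaceI)
  show "0 \<in> H1\<Gamma> \<Gamma> \<nu>"
  proof -
    have "weak_tgrad \<Gamma> \<nu> 0 0"
      unfolding zero_fun_def
      by (rule weak_tgradI) (auto intro!: exI[of _ 0] simp: has_bochner_integral_zero)
    then show ?thesis using fun_space.subspace_0[OF subspace_L2] unfolding H1\<Gamma>_def by blast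
  qed
  show "v + w \<in> H1\<Gamma> \<Gamma> \<nu>" if "v \<in> H1\<Gamma> \<Gamma> \<nu>" "w \<in> H1\<Gamma> \<Gamma> \<nu>" for v w
    using that fun_space.subspace_add[OF subspace_L2] weak_tgrad_add unfolding H1\<Gamma>_def by blast
  show "fscale c v \<in> H1\<Gamma> \<Gamma> \<nu>" if "v \<in> H1\<Gamma> \<Gamma> \<nu>" for c v
    using that fun_space.subspace_scale[OF subspace_L2] weak_tgrad_scale unfolding H1\<Gamma>_def by blast
qed

lemma tgrad_linear: "Vector_Spaces.linear fscale fscale (tgrad \<Gamma> \<nu>)"
  and weak_tgrad_tgrad: "v \<in> H1\<Gamma> \<Gamma> \<nu> \<Longrightarrow> weak_tgrad \<Gamma> \<nu> v (tgrad \<Gamma> \<nu> v)"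
  using someI_ex[OF ex_linear_tgrad[of \<Gamma> \<nu>]] unfolding tgrad_def by blast+

lemma tgrad_integrable_inner:
  assumes "v \<in> H1\<Gamma> \<Gamma> \<nu>" "w \<in> H1\<Gamma> \<Gamma> \<nu>"
  shows "integrable (surface_measure \<Gamma>) (\<lambda>x. tgrad \<Gamma> \<nu> v x \<bullet> tgrad \<Gamma> \<nu> w x)"
  using weak_tgrad_tgrad[OF assms(1)] weak_tgrad_tgrad[OF assms(2)]
  unfolding weak_tgrad_def by (intro integrable_inner_squares) auto

lemma psd_form_a: "psd_form (H1\<Gamma> \<Gamma> \<nu>) (a_form \<Gamma> \<nu>)"
proof -
  interpret module_hom "fscale :: real \<Rightarrow> ('a \<Rightarrow> real) \<Rightarrow> 'a \<Rightarrow> real"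
    "fscale :: real \<Rightarrow> ('a \<Rightarrow> 'a) \<Rightarrow> 'a \<Rightarrow> 'a" "tgrad \<Gamma> \<nu>"
    using tgrad_linear[of \<Gamma> \<nu>] unfolding Vector_Spaces.linear_def by simp
  show ?thesis
  proof (unfold_locales, goal_cases)
    case 1 show ?case by (rule subspace_H1)
  next
    case (2 u v) show ?case by (simp add: a_form_def inner_commute)
  next
    case (3 u v w)
    then show ?case using tgrad_integrable_inner[of u \<Gamma> \<nu> w] tgrad_integrable_inner[of v \<Gamma> \<nu> w]
      by (simp add: a_form_def add inner_add_left)
  next
    case (4 u v c)
    show ?case by (simp only: a_form_def scale) (simp add: fscale_def)
  next
    case (5 u)
    show ?case unfolding a_form_def by (intro Bochner_Integration.integral_nonneg) simp
  qed
qed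

lemma normL2_eq: "normL2\<Gamma> \<Gamma> = psd_form.nrm (ip\<Gamma> \<Gamma>)"
  by (simp add: fun_eq_iff normL2\<Gamma>_def psd_form.nrm_def[OF psd_form_ip])

lemma seminormH1_eq: "seminormH1\<Gamma> \<Gamma> \<nu> = psd_form.nrm (a_form \<Gamma> \<nu>)"
  by (simp add: fun_eq_iff seminormH1\<Gamma>_def psd_form.nrm_def[OF psd_form_a] a_form_def power2_norm_eq_inner)

text \<open>The inner product of \<open>H\<^sup>1(\<Gamma>)\<close>.\<close>

abbreviation H1_ip where
  "H1_ip \<Gamma> \<nu> v w \<equiv> ip\<Gamma> \<Gamma> v w + a_form \<Gamma> \<nu> v w"

lemma H1_subset_L2: "H1\<Gamma> \<Gamma> \<nu> \<subseteq> L2\<Gamma> \<Gamma>"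
  by (auto simp: H1\<Gamma>_def)

lemma psd_form_H1: "psd_form (H1\<Gamma> \<Gamma> \<nu>) (H1_ip \<Gamma> \<nu>)"
  by (intro psd_form_add psd_form_a psd_form.restrict[OF psd_form_ip] subspace_H1 H1_subset_L2)

lemma a_form_nonneg: "0 \<le> a_form \<Gamma> \<nu> u u"
  unfolding a_form_def by (intro Bochner_Integration.integral_nonneg) simp

lemma ip_nonneg: "0 \<le> ip\<Gamma> \<Gamma> u u"
  unfolding ip\<Gamma>_def by (intro Bochner_Integration.integral_nonneg) simp

lemma normL2_sq: "(normL2\<Gamma> \<Gamma> v)\<^sup>2 = ip\<Gamma> \<Gamma> v v"
  by (simp add: normL2\<Gamma>_def ip_nonneg)

lemma seminormH1_sq: "(seminormH1\<Gamma> \<Gamma> \<nu> v)\<^sup>2 = a_form \<Gamma> \<nu> v v"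
  by (simp add: seminormH1_eq psd_form.nrm_def[OF psd_form_a] a_form_nonneg)

lemma normH1_eq: "normH1\<Gamma> \<Gamma> \<nu> = psd_form.nrm (H1_ip \<Gamma> \<nu>)"
  by (simp add: fun_eq_iff normH1\<Gamma>_def psd_form.nrm_def[OF psd_form_H1] normL2_sq seminormH1_sq)

lemma normH1_sq: "(normH1\<Gamma> \<Gamma> \<nu> v)\<^sup>2 = ip\<Gamma> \<Gamma> v v + a_form \<Gamma> \<nu> v v"
  by (simp add: normH1\<Gamma>_def normL2_sq seminormH1_sq ip_nonneg a_form_nonneg)

lemma normH1_nonneg: "0 \<le> normH1\<Gamma> \<Gamma> \<nu> v"
  by (simp add: normH1\<Gamma>_def)

lemma normH1_zero: "normH1\<Gamma> \<Gamma> \<nu> 0 = 0"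
  using psd_form.zero[OF psd_form_H1 fun_space.subspace_0[OF subspace_H1]]
  by (simp add: normH1_eq psd_form.nrm_def[OF psd_form_H1])

lemma normL2_le_normH1: "normL2\<Gamma> \<Gamma> v \<le> normH1\<Gamma> \<Gamma> \<nu> v"
  unfolding normH1\<Gamma>_def by (rule real_le_rsqrt) simp

lemma seminormH1_le_normH1: "seminormH1\<Gamma> \<Gamma> \<nu> v \<le> normH1\<Gamma> \<Gamma> \<nu> v"
  unfolding normH1\<Gamma>_def by (rule real_le_rsqrt) simp

text \<open>The quotient defining the dual norm is \<open>0\<close> at functions of norm zero; a bounded functional
  vanishes there, so that the usual estimate holds for all functions.\<close>

lemma Hm1_bound:
  assumes F: "F \<in> Hm1\<Gamma> \<Gamma> \<nu>" and v: "v \<in> H1\<Gamma> \<Gamma> \<nu>"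
  shows "\<bar>F v\<bar> \<le> normHm1\<Gamma> \<Gamma> \<nu> F * normH1\<Gamma> \<Gamma> \<nu> v"
proof -
  obtain B where B: "\<And>v. v \<in> H1\<Gamma> \<Gamma> \<nu> \<Longrightarrow> \<bar>F v\<bar> \<le> B * normH1\<Gamma> \<Gamma> \<nu> v"
    using F unfolding Hm1\<Gamma>_def by blast
  have "bdd_above ((\<lambda>v. \<bar>F v\<bar> / normH1\<Gamma> \<Gamma> \<nu> v) ` H1\<Gamma> \<Gamma> \<nu>)"
  proof (rule bdd_aboveI2)
    fix w assume w: "w \<in> H1\<Gamma> \<Gamma> \<nu>"
    show "\<bar>F w\<bar> / normH1\<Gamma> \<Gamma> \<nu> w \<le> \<bar>B\<bar>"
    proof (cases "normH1\<Gamma> \<Gamma> \<nu> w = 0")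
      case False
      then have "normH1\<Gamma> \<Gamma> \<nu> w > 0" using normH1_nonneg[of \<Gamma> \<nu> w] by simp
      then have "\<bar>F w\<bar> / normH1\<Gamma> \<Gamma> \<nu> w \<le> B" using B[OF w] by (simp add: divide_le_eq)
      then show ?thesis by linarith
    qed simp
  qed
  then have le: "\<bar>F v\<bar> / normH1\<Gamma> \<Gamma> \<nu> v \<le> normHm1\<Gamma> \<Gamma> \<nu> F"
    unfolding normHm1\<Gamma>_def by (rule cSUP_upper[OF v])
  show ?thesis
  proof (cases "normH1\<Gamma> \<Gamma> \<nu> v = 0")
    case True
    then show ?thesis using B[OF v] by simp
  next
    case False
    then have "normH1\<Gamma> \<Gamma> \<nu> v > 0" using normH1_nonneg[of \<Gamma> \<nu> v] by simp
    then show ?thesis using le by (simp add: divide_le_eq)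
  qed
qed

lemma normHm1_least:
  assumes "0 \<le> K" "\<And>v. v \<in> H1\<Gamma> \<Gamma> \<nu> \<Longrightarrow> \<bar>F v\<bar> \<le> K * normH1\<Gamma> \<Gamma> \<nu> v"
  shows "normHm1\<Gamma> \<Gamma> \<nu> F \<le> K"
  unfolding normHm1\<Gamma>_def
proof (rule cSUP_least)
  show "H1\<Gamma> \<Gamma> \<nu> \<noteq> {}" using fun_space.subspace_0[OF subspace_H1] by blast
  fix v assume v: "v \<in> H1\<Gamma> \<Gamma> \<nu>"
  show "\<bar>F v\<bar> / normH1\<Gamma> \<Gamma> \<nu> v \<le> K"
    using assms(2)[OF v] assms(1) normH1_nonneg[of \<Gamma> \<nu> v]
    by (cases "normH1\<Gamma> \<Gamma> \<nu> v = 0") (auto simp: divide_le_eq)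
qed

lemma normHm1_nonneg:
  assumes "F \<in> Hm1\<Gamma> \<Gamma> \<nu>"
  shows "0 \<le> normHm1\<Gamma> \<Gamma> \<nu> F"
proof (rule ccontr)
  assume neg: "\<not> ?thesis"
  have "normH1\<Gamma> \<Gamma> \<nu> v = 0" if v: "v \<in> H1\<Gamma> \<Gamma> \<nu>" for v
  proof (rule ccontr)
    assume "normH1\<Gamma> \<Gamma> \<nu> v \<noteq> 0"
    then have "normHm1\<Gamma> \<Gamma> \<nu> F * normH1\<Gamma> \<Gamma> \<nu> v < 0"
      using neg normH1_nonneg[of \<Gamma> \<nu> v] by (intro mult_neg_pos) auto
    then show False using Hm1_bound[OF assms v] by linarith
  qed
  then have "normHm1\<Gamma> \<Gamma> \<nu> F = (SUP v\<in>H1\<Gamma> \<Gamma> \<nu>. 0)"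
    unfolding normHm1\<Gamma>_def by (intro SUP_cong) auto
  moreover have "H1\<Gamma> \<Gamma> \<nu> \<noteq> {}" using fun_space.subspace_0[OF subspace_H1] by blast
  ultimately show False using neg by simp
qed

lemma Hm1_diff:
  assumes "F \<in> Hm1\<Gamma> \<Gamma> \<nu>" "G \<in> Hm1\<Gamma> \<Gamma> \<nu>"
  shows "F - G \<in> Hm1\<Gamma> \<Gamma> \<nu>"
proof -
  have "\<bar>(F - G) v\<bar> \<le> (normHm1\<Gamma> \<Gamma> \<nu> F + normHm1\<Gamma> \<Gamma> \<nu> G) * normH1\<Gamma> \<Gamma> \<nu> v"
    if "v \<in> H1\<Gamma> \<Gamma> \<nu>" for v
    using Hm1_bound[OF assms(1) that] Hm1_bound[OF assms(2) that] by (simp add: distrib_right)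
  then have "\<exists>B. \<forall>v\<in>H1\<Gamma> \<Gamma> \<nu>. \<bar>(F - G) v\<bar> \<le> B * normH1\<Gamma> \<Gamma> \<nu> v" by blast
  then show ?thesis using assms by (simp add: Hm1\<Gamma>_def right_diff_distrib)
qed

lemma normHm1_add:
  assumes "F \<in> Hm1\<Gamma> \<Gamma> \<nu>" "G \<in> Hm1\<Gamma> \<Gamma> \<nu>"
  shows "normHm1\<Gamma> \<Gamma> \<nu> (F + G) \<le> normHm1\<Gamma> \<Gamma> \<nu> F + normHm1\<Gamma> \<Gamma> \<nu> G"
proof (rule normHm1_least)
  show "0 \<le> normHm1\<Gamma> \<Gamma> \<nu> F + normHm1\<Gamma> \<Gamma> \<nu> G" using assms by (simp add: normHm1_nonneg)
  show "\<bar>(F + G) v\<bar> \<le> (normHm1\<Gamma> \<Gamma> \<nu> F + normHm1\<Gamma> \<Gamma> \<nu> G) * normH1\<Gamma> \<Gamma> \<nu> v"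
    if "v \<in> H1\<Gamma> \<Gamma> \<nu>" for v
    using Hm1_bound[OF assms(1) that] Hm1_bound[OF assms(2) that] by (simp add: distrib_right)
qed

lemma normHm1_diff:
  assumes "F \<in> Hm1\<Gamma> \<Gamma> \<nu>" "G \<in> Hm1\<Gamma> \<Gamma> \<nu>"
  shows "normHm1\<Gamma> \<Gamma> \<nu> (F - G) \<le> normHm1\<Gamma> \<Gamma> \<nu> F + normHm1\<Gamma> \<Gamma> \<nu> G"
proof (rule normHm1_least)
  show "0 \<le> normHm1\<Gamma> \<Gamma> \<nu> F + normHm1\<Gamma> \<Gamma> \<nu> G" using assms by (simp add: normHm1_nonneg)
  show "\<bar>(F - G) v\<bar> \<le> (normHm1\<Gamma> \<Gamma> \<nu> F + normHm1\<Gamma> \<Gamma> \<nu> G) * normH1\<Gamma> \<Gamma> \<nu> v"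
    if "v \<in> H1\<Gamma> \<Gamma> \<nu>" for v
    using Hm1_bound[OF assms(1) that] Hm1_bound[OF assms(2) that] by (simp add: distrib_right)
qed

lemma normHm1_diff_abs:
  assumes F: "F \<in> Hm1\<Gamma> \<Gamma> \<nu>" and G: "G \<in> Hm1\<Gamma> \<Gamma> \<nu>"
  shows "\<bar>normHm1\<Gamma> \<Gamma> \<nu> F - normHm1\<Gamma> \<Gamma> \<nu> G\<bar> \<le> normHm1\<Gamma> \<Gamma> \<nu> (F - G)"
proof -
  have "normHm1\<Gamma> \<Gamma> \<nu> F \<le> normHm1\<Gamma> \<Gamma> \<nu> (F - G) + normHm1\<Gamma> \<Gamma> \<nu> G"
    using normHm1_add[OF Hm1_diff[OF F G] G] by simp
  moreover have "normHm1\<Gamma> \<Gamma> \<nu> G \<le> normHm1\<Gamma> \<Gamma> \<nu> F + normHm1\<Gamma> \<Gamma> \<nu> (F - G)"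
    using normHm1_diff[OF F Hm1_diff[OF F G]] by simp
  ultimately show ?thesis by linarith
qed

lemma ip_le_normL2_normH1:
  assumes "w \<in> L2\<Gamma> \<Gamma>" "v \<in> H1\<Gamma> \<Gamma> \<nu>"
  shows "\<bar>ip\<Gamma> \<Gamma> w v\<bar> \<le> normL2\<Gamma> \<Gamma> w * normH1\<Gamma> \<Gamma> \<nu> v"
proof -
  have "\<bar>ip\<Gamma> \<Gamma> w v\<bar> \<le> normL2\<Gamma> \<Gamma> w * normL2\<Gamma> \<Gamma> v"
    unfolding normL2_eq using assms H1_subset_L2 by (intro psd_form.Cauchy_Schwarz[OF psd_form_ip]) auto
  also have "\<dots> \<le> normL2\<Gamma> \<Gamma> w * normH1\<Gamma> \<Gamma> \<nu> v"
    by (intro mult_left_mono normL2_le_normH1) (simp add: normL2\<Gamma>_def ip_nonneg)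
  finally show ?thesis .
qed

lemma ip_diff_left:
  assumes "u \<in> L2\<Gamma> \<Gamma>" "v \<in> L2\<Gamma> \<Gamma>" "w \<in> L2\<Gamma> \<Gamma>"
  shows "ip\<Gamma> \<Gamma> (u - v) w = ip\<Gamma> \<Gamma> u w - ip\<Gamma> \<Gamma> v w"
  by (rule psd_form.diff[OF psd_form_ip assms])

lemma ip_in_Hm1:
  assumes w: "w \<in> L2\<Gamma> \<Gamma>"
  shows "ip\<Gamma> \<Gamma> w \<in> Hm1\<Gamma> \<Gamma> \<nu>"
proof -
  interpret psd_form "L2\<Gamma> \<Gamma>" "ip\<Gamma> \<Gamma>" by (rule psd_form_ip)
  have "\<exists>B. \<forall>v\<in>H1\<Gamma> \<Gamma> \<nu>. \<bar>ip\<Gamma> \<Gamma> w v\<bar> \<le> B * normH1\<Gamma> \<Gamma> \<nu> v"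
    using ip_le_normL2_normH1[OF w] by blast
  then show ?thesis
    using w H1_subset_L2[of \<Gamma> \<nu>] by (auto simp: Hm1\<Gamma>_def subset_iff add_right scale_right)
qed

lemma normHm1_ip_le:
  assumes w: "w \<in> L2\<Gamma> \<Gamma>"
  shows "normHm1\<Gamma> \<Gamma> \<nu> (ip\<Gamma> \<Gamma> w) \<le> normL2\<Gamma> \<Gamma> w"
  by (rule normHm1_least) (use ip_le_normL2_normH1[OF w] in \<open>auto simp: normL2\<Gamma>_def ip_nonneg\<close>)

section \<open>The stabilization forms\<close>

lemma (in complete_measure) measurable_AE_eq:
  assumes g: "g \<in> measurable M N" and ae: "AE x in M. f x = g x" and f: "f \<in> space M \<rightarrow> space N"
  shows "f \<in> measurable M N"
proof (rule measurableI)
  fix A assume A: "A \<in> sets N"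
  show "f -` A \<inter> space M \<in> sets M"
  proof (rule in_sets_AE)
    show "AE x in M. x \<in> g -` A \<inter> space M \<longleftrightarrow> x \<in> f -` A \<inter> space M"
      using ae by eventually_elim auto
  qed (use measurable_sets[OF g A] in auto)
qed (use f in auto)

text \<open>Where the closest point in a compact set is unique it depends continuously on the point,
  as a map into a compact set with closed graph.\<close>

lemma continuous_on_closest_point_unique:
  fixes \<Gamma> S :: "'a::euclidean_space set"
  assumes \<Gamma>: "compact \<Gamma>" "\<Gamma> \<noteq> {}" and S: "closed S"
    and uniq: "\<And>x. x \<in> S \<Longrightarrow> \<exists>!y. y \<in> \<Gamma> \<and> (\<forall>z\<in>\<Gamma>. dist x y \<le> dist x z)"
  shows "continuous_on S (closest_point \<Gamma>)"
proof (rule continuous_from_closed_graph[OF \<Gamma>(1)])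
  have cl: "closed \<Gamma>" using \<Gamma> compact_imp_closed by blast
  have cp: "closest_point \<Gamma> x \<in> \<Gamma>" "\<forall>z\<in>\<Gamma>. dist x (closest_point \<Gamma> x) \<le> dist x z" for x
    using closest_point_exists[OF cl \<Gamma>(2)] by auto
  then show "closest_point \<Gamma> \<in> S \<rightarrow> \<Gamma>" by blast
  let ?K = "(S \<times> \<Gamma>) \<inter> (\<Inter>z\<in>\<Gamma>. {p. dist (fst p) (snd p) \<le> dist (fst p) z})"
  have "closed ?K"
    using S cl by (intro closed_Int closed_Times closed_INT ballI closed_Collect_le continuous_intros)
  moreover have "(\<lambda>x. (x, closest_point \<Gamma> x)) ` S = ?K"
  proof
    show "(\<lambda>x. (x, closest_point \<Gamma> x)) ` S \<subseteq> ?K" using cp by auto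
    show "?K \<subseteq> (\<lambda>x. (x, closest_point \<Gamma> x)) ` S"
    proof
      fix p assume p: "p \<in> ?K"
      then have x: "fst p \<in> S" and y: "snd p \<in> \<Gamma> \<and> (\<forall>z\<in>\<Gamma>. dist (fst p) (snd p) \<le> dist (fst p) z)"
        by auto
      have "snd p = closest_point \<Gamma> (fst p)"
        using uniq[OF x] y cp[of "fst p"] by blast
      then show "p \<in> (\<lambda>x. (x, closest_point \<Gamma> x)) ` S" using x by (auto intro!: image_eqI[of _ _ "fst p"] prod_eqI)
    qed
  qed
  ultimately show "closed ((\<lambda>x. (x, closest_point \<Gamma> x)) ` S)" by simp
qed

lemma real_polynomial_gradient:
  fixes p :: "'a::euclidean_space \<Rightarrow> real"
  assumes "real_polynomial_function p"
  shows "\<exists>G. continuous_on UNIV G \<and> (\<forall>x. (p has_derivative (\<lambda>y. G x \<bullet> y)) (at x))"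
  using assms
proof induction
  case (linear f)
  have "f y = adjoint f 1 \<bullet> y" for y
    using adjoint_works[OF bounded_linear.linear[OF linear], of y 1] by (simp add: inner_commute)
  then have "f = (\<lambda>y. adjoint f 1 \<bullet> y)" by (rule ext)
  moreover have "(f has_derivative f) (at x)" for x by (rule bounded_linear_imp_has_derivative[OF linear])
  ultimately have "(f has_derivative (\<lambda>y. adjoint f 1 \<bullet> y)) (at x)" for x by metis
  then show ?case by (intro exI[of _ "\<lambda>x. adjoint f 1"]) auto
next
  case (const c)
  show ?case by (intro exI[of _ "\<lambda>x. 0"]) auto
next
  case (add f g)
  then obtain F G where FG: "continuous_on UNIV F" "continuous_on UNIV G"
    "\<And>x. (f has_derivative (\<lambda>y. F x \<bullet> y)) (at x)" "\<And>x. (g has_derivative (\<lambda>y. G x \<bullet> y)) (at x)" by blast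
  have "((\<lambda>x. f x + g x) has_derivative (\<lambda>y. (F x + G x) \<bullet> y)) (at x)" for x
    using has_derivative_add[OF FG(3,4)] by (simp add: inner_add_left)
  then show ?case using FG by (intro exI[of _ "\<lambda>x. F x + G x"]) (auto intro: continuous_on_add)
next
  case (mult f g)
  then obtain F G where FG: "continuous_on UNIV F" "continuous_on UNIV G"
    "\<And>x. (f has_derivative (\<lambda>y. F x \<bullet> y)) (at x)" "\<And>x. (g has_derivative (\<lambda>y. G x \<bullet> y)) (at x)" by blast
  have "continuous_on UNIV f" "continuous_on UNIV g"
    using FG by (auto intro!: continuous_at_imp_continuous_on has_derivative_continuous)
  moreover have "((\<lambda>x. f x * g x) has_derivative (\<lambda>y. (f x *\<^sub>R G x + g x *\<^sub>R F x) \<bullet> y)) (at x)" for x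
    using has_derivative_mult[OF FG(3,4)] by (simp add: inner_add_left algebra_simps)
  ultimately show ?case using FG
    by (intro exI[of _ "\<lambda>x. f x *\<^sub>R G x + g x *\<^sub>R F x"]) (auto intro!: continuous_intros)
qed

text \<open>What the stabilization forms require of the surface, the elements that it cuts, and the finite
  element space: a continuous extended normal, elements of positive diameter with null boundary, and
  piecewise polynomials.\<close>

locale cut_mesh =
  fixes \<Gamma> :: "'a::euclidean_space set" and \<nu> :: "'a \<Rightarrow> 'a" and \<T> :: "'a set set"
    and V :: "('a \<Rightarrow> real) set"
  assumes compact_\<Gamma>: "compact \<Gamma>" and \<Gamma>_nonempty: "\<Gamma> \<noteq> {}" and cont_\<nu>: "continuous_on \<Gamma> \<nu>"
    and finite_\<T>: "finite \<T>"
    and compact_elem: "\<And>T. T \<in> \<T> \<Longrightarrow> compact T"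
    and interior_elem: "\<And>T. T \<in> \<T> \<Longrightarrow> interior T \<noteq> {}"
    and negligible_frontier_elem: "\<And>T. T \<in> \<T> \<Longrightarrow> negligible (frontier T)"
    and unique_closest: "\<And>x. x \<in> \<Union>\<T> \<Longrightarrow> \<exists>!y. y \<in> \<Gamma> \<and> (\<forall>z\<in>\<Gamma>. dist x y \<le> dist x z)"
    and fe: "fe_space \<T> V"
begin

lemma subspace_V: "fun_space.subspace V"
  using fe fun_space.subspace_span by (auto simp: fe_space_def)

lemma diameter_pos: "T \<in> \<T> \<Longrightarrow> 0 < diameter T"
proof -
  assume T: "T \<in> \<T>"
  obtain x where "x \<in> interior T" using interior_elem[OF T] by blast
  then obtain e where e: "e > 0" "ball x e \<subseteq> T" by (meson mem_interior)
  have "bounded T" using compact_elem[OF T] compact_imp_bounded by blast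
  then have "diameter (ball x e) \<le> diameter T" by (intro diameter_subset e)
  moreover have "diameter (ball x e) > 0" using e by simp
  ultimately show ?thesis by linarith
qed

lemma continuous_on_extended_normal:
  assumes T: "T \<in> \<T>"
  shows "continuous_on T (\<lambda>x. \<nu> (closest_point \<Gamma> x))"
proof -
  have cl: "closed \<Gamma>" using compact_\<Gamma> compact_imp_closed by blast
  have "continuous_on T (closest_point \<Gamma>)"
    by (rule continuous_on_closest_point_unique[OF compact_\<Gamma> \<Gamma>_nonempty
          compact_imp_closed[OF compact_elem[OF T]]]) (rule unique_closest, use T in blast)
  then show ?thesis
    by (rule continuous_on_compose2[OF cont_\<nu>]) (use closest_point_in_set[OF cl \<Gamma>_nonempty] in blast)
qed

lemma fe_gradient:
  assumes v: "v \<in> V" and T: "T \<in> \<T>"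
  obtains G where "continuous_on UNIV G" "\<And>x. x \<in> interior T \<Longrightarrow> (v has_derivative (\<lambda>y. G x \<bullet> y)) (at x)"
proof -
  obtain p where p: "real_polynomial_function p" "\<And>x. x \<in> T \<Longrightarrow> v x = p x"
  proof -
    have "\<forall>v\<in>V. \<forall>T\<in>\<T>. \<exists>p. real_polynomial_function p \<and> (\<forall>x\<in>T. v x = p x)"
      using fe unfolding fe_space_def by (elim conjE) (simp only: Ball_def, meson)
    then show ?thesis using v T that by blast
  qed
  obtain G where G: "continuous_on UNIV G" "\<And>x. (p has_derivative (\<lambda>y. G x \<bullet> y)) (at x)"
    using real_polynomial_gradient[OF p(1)] by blast
  have "(v has_derivative (\<lambda>y. G x \<bullet> y)) (at x)" if x: "x \<in> interior T" for x
  proof (rule has_derivative_transform_within_open[OF G(2) open_interior x])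
    show "p y = v y" if "y \<in> interior T" for y using p(2) that interior_subset by force
  qed
  then show ?thesis using G(1) that by blast
qed

lemma nderiv_add_interior:
  assumes "v \<in> V" "w \<in> V" "T \<in> \<T>" "x \<in> interior T"
  shows "nderiv \<Gamma> \<nu> (v + w) x = nderiv \<Gamma> \<nu> v x + nderiv \<Gamma> \<nu> w x"
proof -
  obtain F where F: "(v has_derivative (\<lambda>y. F x \<bullet> y)) (at x)"
    using fe_gradient[OF assms(1,3)] assms(4) by metis
  obtain G where G: "(w has_derivative (\<lambda>y. G x \<bullet> y)) (at x)"
    using fe_gradient[OF assms(2,3)] assms(4) by metis
  have "((v + w) has_derivative (\<lambda>y. F x \<bullet> y + G x \<bullet> y)) (at x)"
    unfolding plus_fun_def by (rule has_derivative_add[OF F G])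
  then show ?thesis
    by (simp add: nderiv_def frechet_derivative_at[OF F, symmetric] frechet_derivative_at[OF G, symmetric]
        frechet_derivative_at[of "v + w", symmetric])
qed

lemma nderiv_scale_interior:
  assumes "v \<in> V" "T \<in> \<T>" "x \<in> interior T"
  shows "nderiv \<Gamma> \<nu> (fscale c v) x = c * nderiv \<Gamma> \<nu> v x"
proof -
  obtain F where F: "(v has_derivative (\<lambda>y. F x \<bullet> y)) (at x)"
    using fe_gradient[OF assms(1,2)] assms(3) by metis
  have "(fscale c v has_derivative (\<lambda>y. c *\<^sub>R (F x \<bullet> y))) (at x)"
    unfolding fscale_def by (rule has_derivative_scaleR_right[OF F])
  then show ?thesis
    by (simp add: nderiv_def frechet_derivative_at[OF F, symmetric]
        frechet_derivative_at[of "fscale c v", symmetric])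
qed

lemma AE_interior_elem:
  assumes T: "T \<in> \<T>"
  shows "AE x in lebesgue. x \<in> T \<longrightarrow> x \<in> interior T"
proof -
  have "frontier T \<in> null_sets lebesgue"
    using negligible_frontier_elem[OF T] negligible_iff_null_sets by blast
  moreover have "closed T" using compact_elem[OF T] compact_imp_closed by blast
  ultimately show ?thesis
    by (intro AE_I'[of "frontier T"]) (auto simp: frontier_def)
qed

text \<open>Inside \<open>T\<close> the normal derivative is a function continuous on all of \<open>T\<close>; on the boundary of \<open>T\<close>,
  a null set, nothing is known about it, and measurability comes from the completeness of Lebesgue
  measure.\<close>

lemma nderiv_product_integrable:
  assumes v: "v \<in> V" and w: "w \<in> V" and T: "T \<in> \<T>"
  shows "set_integrable lebesgue T (\<lambda>x. nderiv \<Gamma> \<nu> v x * nderiv \<Gamma> \<nu> w x)"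
proof -
  obtain F where F: "continuous_on UNIV F" "\<And>x. x \<in> interior T \<Longrightarrow> (v has_derivative (\<lambda>y. F x \<bullet> y)) (at x)"
    by (rule fe_gradient[OF v T], rule that)
  obtain G where G: "continuous_on UNIV G" "\<And>x. x \<in> interior T \<Longrightarrow> (w has_derivative (\<lambda>y. G x \<bullet> y)) (at x)"
    by (rule fe_gradient[OF w T], rule that)
  let ?n = "\<lambda>x. \<nu> (closest_point \<Gamma> x)"
  let ?g = "\<lambda>x. indicator T x *\<^sub>R ((F x \<bullet> ?n x) * (G x \<bullet> ?n x))"
  have n: "continuous_on T ?n" by (rule continuous_on_extended_normal[OF T])
  have "continuous_on T (\<lambda>x. (F x \<bullet> ?n x) * (G x \<bullet> ?n x))"
    using F(1) G(1) n by (intro continuous_intros) (auto intro: continuous_on_subset)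
  then have l: "integrable lborel ?g"
    using compact_elem[OF T] borel_integrable_compact by blast
  then have g: "integrable lebesgue ?g"
    by (subst integrable_completion[OF borel_measurable_integrable[OF l]])
  have ae: "AE x in lebesgue. indicator T x *\<^sub>R (nderiv \<Gamma> \<nu> v x * nderiv \<Gamma> \<nu> w x) = ?g x"
    using AE_interior_elem[OF T]
  proof eventually_elim
    case (elim x)
    then show ?case
      by (cases "x \<in> T") (simp_all add: nderiv_def frechet_derivative_at[OF F(2), symmetric] frechet_derivative_at[OF G(2), symmetric])
  qed
  have "(\<lambda>x. indicator T x *\<^sub>R (nderiv \<Gamma> \<nu> v x * nderiv \<Gamma> \<nu> w x)) \<in> borel_measurable lebesgue"
    by (rule completion.measurable_AE_eq[OF _ ae]) (use g in auto)
  then show ?thesis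
    unfolding set_integrable_def using integrable_cong_AE[OF _ _ ae] g by auto
qed

text \<open>The local stabilization form without the power of \<open>h\<^sub>T\<close>.\<close>

definition q where
  "q T v w = (LINT x:T|lebesgue. nderiv \<Gamma> \<nu> v x * nderiv \<Gamma> \<nu> w x)"

lemma q_cong:
  assumes T: "T \<in> \<T>" and "v \<in> V" "w \<in> V"
    and "\<And>x. x \<in> interior T \<Longrightarrow> f x = g x"
    and "set_integrable lebesgue T f" "set_integrable lebesgue T g"
  shows "(LINT x:T|lebesgue. f x) = (LINT x:T|lebesgue. (g x :: real))"
  unfolding set_lebesgue_integral_def
proof (rule integral_cong_AE)
  show "AE x in lebesgue. indicator T x *\<^sub>R f x = indicator T x *\<^sub>R g x"
    using AE_interior_elem[OF T] by eventually_elim (use assms(4) in \<open>auto simp: indicator_def\<close>)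
qed (use assms in \<open>auto simp: set_integrable_def\<close>)

lemma psd_form_q:
  assumes T: "T \<in> \<T>"
  shows "psd_form V (q T)"
proof (unfold_locales, goal_cases)
  case 1 show ?case by (rule subspace_V)
next
  case (2 u v) show ?case by (simp add: q_def mult.commute)
next
  case (3 u v w)
  have uv: "u + v \<in> V" using 3 fun_space.subspace_add[OF subspace_V] by blast
  have "q T (u + v) w = (LINT x:T|lebesgue. nderiv \<Gamma> \<nu> u x * nderiv \<Gamma> \<nu> w x + nderiv \<Gamma> \<nu> v x * nderiv \<Gamma> \<nu> w x)"
    unfolding q_def
    by (rule q_cong[OF T uv \<open>w \<in> V\<close>])
       (use 3 T uv in \<open>auto simp: nderiv_add_interior distrib_right intro!: nderiv_product_integrable\<close>)
  also have "\<dots> = q T u w + q T v w"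
    unfolding q_def by (intro set_integral_add(2) nderiv_product_integrable 3 T)
  finally show ?case .
next
  case (4 u v c)
  have uv: "fscale c u \<in> V" using 4 fun_space.subspace_scale[OF subspace_V] by blast
  have "q T (fscale c u) v = (LINT x:T|lebesgue. c * (nderiv \<Gamma> \<nu> u x * nderiv \<Gamma> \<nu> v x))"
    unfolding q_def
    by (rule q_cong[OF T uv \<open>v \<in> V\<close>])
       (use 4 T uv in \<open>auto simp: nderiv_scale_interior mult.assoc intro!: nderiv_product_integrable\<close>)
  also have "\<dots> = c * q T u v"
    unfolding q_def by simp
  finally show ?case .
next
  case (5 u)
  show ?case unfolding q_def set_lebesgue_integral_def
    by (intro Bochner_Integration.integral_nonneg) simp
qed

lemma s_elem_eq: "s_elem \<Gamma> \<nu> j T v w = diameter T powi (1 - 2 * j) * q T v w"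
  by (simp add: s_elem_def q_def)

lemma psd_form_s: "psd_form V (s_form \<Gamma> \<nu> \<T> j)"
proof -
  have "psd_form V (\<lambda>v w. \<Sum>T\<in>\<T>. diameter T powi (1 - 2 * j) * q T v w)"
    using diameter_pos by (intro psd_form_sum psd_form_cmult psd_form_q subspace_V) (auto simp: less_imp_le)
  then show ?thesis by (simp add: s_form_def [abs_def] s_elem_eq)
qed

abbreviation s_nrm where "s_nrm j v \<equiv> sqrt (s_form \<Gamma> \<nu> \<T> j v v)"

lemma s_form_nonneg: "v \<in> V \<Longrightarrow> 0 \<le> s_form \<Gamma> \<nu> \<T> j v v"
  by (rule psd_form.nonneg[OF psd_form_s])

text \<open>The weights \<open>h\<^sub>T = (h\<^sub>T\<^sup>3)\<^sup>1\<^sup>/\<^sup>2 (h\<^sub>T\<^sup>-\<^sup>1)\<^sup>1\<^sup>/\<^sup>2\<close> make \<open>s\<^sub>0\<close> a duality between \<open>s\<^sub>-\<^sub>1\<close> and \<open>s\<^sub>1\<close>.\<close>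

lemma s_form_duality:
  assumes v: "v \<in> V" and w: "w \<in> V"
  shows "\<bar>s_form \<Gamma> \<nu> \<T> 0 v w\<bar> \<le> s_nrm (-1) v * s_nrm 1 w"
proof -
  have "\<bar>s_form \<Gamma> \<nu> \<T> 0 v w\<bar> \<le> (\<Sum>T\<in>\<T>. \<bar>diameter T * q T v w\<bar>)"
    unfolding s_form_def s_elem_eq by (simp add: sum_abs)
  also have "\<dots> \<le> (\<Sum>T\<in>\<T>. \<bar>sqrt (s_elem \<Gamma> \<nu> (-1) T v v)\<bar> * \<bar>sqrt (s_elem \<Gamma> \<nu> 1 T w w)\<bar>)"
  proof (rule sum_mono)
    fix T assume T: "T \<in> \<T>"
    interpret Q: psd_form V "q T" by (rule psd_form_q[OF T])
    let ?h = "diameter T"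
    have h: "?h > 0" by (rule diameter_pos[OF T])
    have e: "?h powi (1 - 2 * (-1)) = ?h ^ 3" "?h powi (1 - 2 * 1) = inverse ?h"
      using h by (simp_all add: power_int_def)
    have "\<bar>?h * q T v w\<bar> = ?h * \<bar>q T v w\<bar>" using h by (simp add: abs_mult)
    also have "\<dots> \<le> ?h * (sqrt (q T v v) * sqrt (q T w w))"
      using Q.Cauchy_Schwarz[OF v w] h by (simp add: Q.nrm_def)
    also have "\<dots> = (sqrt (?h ^ 3) * sqrt (inverse ?h)) * (sqrt (q T v v) * sqrt (q T w w))"
    proof -
      have "?h ^ 3 * inverse ?h = ?h\<^sup>2" using h by (simp add: power2_eq_square power3_eq_cube)
      then show ?thesis using h by (simp flip: real_sqrt_mult)
    qed
    finally show "\<bar>?h * q T v w\<bar> \<le> \<bar>sqrt (s_elem \<Gamma> \<nu> (-1) T v v)\<bar> * \<bar>sqrt (s_elem \<Gamma> \<nu> 1 T w w)\<bar>"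
      using h Q.nonneg[OF v] Q.nonneg[OF w] unfolding s_elem_eq e by (simp add: real_sqrt_mult mult_ac)
  qed
  also have "\<dots> \<le> L2_set (\<lambda>T. sqrt (s_elem \<Gamma> \<nu> (-1) T v v)) \<T> * L2_set (\<lambda>T. sqrt (s_elem \<Gamma> \<nu> 1 T w w)) \<T>"
    by (rule L2_set_mult_ineq)
  also have "\<dots> = s_nrm (-1) v * s_nrm 1 w"
  proof -
    have "0 \<le> s_elem \<Gamma> \<nu> j T u u" if "T \<in> \<T>" "u \<in> V" for j T u
      using that diameter_pos[of T] psd_form.nonneg[OF psd_form_q] by (auto simp: s_elem_eq intro!: mult_nonneg_nonneg)
    then show ?thesis using v w by (simp add: L2_set_def s_form_def)
  qed
  finally show ?thesis .
qed

lemma s_form_minus_one_le: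
  assumes v: "v \<in> V"
  shows "s_form \<Gamma> \<nu> \<T> (-1) v v \<le> (\<Sum>T\<in>\<T>. (diameter T)\<^sup>2 * (normL2_star_elem \<Gamma> \<nu> T v)\<^sup>2)"
  unfolding s_form_def
proof (rule sum_mono)
  fix T assume T: "T \<in> \<T>"
  let ?h = "diameter T"
  have h: "?h > 0" by (rule diameter_pos[OF T])
  have q: "q T v v \<ge> 0" by (rule psd_form.nonneg[OF psd_form_q[OF T] v])
  have L: "0 \<le> (LINT x:\<Gamma> \<inter> T|surface_measure \<Gamma>. (v x)\<^sup>2)"
    unfolding set_lebesgue_integral_def by (intro Bochner_Integration.integral_nonneg) simp
  have "s_elem \<Gamma> \<nu> (-1) T v v = ?h\<^sup>2 * s_elem \<Gamma> \<nu> 0 T v v"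
    by (simp add: s_elem_eq power_int_def power2_eq_square power3_eq_cube)
  also have "\<dots> \<le> ?h\<^sup>2 * (normL2_star_elem \<Gamma> \<nu> T v)\<^sup>2"
    using L q h by (intro mult_left_mono) (simp_all add: normL2_star_elem_def s_elem_eq)
  finally show "s_elem \<Gamma> \<nu> (-1) T v v \<le> ?h\<^sup>2 * (normL2_star_elem \<Gamma> \<nu> T v)\<^sup>2" .
qed

end

section \<open>Square integrable functions of time\<close>

lemma complete_measure_time: "complete_measure (time_measure \<tau>)"
proof
  fix A B assume A: "B \<subseteq> A" "A \<in> null_sets (time_measure \<tau>)"
  have S: "{0<..<\<tau>} \<in> sets lebesgue" by simp
  have "A \<in> null_sets lebesgue" "A \<subseteq> {0<..<\<tau>}"
    using A(2) null_sets_restrict_space[OF S] by auto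
  then have "B \<in> null_sets lebesgue" "B \<subseteq> {0<..<\<tau>}"
    using A(1) completion.complete2 by blast+
  then show "B \<in> sets (time_measure \<tau>)" by (simp add: sets_restrict_space_iff null_setsD2)
qed

lemma measurable_time_AE_limit:
  fixes l :: "real \<Rightarrow> real"
  assumes c: "\<And>k::nat. c k \<in> borel_measurable (time_measure \<tau>)"
    and lim: "AE t in time_measure \<tau>. (\<lambda>k. c k t) \<longlonglongrightarrow> l t"
  shows "l \<in> borel_measurable (time_measure \<tau>)"
proof -
  let ?M = "time_measure \<tau>"
  obtain Z where Z: "{t \<in> space ?M. \<not> (\<lambda>k. c k t) \<longlonglongrightarrow> l t} \<subseteq> Z" "emeasure ?M Z = 0" "Z \<in> sets ?M"
    by (rule AE_E[OF lim])
  have "(\<lambda>t. if t \<in> Z then 0 else l t) \<in> borel_measurable ?M"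
  proof (rule borel_measurable_LIMSEQ_real)
    show "(\<lambda>t. if t \<in> Z then 0 else c k t) \<in> borel_measurable ?M" for k
      using Z(3) c by (intro measurable_If_set) auto
    show "(\<lambda>k. if t \<in> Z then 0 else c k t) \<longlonglongrightarrow> (if t \<in> Z then 0 else l t)" if "t \<in> space ?M" for t
      using Z(1) that by auto
  qed
  moreover have "AE t in ?M. t \<notin> Z" using Z by (intro AE_not_in) auto
  then have "AE t in ?M. l t = (if t \<in> Z then 0 else l t)" by eventually_elim simp
  ultimately show ?thesis
    by (rule complete_measure.measurable_AE_eq[OF complete_measure_time]) simp
qed

lemma integral_time_cong_AE:
  fixes f g :: "real \<Rightarrow> real"
  assumes "g \<in> borel_measurable (time_measure \<tau>)" "AE t in time_measure \<tau>. f t = g t"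
  shows "(LINT t|time_measure \<tau>. f t) = (LINT t|time_measure \<tau>. g t)"
  by (rule integral_cong_AE[OF complete_measure.measurable_AE_eq[OF complete_measure_time assms]])
     (use assms in auto)

lemma integrable_time_cong_AE:
  fixes f g :: "real \<Rightarrow> real"
  assumes "integrable (time_measure \<tau>) g" "AE t in time_measure \<tau>. f t = g t"
  shows "integrable (time_measure \<tau>) f"
proof -
  have g: "g \<in> borel_measurable (time_measure \<tau>)" using assms(1) by simp
  have "f \<in> borel_measurable (time_measure \<tau>)"
    by (rule complete_measure.measurable_AE_eq[OF complete_measure_time g assms(2)]) simp
  then show ?thesis using integrable_cong_AE[OF _ g assms(2)] assms(1) by blast
qed

lemma L2_time_AE: "u \<in> L2_time \<tau> X N \<Longrightarrow> AE t in time_measure \<tau>. u t \<in> X"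
  by (simp add: L2_time_def)

lemma L2_time_integrable: "u \<in> L2_time \<tau> X N \<Longrightarrow> integrable (time_measure \<tau>) (\<lambda>t. (N (u t))\<^sup>2)"
  by (simp add: L2_time_def)

text \<open>A Lipschitz function of strongly measurable functions is measurable.\<close>

lemma L2_time_Lipschitz2:
  fixes H :: "('c \<Rightarrow> real) \<Rightarrow> ('d \<Rightarrow> real) \<Rightarrow> real"
  assumes u: "u \<in> L2_time \<tau> X N" and z: "z \<in> L2_time \<tau> Y N'"
    and Lip: "\<And>a a' b b'. a \<in> X \<Longrightarrow> a' \<in> X \<Longrightarrow> b \<in> Y \<Longrightarrow> b' \<in> Y \<Longrightarrow>
      \<bar>H a' b' - H a b\<bar> \<le> C * N (a' - a) + C * N' (b' - b)"
  shows "(\<lambda>t. H (u t) (z t)) \<in> borel_measurable (time_measure \<tau>)"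
proof -
  let ?M = "time_measure \<tau>"
  obtain s where s: "\<And>k::nat. simple_function ?M (s k)" "\<And>k. s k ` {0<..<\<tau>} \<subseteq> X"
    "AE t in ?M. (\<lambda>k. N (s k t - u t)) \<longlonglongrightarrow> 0"
    using u unfolding L2_time_def by blast
  obtain r where r: "\<And>k::nat. simple_function ?M (r k)" "\<And>k. r k ` {0<..<\<tau>} \<subseteq> Y"
    "AE t in ?M. (\<lambda>k. N' (r k t - z t)) \<longlonglongrightarrow> 0"
    using z unfolding L2_time_def by blast
  show ?thesis
  proof (rule measurable_time_AE_limit)
    show "(\<lambda>t. H (s k t) (r k t)) \<in> borel_measurable ?M" for k
      by (rule borel_measurable_simple_function, rule simple_function_compose2[where h = H]) (rule s r)+
    show "AE t in ?M. (\<lambda>k. H (s k t) (r k t)) \<longlonglongrightarrow> H (u t) (z t)"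
      using s(3) r(3) L2_time_AE[OF u] L2_time_AE[OF z] AE_space
    proof eventually_elim
      case (elim t)
      have "(\<lambda>k. C * N (s k t - u t) + C * N' (r k t - z t)) \<longlonglongrightarrow> C * 0 + C * 0"
        by (intro tendsto_intros elim)
      then have lim: "(\<lambda>k. C * N (s k t - u t) + C * N' (r k t - z t)) \<longlonglongrightarrow> 0" by simp
      have "norm (H (s k t) (r k t) - H (u t) (z t)) \<le> C * N (s k t - u t) + C * N' (r k t - z t)" for k
        unfolding real_norm_def
        by (rule Lip) (use elim s(2)[of k] r(2)[of k] in \<open>auto simp: image_subset_iff\<close>)
      then have "(\<lambda>k. H (s k t) (r k t) - H (u t) (z t)) \<longlonglongrightarrow> 0"
        by (intro Lim_null_comparison[OF always_eventually lim]) blast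
      then show ?case by (simp add: LIM_zero_iff)
    qed
  qed
qed

text \<open>A dummy second argument, used to specialize the preceding lemma to a single function.\<close>

lemma L2_time_zero: "(\<lambda>t. 0) \<in> L2_time \<tau> {0 :: real \<Rightarrow> real} (\<lambda>_. 0)"
  unfolding L2_time_def by (auto intro!: exI[of _ "\<lambda>k t. 0"])

lemma L2_time_Lipschitz:
  fixes H :: "('c \<Rightarrow> real) \<Rightarrow> real"
  assumes u: "u \<in> L2_time \<tau> X N"
    and Lip: "\<And>a a'. a \<in> X \<Longrightarrow> a' \<in> X \<Longrightarrow> \<bar>H a' - H a\<bar> \<le> C * N (a' - a)"
  shows "(\<lambda>t. H (u t)) \<in> borel_measurable (time_measure \<tau>)"
  by (rule L2_time_Lipschitz2[where H = "\<lambda>a b. H a", OF u L2_time_zero, of C]) (simp add: Lip)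

lemma L2_time_square_integrable:
  fixes f :: "real \<Rightarrow> real"
  assumes u: "u \<in> L2_time \<tau> X N" and f: "f \<in> borel_measurable (time_measure \<tau>)"
    and bound: "AE t in time_measure \<tau>. u t \<in> X \<longrightarrow> \<bar>f t\<bar> \<le> C * N (u t)"
  shows "integrable (time_measure \<tau>) (\<lambda>t. (f t)\<^sup>2)"
proof (rule Bochner_Integration.integrable_bound)
  show "integrable (time_measure \<tau>) (\<lambda>t. C\<^sup>2 * (N (u t))\<^sup>2)"
    using L2_time_integrable[OF u] by simp
  show "AE t in time_measure \<tau>. norm ((f t)\<^sup>2) \<le> norm (C\<^sup>2 * (N (u t))\<^sup>2)"
    using bound L2_time_AE[OF u]
  proof eventually_elim
    case (elim t)
    then have "\<bar>f t\<bar>\<^sup>2 \<le> (C * N (u t))\<^sup>2" by (intro power_mono) auto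
    then show ?case by (simp add: power_mult_distrib)
  qed
qed (use f in measurable)

lemma integrable_time_square:
  fixes f :: "real \<Rightarrow> real"
  assumes "f \<in> borel_measurable (time_measure \<tau>)" "integrable (time_measure \<tau>) (\<lambda>t. (f t)\<^sup>2)"
  shows "integrable (time_measure \<tau>) f"
proof -
  interpret finite_measure "time_measure \<tau>" by (rule finite_measure_time)
  have "integrable (time_measure \<tau>) (\<lambda>t. f t * 1)"
    by (rule integrable_product_squares) (use assms in auto)
  then show ?thesis by simp
qed

lemma L2_time_indicator:
  assumes w: "w \<in> X" and zero: "0 \<in> X" "N 0 = 0" and A: "A \<in> sets (time_measure \<tau>)"
  shows "(\<lambda>t. if t \<in> A then w else 0) \<in> L2_time \<tau> X N"
  unfolding L2_time_def
proof (intro CollectI conjI exI[of _ "\<lambda>k t. if t \<in> A then w else 0"] allI)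
  let ?M = "time_measure \<tau>"
  show "AE t in ?M. (if t \<in> A then w else 0) \<in> X" using w zero by auto
  show "AE t in ?M. (\<lambda>k. N ((if t \<in> A then w else 0) - (if t \<in> A then w else 0))) \<longlonglongrightarrow> 0"
    using zero by simp
  show "(\<lambda>t. if t \<in> A then w else 0) ` {0<..<\<tau>} \<subseteq> X" using w zero by auto
  show "simple_function ?M (\<lambda>t. if t \<in> A then w else 0)"
    using A by (intro simple_function_If_set) auto
  have "integrable ?M (\<lambda>t. (if t \<in> A then (N w)\<^sup>2 else 0))"
    by (rule integrable_time_bounded[where B = "(N w)\<^sup>2"]) (use A in \<open>auto intro!: measurable_If_set\<close>)
  then show "integrable ?M (\<lambda>t. (N (if t \<in> A then w else 0))\<^sup>2)"
    by (rule Bochner_Integration.integrable_cong[OF refl, THEN iffD1, rotated]) (auto simp: zero)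
qed

text \<open>Integrable functions with the same integrals over all measurable sets agree almost everywhere.
  The integrals are written with a cut-off integrand, the form in which a variational equation
  delivers them.\<close>

lemma AE_le_from_tests:
  fixes p q :: "'b \<Rightarrow> real"
  assumes p: "integrable M p" and q: "integrable M q"
    and eq: "\<And>A. A \<in> sets M \<Longrightarrow> (LINT t|M. (if t \<in> A then p t else 0)) = (LINT t|M. (if t \<in> A then q t else 0))"
  shows "AE t in M. p t \<le> q t"
proof -
  have m[measurable]: "p \<in> borel_measurable M" "q \<in> borel_measurable M" using p q by auto
  define A where "A = {t \<in> space M. q t < p t}"
  have A[measurable]: "A \<in> sets M" unfolding A_def by measurable
  have i: "integrable M (\<lambda>t. (if t \<in> A then f t else 0))" if "integrable M f" for f :: "'b \<Rightarrow> real"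
  proof -
    have "(\<lambda>t. if t \<in> A then f t else 0) = (\<lambda>t. f t * indicator A t)"
      by (auto simp: indicator_def)
    then show ?thesis using integrable_real_mult_indicator[OF A that] by simp
  qed
  have d: "integrable M (\<lambda>t. (if t \<in> A then p t - q t else 0))" using p q by (intro i) auto
  have "(LINT t|M. (if t \<in> A then p t - q t else 0))
      = (LINT t|M. (if t \<in> A then p t else 0) - (if t \<in> A then q t else 0))"
    by (intro Bochner_Integration.integral_cong) auto
  also have "\<dots> = 0" using eq[OF A] i p q by (simp add: Bochner_Integration.integral_diff)
  finally have "AE t in M. (if t \<in> A then p t - q t else 0) = 0"
    by (subst (asm) integral_nonneg_eq_0_iff_AE[OF d]) (auto simp: A_def)
  then show ?thesis using AE_space
    by eventually_elim (auto simp: A_def split: if_splits)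
qed

lemma AE_eq_from_tests:
  fixes p q :: "'b \<Rightarrow> real"
  assumes "integrable M p" "integrable M q"
    and "\<And>A. A \<in> sets M \<Longrightarrow> (LINT t|M. (if t \<in> A then p t else 0)) = (LINT t|M. (if t \<in> A then q t else 0))"
  shows "AE t in M. p t = q t"
proof -
  have "AE t in M. q t \<le> p t" by (rule AE_le_from_tests[OF assms(2,1)]) (simp add: assms(3))
  moreover have "AE t in M. p t \<le> q t" by (rule AE_le_from_tests[OF assms(1,2)]) (simp add: assms(3))
  ultimately show ?thesis by eventually_elim simp
qed

lemma integrable_time_continuous_mult:
  fixes \<phi> G :: "real \<Rightarrow> real"
  assumes \<phi>: "continuous_on {0..\<tau>} \<phi>" and G: "integrable (time_measure \<tau>) G"
  shows "integrable (time_measure \<tau>) (\<lambda>t. \<phi> t * G t)"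
proof -
  have "compact (\<phi> ` {0..\<tau>})"
    by (rule compact_continuous_image[OF \<phi>]) simp
  then obtain B where B: "\<forall>y\<in>\<phi> ` {0..\<tau>}. norm y \<le> B"
    using compact_imp_bounded bounded_iff by metis
  show ?thesis
  proof (rule Bochner_Integration.integrable_bound)
    show "integrable (time_measure \<tau>) (\<lambda>t. B * G t)" using G by simp
    show "(\<lambda>t. \<phi> t * G t) \<in> borel_measurable (time_measure \<tau>)"
      by (intro borel_measurable_times continuous_imp_measurable_time[OF \<phi>] borel_measurable_integrable[OF G])
    have "\<bar>\<phi> t\<bar> \<le> \<bar>B\<bar>" if "t \<in> {0<..<\<tau>}" for t
      using B that by (smt (verit) atLeastAtMost_iff greaterThanLessThan_iff image_eqI real_norm_def)
    then show "AE t in time_measure \<tau>. norm (\<phi> t * G t) \<le> norm (B * G t)"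
      by (intro AE_I2) (simp add: abs_mult mult_right_mono)
  qed
qed

lemma test_function_continuous:
  "\<forall>t. (\<phi> has_real_derivative \<phi>' t) (at t) \<Longrightarrow> continuous_on S \<phi>"
  by (intro continuous_at_imp_continuous_on ballI DERIV_isCont) blast

lemma weak_derivD:
  assumes "weak_deriv \<tau> F G"
    and "(\<forall>t. (\<phi> has_real_derivative \<phi>' t) (at t)) \<and> continuous_on UNIV \<phi>' \<and>
      compact (closure {t. \<phi> t \<noteq> 0}) \<and> closure {t. \<phi> t \<noteq> 0} \<subseteq> {0<..<\<tau>}"
  shows "(LINT t|time_measure \<tau>. \<phi>' t * F t) = - (LINT t|time_measure \<tau>. \<phi> t * G t)"
  using assms unfolding weak_deriv_def by blast

lemma weak_deriv_sum:
  assumes F: "\<And>i. i \<in> I \<Longrightarrow> integrable (time_measure \<tau>) (F i)"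
    and G: "\<And>i. i \<in> I \<Longrightarrow> integrable (time_measure \<tau>) (G i)"
    and wd: "\<And>i. i \<in> I \<Longrightarrow> weak_deriv \<tau> (F i) (G i)"
  shows "weak_deriv \<tau> (\<lambda>t. \<Sum>i\<in>I. c i * F i t) (\<lambda>t. \<Sum>i\<in>I. c i * G i t)"
  unfolding weak_deriv_def
proof (intro allI impI)
  fix \<phi> \<phi>' :: "real \<Rightarrow> real"
  assume \<phi>: "(\<forall>t. (\<phi> has_real_derivative \<phi>' t) (at t)) \<and> continuous_on UNIV \<phi>' \<and>
    compact (closure {t. \<phi> t \<noteq> 0}) \<and> closure {t. \<phi> t \<noteq> 0} \<subseteq> {0<..<\<tau>}"
  then have c: "continuous_on {0..\<tau>} \<phi>" "continuous_on {0..\<tau>} \<phi>'"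
    by (auto intro: test_function_continuous continuous_on_subset)
  have "(LINT t|time_measure \<tau>. \<phi>' t * (\<Sum>i\<in>I. c i * F i t))
      = (LINT t|time_measure \<tau>. (\<Sum>i\<in>I. c i * (\<phi>' t * F i t)))"
    by (intro Bochner_Integration.integral_cong refl) (simp add: sum_distrib_left mult_ac)
  also have "\<dots> = (\<Sum>i\<in>I. c i * (LINT t|time_measure \<tau>. \<phi>' t * F i t))"
    by (subst Bochner_Integration.integral_sum) (auto intro!: integrable_time_continuous_mult c F)
  also have "\<dots> = (\<Sum>i\<in>I. c i * (- (LINT t|time_measure \<tau>. \<phi> t * G i t)))"
    by (intro sum.cong refl) (simp only: weak_derivD[OF wd \<phi>])
  also have "\<dots> = - (LINT t|time_measure \<tau>. (\<Sum>i\<in>I. c i * (\<phi> t * G i t)))"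
    by (subst Bochner_Integration.integral_sum)
      (auto intro!: integrable_time_continuous_mult c G simp: sum_negf)
  also have "\<dots> = - (LINT t|time_measure \<tau>. \<phi> t * (\<Sum>i\<in>I. c i * G i t))"
    by (intro arg_cong[where f = uminus] Bochner_Integration.integral_cong refl)
       (simp add: sum_distrib_left mult_ac)
  finally show "(LINT t|time_measure \<tau>. \<phi>' t * (\<Sum>i\<in>I. c i * F i t))
    = - (LINT t|time_measure \<tau>. \<phi> t * (\<Sum>i\<in>I. c i * G i t))" .
qed

lemma weak_deriv_diff:
  assumes "integrable (time_measure \<tau>) F" "integrable (time_measure \<tau>) F'"
    and "integrable (time_measure \<tau>) G" "integrable (time_measure \<tau>) G'"
    and "weak_deriv \<tau> F G" "weak_deriv \<tau> F' G'"
  shows "weak_deriv \<tau> (\<lambda>t. F t - F' t) (\<lambda>t. G t - G' t)"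
  using weak_deriv_sum[of UNIV \<tau> "\<lambda>b. if b then F else F'" "\<lambda>b. if b then G else G'" "\<lambda>b. if b then 1 else -1"]
    assms by (simp add: UNIV_bool)

lemma weak_deriv_cong_AE:
  assumes "weak_deriv \<tau> F G" "AE t in time_measure \<tau>. F t = F' t" "AE t in time_measure \<tau>. G t = G' t"
    and [measurable]: "F \<in> borel_measurable (time_measure \<tau>)" "F' \<in> borel_measurable (time_measure \<tau>)"
    "G \<in> borel_measurable (time_measure \<tau>)" "G' \<in> borel_measurable (time_measure \<tau>)"
  shows "weak_deriv \<tau> F' G'"
  unfolding weak_deriv_def
proof (intro allI impI)
  fix \<phi> \<phi>' :: "real \<Rightarrow> real"
  assume \<phi>: "(\<forall>t. (\<phi> has_real_derivative \<phi>' t) (at t)) \<and> continuous_on UNIV \<phi>' \<and>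
    compact (closure {t. \<phi> t \<noteq> 0}) \<and> closure {t. \<phi> t \<noteq> 0} \<subseteq> {0<..<\<tau>}"
  then have c: "continuous_on {0..\<tau>} \<phi>" "continuous_on {0..\<tau>} \<phi>'"
    by (auto intro: test_function_continuous continuous_on_subset)
  have [measurable]: "\<phi> \<in> borel_measurable (time_measure \<tau>)" "\<phi>' \<in> borel_measurable (time_measure \<tau>)"
    using c by (auto intro: continuous_imp_measurable_time)
  have "(LINT t|time_measure \<tau>. \<phi>' t * F' t) = (LINT t|time_measure \<tau>. \<phi>' t * F t)"
    by (rule integral_cong_AE) (use assms(2) in auto)
  also have "\<dots> = - (LINT t|time_measure \<tau>. \<phi> t * G t)"
    by (rule weak_derivD[OF assms(1) \<phi>])
  also have "(LINT t|time_measure \<tau>. \<phi> t * G t) = (LINT t|time_measure \<tau>. \<phi> t * G' t)"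
    by (rule integral_cong_AE) (use assms(3) in auto)
  finally show "(LINT t|time_measure \<tau>. \<phi>' t * F' t) = - (LINT t|time_measure \<tau>. \<phi> t * G' t)" .
qed

lemma weak_deriv_exp:
  assumes F: "integrable (time_measure \<tau>) F" and G: "integrable (time_measure \<tau>) G"
    and wd: "weak_deriv \<tau> F G"
  shows "weak_deriv \<tau> (\<lambda>t. exp (- t) * F t) (\<lambda>t. exp (- t) * (G t - F t))"
  unfolding weak_deriv_def
proof (intro allI impI)
  fix \<phi> \<phi>' :: "real \<Rightarrow> real"
  assume \<phi>: "(\<forall>t. (\<phi> has_real_derivative \<phi>' t) (at t)) \<and> continuous_on UNIV \<phi>' \<and>
    compact (closure {t. \<phi> t \<noteq> 0}) \<and> closure {t. \<phi> t \<noteq> 0} \<subseteq> {0<..<\<tau>}"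
  have cU: "continuous_on UNIV \<phi>" "continuous_on UNIV \<phi>'"
    using \<phi> by (auto intro: test_function_continuous)
  then have c: "continuous_on {0..\<tau>} \<phi>" "continuous_on {0..\<tau>} \<phi>'"
    by (auto intro: continuous_on_subset)
  let ?\<psi> = "\<lambda>t. \<phi> t * exp (- t)"
  let ?\<psi>' = "\<lambda>t. \<phi>' t * exp (- t) - \<phi> t * exp (- t)"
  have "{t. ?\<psi> t \<noteq> 0} = {t. \<phi> t \<noteq> 0}" by simp
  moreover have "\<forall>t. (?\<psi> has_real_derivative ?\<psi>' t) (at t)"
    using \<phi> by (auto intro!: derivative_eq_intros)
  moreover have "continuous_on UNIV ?\<psi>'" by (intro continuous_intros cU)
  ultimately have "(LINT t|time_measure \<tau>. ?\<psi>' t * F t) = - (LINT t|time_measure \<tau>. ?\<psi> t * G t)"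
    using \<phi> by (intro weak_derivD[OF wd]) simp
  moreover have "(LINT t|time_measure \<tau>. ?\<psi>' t * F t)
      = (LINT t|time_measure \<tau>. \<phi>' t * (exp (- t) * F t)) - (LINT t|time_measure \<tau>. ?\<psi> t * F t)"
  proof -
    have "integrable (time_measure \<tau>) (\<lambda>t. \<phi>' t * (exp (- t) * F t))"
      by (intro integrable_time_continuous_mult continuous_intros c F)
    moreover have "integrable (time_measure \<tau>) (\<lambda>t. ?\<psi> t * F t)"
      by (intro integrable_time_continuous_mult continuous_intros c F)
    ultimately show ?thesis
      by (subst Bochner_Integration.integral_diff[symmetric]) (auto simp: algebra_simps)
  qed
  moreover have "(LINT t|time_measure \<tau>. \<phi> t * (exp (- t) * (G t - F t)))
      = (LINT t|time_measure \<tau>. ?\<psi> t * G t) - (LINT t|time_measure \<tau>. ?\<psi> t * F t)"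
  proof -
    have "integrable (time_measure \<tau>) (\<lambda>t. ?\<psi> t * G t)"
      by (intro integrable_time_continuous_mult continuous_intros c G)
    moreover have "integrable (time_measure \<tau>) (\<lambda>t. ?\<psi> t * F t)"
      by (intro integrable_time_continuous_mult continuous_intros c F)
    ultimately show ?thesis
      by (subst Bochner_Integration.integral_diff[symmetric]) (auto simp: algebra_simps)
  qed
  ultimately show "(LINT t|time_measure \<tau>. \<phi>' t * (exp (- t) * F t))
    = - (LINT t|time_measure \<tau>. \<phi> t * (exp (- t) * (G t - F t)))" by simp
qed

text \<open>The weight \<open>exp (- 2 t)\<close> takes the place of Gronwall's lemma: the function \<open>exp (- t) F\<close> has
  derivative \<open>exp (- t) (G - F)\<close>, which supplies the zeroth order term \<open>F\<^sup>2\<close>.\<close>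

lemma weighted_energy:
  assumes F: "continuous_on {0..\<tau>} F" and G: "integrable (time_measure \<tau>) G"
    and wd: "weak_deriv \<tau> F G" and \<tau>: "0 < \<tau>"
  shows "integrable (time_measure \<tau>) (\<lambda>t. exp (- 2 * t) * (F t * G t - (F t)\<^sup>2))"
    and "- (F 0)\<^sup>2 \<le> 2 * (LINT t|time_measure \<tau>. exp (- 2 * t) * (F t * G t - (F t)\<^sup>2))"
proof -
  let ?F = "\<lambda>t. exp (- t) * F t" and ?G = "\<lambda>t. exp (- t) * (G t - F t)"
  have Fi: "integrable (time_measure \<tau>) F" by (rule continuous_imp_integrable_time[OF F])
  have c: "continuous_on {0..\<tau>} ?F" by (intro continuous_intros F)
  have i: "integrable (time_measure \<tau>) ?G"
    by (intro integrable_time_continuous_mult continuous_intros Bochner_Integration.integrable_diff G Fi)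
  have "exp (- 2 * t) = exp (- t) * exp (- t)" for t :: real
    by (simp flip: exp_add)
  then have eq: "exp (- 2 * t) * (F t * G t - (F t)\<^sup>2) = ?F t * ?G t" for t
    by (simp add: power2_eq_square algebra_simps)
  show "integrable (time_measure \<tau>) (\<lambda>t. exp (- 2 * t) * (F t * G t - (F t)\<^sup>2))"
    unfolding eq by (rule integrable_time_continuous_mult[OF c i])
  have "2 * (LINT t|time_measure \<tau>. ?F t * ?G t) = (?F \<tau>)\<^sup>2 - (?F 0)\<^sup>2"
    by (rule weak_deriv_energy[OF c i weak_deriv_exp[OF Fi G wd] \<tau>])
  then show "- (F 0)\<^sup>2 \<le> 2 * (LINT t|time_measure \<tau>. exp (- 2 * t) * (F t * G t - (F t)\<^sup>2))"
    unfolding eq by simp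
qed

section \<open>The discrete spaces\<close>

text \<open>Linear functionals on a subspace \<open>X\<close>; nothing is required outside \<open>X\<close>.\<close>

definition functional_on :: "('a \<Rightarrow> real) set \<Rightarrow> (('a \<Rightarrow> real) \<Rightarrow> real) \<Rightarrow> bool" where
  "functional_on X L \<longleftrightarrow> (\<forall>u\<in>X. \<forall>v\<in>X. L (u + v) = L u + L v) \<and> (\<forall>u\<in>X. \<forall>c. L (fscale c u) = c * L u)"

lemma functional_on_sum:
  assumes L: "functional_on X L" and X: "fun_space.subspace X" and e: "\<And>i. i \<in> I \<Longrightarrow> e i \<in> X"
  shows "L (\<Sum>i\<in>I. fscale (c i) (e i)) = (\<Sum>i\<in>I. c i * L (e i))"
proof -
  have "L (fscale 0 0) = 0 * L 0" using L fun_space.subspace_0[OF X] unfolding functional_on_def by blast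
  then have L0: "L 0 = 0" by (simp add: fun_space.scale_zero_left)
  show ?thesis
    using e
  proof (induction I rule: infinite_finite_induct)
    case (insert i I)
    have s: "(\<Sum>i\<in>I. fscale (c i) (e i)) \<in> X" "fscale (c i) (e i) \<in> X"
      using insert.prems by (auto intro!: fun_space.subspace_sum[OF X] fun_space.subspace_scale[OF X])
    have eq: "(\<Sum>i\<in>insert i I. fscale (c i) (e i)) = fscale (c i) (e i) + (\<Sum>i\<in>I. fscale (c i) (e i))"
      by (rule sum.insert) (use insert in auto)
    have "L (fscale (c i) (e i) + (\<Sum>i\<in>I. fscale (c i) (e i))) = c i * L (e i) + (\<Sum>i\<in>I. c i * L (e i))"
      using L s insert.IH insert.prems unfolding functional_on_def by simp
    then show ?case using insert by (simp only: eq) simp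
  qed (simp_all add: L0)
qed

lemma functional_on_diff:
  assumes "functional_on X L" "fun_space.subspace X" "u \<in> X" "v \<in> X"
  shows "L (u - v) = L u - L v"
proof -
  have "L (u + fscale (- 1) v) = L u + (- 1) * L v"
    using assms fun_space.subspace_scale[OF assms(2,4)] unfolding functional_on_def by metis
  then show ?thesis unfolding minus_fscale by simp
qed

lemma (in psd_form) functional_left: "w \<in> X \<Longrightarrow> functional_on X (\<lambda>v. B v w)"
  by (simp add: functional_on_def add scale)

lemma (in psd_form) functional_right: "w \<in> X \<Longrightarrow> functional_on X (B w)"
  by (simp add: functional_on_def add_right scale_right)

lemma functional_on_add:
  "functional_on X L \<Longrightarrow> functional_on X K \<Longrightarrow> functional_on X (\<lambda>v. L v + K v)"
  by (simp add: functional_on_def distrib_left)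

lemma functional_on_subset: "functional_on X L \<Longrightarrow> Y \<subseteq> X \<Longrightarrow> functional_on Y L"
  unfolding functional_on_def by blast

lemma functional_on_Hm1: "F \<in> Hm1\<Gamma> \<Gamma> \<nu> \<Longrightarrow> functional_on (H1\<Gamma> \<Gamma> \<nu>) F"
  by (simp add: functional_on_def Hm1\<Gamma>_def)

lemma functional_on_point: "functional_on X (\<lambda>v. v x)"
  by (simp add: functional_on_def fscale_def)

text \<open>Below, \<open>ips\<close> and \<open>nS\<close> are the stabilized \<open>L\<^sup>2\<close> inner product and norm, and \<open>nH\<close> is the stabilized
  \<open>H\<^sup>1\<close> norm.\<close>

locale trace_fem = cut_mesh \<Gamma> \<nu> \<T> V
  for \<Gamma> :: "'a::euclidean_space set" and \<nu> :: "'a \<Rightarrow> 'a" and \<T> :: "'a set set"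
    and V :: "('a \<Rightarrow> real) set" +
  assumes V_H1: "V \<subseteq> H1\<Gamma> \<Gamma> \<nu>"
    and inner: "inner_product_on V (ip_star \<Gamma> \<nu> \<T>)"
begin

abbreviation "ips \<equiv> ip_star \<Gamma> \<nu> \<T>"
abbreviation "nS \<equiv> norm_star \<Gamma> \<nu> \<T>"
abbreviation "nH \<equiv> normH1_star \<Gamma> \<nu> \<T>"

lemma V_L2: "V \<subseteq> L2\<Gamma> \<Gamma>"
  using V_H1 H1_subset_L2 by blast

lemma psd_form_ipV: "psd_form V (ip\<Gamma> \<Gamma>)"
  by (rule psd_form.restrict[OF psd_form_ip subspace_V V_L2])

lemma psd_form_aV: "psd_form V (a_form \<Gamma> \<nu>)"
  by (rule psd_form.restrict[OF psd_form_a subspace_V V_H1])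

lemma psd_form_star: "psd_form V ips"
  using psd_form_add[OF psd_form_ipV psd_form_s] by (simp add: ip_star_def [abs_def])

lemma psd_form_a_star: "psd_form V (a_star \<Gamma> \<nu> \<T>)"
  using psd_form_add[OF psd_form_aV psd_form_s] by (simp add: a_star_def [abs_def])

lemma psd_form_H1_star: "psd_form V (\<lambda>v w. ip\<Gamma> \<Gamma> v w + a_star \<Gamma> \<nu> \<T> v w)"
  by (rule psd_form_add[OF psd_form_ipV psd_form_a_star])

sublocale S: psd_form V ips by (rule psd_form_star)

sublocale H: psd_form V "\<lambda>v w. ip\<Gamma> \<Gamma> v w + a_star \<Gamma> \<nu> \<T> v w" by (rule psd_form_H1_star)

lemma nS_eq: "nS = S.nrm"
  by (simp add: fun_eq_iff norm_star_def S.nrm_def)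

lemma nH_eq: "nH = H.nrm"
  by (rule ext, subst H.nrm_def) (simp only: normH1_star_def a_star_def normH1_sq add.assoc)

lemma nH_sq: "v \<in> V \<Longrightarrow> (nH v)\<^sup>2 = ip\<Gamma> \<Gamma> v v + a_star \<Gamma> \<nu> \<T> v v"
  by (simp add: nH_eq H.nrm_sq)

lemma nH_nonneg: "v \<in> V \<Longrightarrow> 0 \<le> nH v"
  by (simp add: nH_eq H.nrm_nonneg)

lemma ips_pos: "u \<in> V \<Longrightarrow> u \<noteq> 0 \<Longrightarrow> ips u u > 0"
  using inner unfolding inner_product_on_def by blast

lemma orthonormal_basis_V:
  obtains E where "finite E" "E \<subseteq> V"
    "\<And>d e. d \<in> E \<Longrightarrow> e \<in> E \<Longrightarrow> ips d e = (if d = e then 1 else 0)"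
    "\<And>v. v \<in> V \<Longrightarrow> v = (\<Sum>e\<in>E. fscale (ips v e) e)"
proof -
  obtain B where B: "finite B" "V = fun_space.span B" using fe unfolding fe_space_def by blast
  have "B \<subseteq> V" using B fun_space.span_superset by blast
  then have "\<exists>E. finite E \<and> E \<subseteq> fun_space.span B \<and>
    (\<forall>d\<in>E. \<forall>e\<in>E. ips d e = (if d = e then 1 else 0)) \<and>
    (\<forall>v\<in>fun_space.span B. v = (\<Sum>e\<in>E. fscale (ips v e) e))"
    by (intro S.orthonormal_basis B(1) ips_pos)
  then obtain E where E: "finite E" "E \<subseteq> V" "\<forall>d\<in>E. \<forall>e\<in>E. ips d e = (if d = e then 1 else 0)"
    "\<forall>v\<in>V. v = (\<Sum>e\<in>E. fscale (ips v e) e)"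
    unfolding B(2)[symmetric] by (elim exE conjE) (rule that)
  show ?thesis by (rule that[OF E(1,2) E(3)[rule_format] E(4)[rule_format]])
qed

lemma abs_ips_le: "v \<in> V \<Longrightarrow> w \<in> V \<Longrightarrow> \<bar>ips v w\<bar> \<le> nS v * nS w"
  unfolding nS_eq by (rule S.Cauchy_Schwarz)

lemma normL2_le_nS:
  assumes "v \<in> V" shows "normL2\<Gamma> \<Gamma> v \<le> nS v"
  unfolding normL2\<Gamma>_def norm_star_def ip_star_def using s_form_nonneg[OF assms] by simp

text \<open>In finite dimensions every functional and every seminorm is bounded; the constants may
  depend on the mesh and are used for measurability and integrability only.\<close>

lemma functional_bounded:
  assumes L: "functional_on V L"
  obtains C where "\<And>v. v \<in> V \<Longrightarrow> \<bar>L v\<bar> \<le> C * nS v"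
proof -
  obtain E where E: "finite E" "E \<subseteq> V" "\<And>v. v \<in> V \<Longrightarrow> v = (\<Sum>e\<in>E. fscale (ips v e) e)"
    by (rule orthonormal_basis_V) (rule that)
  have "\<bar>L v\<bar> \<le> (\<Sum>e\<in>E. nS e * \<bar>L e\<bar>) * nS v" if v: "v \<in> V" for v
  proof -
    have "L v = L (\<Sum>e\<in>E. fscale (ips v e) e)" by (simp only: E(3)[OF v, symmetric])
    also have "\<dots> = (\<Sum>e\<in>E. ips v e * L e)"
      by (rule functional_on_sum[OF L subspace_V]) (use E(2) in auto)
    finally have "L v = (\<Sum>e\<in>E. ips v e * L e)" .
    then have "\<bar>L v\<bar> \<le> (\<Sum>e\<in>E. \<bar>ips v e\<bar> * \<bar>L e\<bar>)"
      unfolding abs_mult[symmetric] by (simp only: sum_abs)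
    also have "\<dots> \<le> (\<Sum>e\<in>E. (nS v * nS e) * \<bar>L e\<bar>)"
      using E(2) v by (intro sum_mono mult_right_mono abs_ips_le) auto
    also have "\<dots> = (\<Sum>e\<in>E. nS e * \<bar>L e\<bar>) * nS v" by (simp add: sum_distrib_left mult_ac)
    finally show ?thesis .
  qed
  then show ?thesis by (rule that)
qed

lemma seminorm_bounded:
  assumes "psd_form V B"
  obtains C where "0 \<le> C" "\<And>v. v \<in> V \<Longrightarrow> sqrt (B v v) \<le> C * nS v"
proof -
  interpret B: psd_form V B by fact
  obtain E where E: "finite E" "E \<subseteq> V" "\<And>v. v \<in> V \<Longrightarrow> v = (\<Sum>e\<in>E. fscale (ips v e) e)"
    by (rule orthonormal_basis_V) (rule that)
  have "sqrt (B v v) \<le> (\<Sum>e\<in>E. nS e * B.nrm e) * nS v" if v: "v \<in> V" for v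
  proof -
    have "sqrt (B v v) = B.nrm (\<Sum>e\<in>E. fscale (ips v e) e)"
      using E(3)[OF v] by (simp add: B.nrm_def)
    also have "\<dots> \<le> (\<Sum>e\<in>E. \<bar>ips v e\<bar> * B.nrm e)"
      by (rule B.nrm_sum) (use E(2) in auto)
    also have "\<dots> \<le> (\<Sum>e\<in>E. (nS v * nS e) * B.nrm e)"
      using E(2) v by (intro sum_mono mult_right_mono abs_ips_le B.nrm_nonneg) auto
    also have "\<dots> = (\<Sum>e\<in>E. nS e * B.nrm e) * nS v" by (simp add: sum_distrib_left mult_ac)
    finally show ?thesis .
  qed
  moreover have "0 \<le> (\<Sum>e\<in>E. nS e * B.nrm e)"
    using E(2) B.nrm_nonneg S.nrm_nonneg by (intro sum_nonneg mult_nonneg_nonneg) (auto simp: nS_eq)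
  ultimately show ?thesis by (rule that[rotated])
qed

text \<open>Since \<open>ips\<close> is definite on \<open>V\<close>, the description that defines \<open>P_h\<close> denotes the Riesz
  representative.\<close>

lemma P_h_characterization:
  assumes F: "functional_on V F"
  shows "P_h \<Gamma> \<nu> \<T> V F \<in> V" "\<And>v. v \<in> V \<Longrightarrow> ips (P_h \<Gamma> \<nu> \<T> V F) v = F v"
proof -
  obtain E where E: "finite E" "E \<subseteq> V" "\<And>v. v \<in> V \<Longrightarrow> v = (\<Sum>e\<in>E. fscale (ips v e) e)"
    by (rule orthonormal_basis_V) (rule that)
  define p where "p = (\<Sum>e\<in>E. fscale (F e) e)"
  have pV: "p \<in> V"
    unfolding p_def using E(2) by (intro fun_space.subspace_sum[OF subspace_V] fun_space.subspace_scale[OF subspace_V]) auto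
  have pF: "ips p v = F v" if v: "v \<in> V" for v
  proof -
    have "ips p v = (\<Sum>e\<in>E. F e * ips e v)"
      unfolding p_def using E(2) v by (intro S.sum_left) auto
    also have "\<dots> = (\<Sum>e\<in>E. ips v e * F e)"
      using E(2) v by (intro sum.cong refl) (simp add: S.sym[of v] subset_iff)
    also have "\<dots> = F (\<Sum>e\<in>E. fscale (ips v e) e)"
      by (rule functional_on_sum[OF F subspace_V, symmetric]) (use E(2) in auto)
    also have "\<dots> = F v" by (simp only: E(3)[OF v, symmetric])
    finally show ?thesis .
  qed
  have uniq: "r = p" if r: "r \<in> V" "\<forall>v\<in>V. ips r v = F v" for r
  proof (rule ccontr)
    assume "r \<noteq> p"
    have "r - p \<in> V" using r pV by (intro S.mem)
    moreover have "ips (r - p) (r - p) = 0"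
      using calculation r(2) pF S.diff[OF r(1) pV] by simp
    ultimately show False using ips_pos[of "r - p"] \<open>r \<noteq> p\<close> by simp
  qed
  have "P_h \<Gamma> \<nu> \<T> V F = p"
    unfolding P_h_def by (rule the_equality) (use pV pF uniq in blast)+
  then show "P_h \<Gamma> \<nu> \<T> V F \<in> V" "\<And>v. v \<in> V \<Longrightarrow> ips (P_h \<Gamma> \<nu> \<T> V F) v = F v"
    using pV pF by auto
qed

lemma P_h_norm_bound:
  assumes B: "P_h_norm \<Gamma> \<nu> \<T> V \<le> ennreal B" "0 \<le> B"
    and v: "v \<in> H1\<Gamma> \<Gamma> \<nu>" "normH1\<Gamma> \<Gamma> \<nu> v \<noteq> 0"
  shows "nH (P_h \<Gamma> \<nu> \<T> V (ip\<Gamma> \<Gamma> v)) \<le> B * normH1\<Gamma> \<Gamma> \<nu> v"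
proof -
  have pos: "normH1\<Gamma> \<Gamma> \<nu> v > 0" using v(2) normH1_nonneg[of \<Gamma> \<nu> v] by simp
  have "ennreal (nH (P_h \<Gamma> \<nu> \<T> V (ip\<Gamma> \<Gamma> v)) / normH1\<Gamma> \<Gamma> \<nu> v) \<le> P_h_norm \<Gamma> \<nu> \<T> V"
    unfolding P_h_norm_def by (rule SUP_upper) (use v in simp)
  then have "ennreal (nH (P_h \<Gamma> \<nu> \<T> V (ip\<Gamma> \<Gamma> v)) / normH1\<Gamma> \<Gamma> \<nu> v) \<le> ennreal B"
    using B(1) by (rule order_trans)
  then show ?thesis using B(2) pos by (simp add: divide_le_eq)
qed

text \<open>A bound \<open>K\<close> for the discrete dual norm of \<open>d\<close> controls the two terms that make up the
  stabilized dual norm: the trace in \<open>H\<^sup>-\<^sup>1\<close> by the stability of \<open>P\<^sub>h\<close>, and the stabilization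
  by the inverse inequality.\<close>

lemma dual_norm_trace:
  assumes B: "P_h_norm \<Gamma> \<nu> \<T> V \<le> ennreal B" "0 \<le> B"
    and d: "d \<in> V" and K: "0 \<le> K" "\<And>w. w \<in> V \<Longrightarrow> \<bar>ips d w\<bar> \<le> K * nH w"
  shows "normHm1\<Gamma> \<Gamma> \<nu> (ip\<Gamma> \<Gamma> d) \<le> B * K"
proof (rule normHm1_least)
  show "0 \<le> B * K" using B K by simp
  fix v assume v: "v \<in> H1\<Gamma> \<Gamma> \<nu>"
  have dL: "d \<in> L2\<Gamma> \<Gamma>" and vL: "v \<in> L2\<Gamma> \<Gamma>" using d V_L2 v H1_subset_L2 by blast+
  show "\<bar>ip\<Gamma> \<Gamma> d v\<bar> \<le> B * K * normH1\<Gamma> \<Gamma> \<nu> v"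
  proof (cases "normH1\<Gamma> \<Gamma> \<nu> v = 0")
    case True
    then show ?thesis using ip_le_normL2_normH1[OF dL v] by simp
  next
    case False
    interpret ip: psd_form "L2\<Gamma> \<Gamma>" "ip\<Gamma> \<Gamma>" by (rule psd_form_ip)
    have "functional_on V (ip\<Gamma> \<Gamma> v)"
      using V_L2 vL by (auto simp: functional_on_def subset_iff ip.add_right ip.scale_right)
    note P = P_h_characterization[OF this]
    have "\<bar>ip\<Gamma> \<Gamma> d v\<bar> = \<bar>ips d (P_h \<Gamma> \<nu> \<T> V (ip\<Gamma> \<Gamma> v))\<bar>"
      using P d dL vL by (simp add: S.sym[OF d P(1)] ip.sym[of d v])
    also have "\<dots> \<le> K * nH (P_h \<Gamma> \<nu> \<T> V (ip\<Gamma> \<Gamma> v))" by (rule K(2)[OF P(1)])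
    also have "\<dots> \<le> K * (B * normH1\<Gamma> \<Gamma> \<nu> v)"
      using K(1) by (intro mult_left_mono P_h_norm_bound[OF B v False])
    finally show ?thesis by (simp add: mult_ac)
  qed
qed

lemma dual_norm_stabilization:
  assumes B: "C_inv \<Gamma> \<nu> \<T> V \<le> ennreal B" "0 \<le> B"
    and d: "d \<in> V" and K: "0 \<le> K" "\<And>w. w \<in> V \<Longrightarrow> \<bar>ips d w\<bar> \<le> K * nH w"
  shows "s_nrm (- 1) d \<le> B * K"
proof (cases "d = 0")
  case True
  then show ?thesis using psd_form.zero[OF psd_form_s d, of "-1"] B K by simp
next
  case False
  define A where "A = sqrt (\<Sum>T\<in>\<T>. (diameter T)\<^sup>2 * (normL2_star_elem \<Gamma> \<nu> T d)\<^sup>2)"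
  have "A \<ge> 0" unfolding A_def by (simp add: sum_nonneg)
  have "ennreal A / norm_Vm1 \<Gamma> \<nu> \<T> V d \<le> C_inv \<Gamma> \<nu> \<T> V"
    unfolding C_inv_def A_def by (rule SUP_upper) (use d False in simp)
  then have le: "ennreal A / norm_Vm1 \<Gamma> \<nu> \<T> V d \<le> ennreal B" using B(1) by (rule order_trans)
  have n: "norm_Vm1 \<Gamma> \<nu> \<T> V d \<le> ennreal K"
    unfolding norm_Vm1_def
  proof (rule SUP_least, rule ennreal_leI)
    fix w assume "w \<in> V - {0}"
    then have w: "w \<in> V" by simp
    show "ips d w / nH w \<le> K"
    proof (cases "nH w = 0")
      case False
      then have "nH w > 0" using nH_nonneg[OF w] by simp
      then show ?thesis using K(2)[OF w] by (simp add: divide_le_eq)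
    qed (use K in simp)
  qed
  \<comment> \<open>If the dual norm vanishes, the quotient in \<open>C_inv\<close> is infinite unless \<open>A = 0\<close>.\<close>
  have "ennreal A \<le> ennreal B * norm_Vm1 \<Gamma> \<nu> \<T> V d"
  proof (cases "norm_Vm1 \<Gamma> \<nu> \<T> V d = 0")
    case True
    have "A = 0"
    proof (rule ccontr)
      assume "A \<noteq> 0"
      then have "ennreal A / 0 = \<infinity>" using \<open>A \<ge> 0\<close> by (simp add: ennreal_divide_zero)
      then show False using le True by (simp add: top_unique)
    qed
    then show ?thesis by simp
  next
    case False
    have fin: "norm_Vm1 \<Gamma> \<nu> \<T> V d < \<infinity>" using n by (simp add: le_less_trans)
    have "ennreal A = (ennreal A / norm_Vm1 \<Gamma> \<nu> \<T> V d) * norm_Vm1 \<Gamma> \<nu> \<T> V d"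
      using False fin by (simp add: ennreal_divide_times ennreal_times_divide mult_divide_eq_ennreal)
    also have "\<dots> \<le> ennreal B * norm_Vm1 \<Gamma> \<nu> \<T> V d" by (rule mult_right_mono[OF le]) simp
    finally show ?thesis .
  qed
  also have "\<dots> \<le> ennreal B * ennreal K" by (rule mult_left_mono[OF n]) simp
  also have "\<dots> = ennreal (B * K)" using B K by (simp add: ennreal_mult)
  finally have "A \<le> B * K" using B K by simp
  moreover have "s_nrm (- 1) d \<le> A"
    unfolding A_def by (intro real_sqrt_le_mono s_form_minus_one_le d)
  ultimately show ?thesis by simp
qed

lemma functional_time:
  assumes u: "u \<in> L2_time \<tau> V nS" and L: "functional_on V L"
  shows "(\<lambda>t. L (u t)) \<in> borel_measurable (time_measure \<tau>)"
    and "integrable (time_measure \<tau>) (\<lambda>t. (L (u t))\<^sup>2)"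
    and "integrable (time_measure \<tau>) (\<lambda>t. L (u t))"
proof -
  obtain C where C: "\<And>v. v \<in> V \<Longrightarrow> \<bar>L v\<bar> \<le> C * nS v" by (rule functional_bounded[OF L], rule that)
  show m: "(\<lambda>t. L (u t)) \<in> borel_measurable (time_measure \<tau>)"
    by (rule L2_time_Lipschitz[OF u, of L C])
       (use C S.mem functional_on_diff[OF L subspace_V] in metis)
  show i: "integrable (time_measure \<tau>) (\<lambda>t. (L (u t))\<^sup>2)"
    by (rule L2_time_square_integrable[OF u m, of C]) (simp add: C)
  show "integrable (time_measure \<tau>) (\<lambda>t. L (u t))"
    by (rule integrable_time_square[OF m i])
qed

text \<open>Weak derivatives of point values are weak derivatives of all functionals, because the
  functionals of a finite-dimensional function space are combinations of point values.\<close>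

lemma functional_weak_deriv:
  assumes u: "u \<in> L2_time \<tau> V nS" and g: "is_dt_h \<Gamma> \<nu> \<T> V \<tau> u g" and L: "functional_on V L"
  shows "weak_deriv \<tau> (\<lambda>t. L (u t)) (\<lambda>t. L (g t))"
proof -
  obtain B where B: "finite B" "V = fun_space.span B" using fe unfolding fe_space_def by blast
  obtain P e where e': "\<forall>p\<in>P. e p \<in> V" and ex': "\<forall>v\<in>V. v = (\<Sum>p\<in>P. fscale (v p) (e p))"
    using nodal_basis[OF B(1)] unfolding B(2)[symmetric] by (elim exE conjE) (rule that)
  note e = e'[rule_format] and ex = ex'[rule_format]
  have Lp: "L v = (\<Sum>p\<in>P. L (e p) * v p)" if "v \<in> V" for v
  proof -
    have "L v = L (\<Sum>p\<in>P. fscale (v p) (e p))" by (simp only: ex[OF that, symmetric])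
    also have "\<dots> = (\<Sum>p\<in>P. v p * L (e p))" by (rule functional_on_sum[OF L subspace_V e])
    finally show ?thesis by (simp add: mult.commute)
  qed
  have gL: "g \<in> L2_time \<tau> V nS" and wd: "\<And>x. weak_deriv \<tau> (\<lambda>t. u t x) (\<lambda>t. g t x)"
    using g by (auto simp: is_dt_h_def)
  note pt = functional_on_point[of V]
  have "weak_deriv \<tau> (\<lambda>t. \<Sum>p\<in>P. L (e p) * u t p) (\<lambda>t. \<Sum>p\<in>P. L (e p) * g t p)"
    by (intro weak_deriv_sum functional_time(3)[OF u pt] functional_time(3)[OF gL pt] wd)
  then show ?thesis
  proof (rule weak_deriv_cong_AE)
    show "AE t in time_measure \<tau>. (\<Sum>p\<in>P. L (e p) * u t p) = L (u t)"
      using L2_time_AE[OF u] by eventually_elim (simp add: Lp)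
    show "AE t in time_measure \<tau>. (\<Sum>p\<in>P. L (e p) * g t p) = L (g t)"
      using L2_time_AE[OF gL] by eventually_elim (simp add: Lp)
    show "(\<lambda>t. L (u t)) \<in> borel_measurable (time_measure \<tau>)" "(\<lambda>t. L (g t)) \<in> borel_measurable (time_measure \<tau>)"
      using functional_time(1)[OF u L] functional_time(1)[OF gL L] .
    show "(\<lambda>t. \<Sum>p\<in>P. L (e p) * u t p) \<in> borel_measurable (time_measure \<tau>)"
      "(\<lambda>t. \<Sum>p\<in>P. L (e p) * g t p) \<in> borel_measurable (time_measure \<tau>)"
      by (intro borel_measurable_sum borel_measurable_times borel_measurable_const
          functional_time(1)[OF u pt] functional_time(1)[OF gL pt])+
  qed
qed

end

section \<open>Error estimates at a fixed time\<close>

lemma Cauchy_Schwarz_pair: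
  fixes a b x y :: real
  shows "a * x + b * y \<le> sqrt (a\<^sup>2 + b\<^sup>2) * sqrt (x\<^sup>2 + y\<^sup>2)"
proof -
  have "(a * x + b * y)\<^sup>2 \<le> (a\<^sup>2 + b\<^sup>2) * (x\<^sup>2 + y\<^sup>2)"
    using zero_le_power2[of "a * y - b * x"] by (simp add: power2_eq_square algebra_simps)
  then have "a * x + b * y \<le> sqrt ((a\<^sup>2 + b\<^sup>2) * (x\<^sup>2 + y\<^sup>2))" by (rule real_le_rsqrt)
  then show ?thesis by (simp add: real_sqrt_mult)
qed

context trace_fem begin

lemma seminormH1_le_nH: "v \<in> V \<Longrightarrow> seminormH1\<Gamma> \<Gamma> \<nu> v \<le> nH v"
  and s_nrm_le_nH: "v \<in> V \<Longrightarrow> s_nrm 1 v \<le> nH v"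
  unfolding nH_eq H.nrm_def
  by (auto simp: seminormH1_eq psd_form.nrm_def[OF psd_form_a] a_star_def ip_nonneg a_form_nonneg s_form_nonneg)

lemma E_parts:
  assumes v: "v \<in> V"
  shows "normHm1\<Gamma> \<Gamma> \<nu> (F - ip\<Gamma> \<Gamma> v) \<le> E_Hm1 \<Gamma> \<nu> \<T> F v" "s_nrm (- 1) v \<le> E_Hm1 \<Gamma> \<nu> \<T> F v"
    and "seminormH1\<Gamma> \<Gamma> \<nu> (U - v) \<le> E_H1 \<Gamma> \<nu> \<T> U v" "s_nrm 1 v \<le> E_H1 \<Gamma> \<nu> \<T> U v"
    and "normL2\<Gamma> \<Gamma> (U - v) \<le> E_L2 \<Gamma> \<nu> \<T> U v" "s_nrm 0 v \<le> E_L2 \<Gamma> \<nu> \<T> U v"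
  using v unfolding E_Hm1_def E_H1_def E_L2_def
  by (auto intro!: real_le_rsqrt simp: s_form_nonneg)

lemma E_sq:
  assumes v: "v \<in> V"
  shows "(E_Hm1 \<Gamma> \<nu> \<T> F v)\<^sup>2 = (normHm1\<Gamma> \<Gamma> \<nu> (F - ip\<Gamma> \<Gamma> v))\<^sup>2 + (s_nrm (- 1) v)\<^sup>2"
    and "(E_H1 \<Gamma> \<nu> \<T> U v)\<^sup>2 = (seminormH1\<Gamma> \<Gamma> \<nu> (U - v))\<^sup>2 + (s_nrm 1 v)\<^sup>2"
    and "(E_L2 \<Gamma> \<nu> \<T> U v)\<^sup>2 = (normL2\<Gamma> \<Gamma> (U - v))\<^sup>2 + (s_nrm 0 v)\<^sup>2"
  using v unfolding E_Hm1_def E_H1_def E_L2_def by (auto simp: s_form_nonneg)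

text \<open>How far a pair \<open>(g, z)\<close> of discrete functions, in the role of \<open>(\<partial>\<^sub>t z\<^sub>h, z\<^sub>h)\<close> at a fixed time, is
  from satisfying the equation of the exact solution, with values \<open>F\<close> and \<open>U\<close> of \<open>\<partial>\<^sub>t u\<close> and \<open>u\<close>.\<close>

lemma consistency:
  assumes g: "g \<in> V" and z: "z \<in> V" and w: "w \<in> V" and U: "U \<in> H1\<Gamma> \<Gamma> \<nu>" and F: "F \<in> Hm1\<Gamma> \<Gamma> \<nu>"
  shows "\<bar>(F w + a_form \<Gamma> \<nu> U w) - (ips g w + a_star \<Gamma> \<nu> \<T> z w)\<bar>
    \<le> (E_Hm1 \<Gamma> \<nu> \<T> F g + E_H1 \<Gamma> \<nu> \<T> U z) * nH w"
proof -
  interpret A: psd_form "H1\<Gamma> \<Gamma> \<nu>" "a_form \<Gamma> \<nu>" by (rule psd_form_a)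
  interpret S1: psd_form V "s_form \<Gamma> \<nu> \<T> 1" by (rule psd_form_s)
  have wH: "w \<in> H1\<Gamma> \<Gamma> \<nu>" and zH: "z \<in> H1\<Gamma> \<Gamma> \<nu>" and gL: "g \<in> L2\<Gamma> \<Gamma>"
    using w z g V_H1 V_L2 by auto
  have FH: "F - ip\<Gamma> \<Gamma> g \<in> Hm1\<Gamma> \<Gamma> \<nu>" by (intro Hm1_diff F ip_in_Hm1 gL)
  have eq: "(F w + a_form \<Gamma> \<nu> U w) - (ips g w + a_star \<Gamma> \<nu> \<T> z w)
    = (F - ip\<Gamma> \<Gamma> g) w - s_form \<Gamma> \<nu> \<T> 0 g w + (a_form \<Gamma> \<nu> (U - z) w - s_form \<Gamma> \<nu> \<T> 1 z w)"
    by (simp add: ip_star_def a_star_def A.diff[OF U zH wH])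
  have "\<bar>(F - ip\<Gamma> \<Gamma> g) w\<bar> + \<bar>s_form \<Gamma> \<nu> \<T> 0 g w\<bar> \<le> E_Hm1 \<Gamma> \<nu> \<T> F g * nH w"
  proof -
    have "\<bar>(F - ip\<Gamma> \<Gamma> g) w\<bar> + \<bar>s_form \<Gamma> \<nu> \<T> 0 g w\<bar>
      \<le> normHm1\<Gamma> \<Gamma> \<nu> (F - ip\<Gamma> \<Gamma> g) * normH1\<Gamma> \<Gamma> \<nu> w + s_nrm (- 1) g * s_nrm 1 w"
      by (rule add_mono[OF Hm1_bound[OF FH wH] s_form_duality[OF g w]])
    also have "\<dots> \<le> sqrt ((normHm1\<Gamma> \<Gamma> \<nu> (F - ip\<Gamma> \<Gamma> g))\<^sup>2 + (s_nrm (- 1) g)\<^sup>2)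
        * sqrt ((normH1\<Gamma> \<Gamma> \<nu> w)\<^sup>2 + (s_nrm 1 w)\<^sup>2)" by (rule Cauchy_Schwarz_pair)
    also have "\<dots> = E_Hm1 \<Gamma> \<nu> \<T> F g * nH w"
      using g w by (simp add: E_Hm1_def normH1_star_def s_form_nonneg)
    finally show ?thesis .
  qed
  moreover have "\<bar>a_form \<Gamma> \<nu> (U - z) w\<bar> + \<bar>s_form \<Gamma> \<nu> \<T> 1 z w\<bar> \<le> E_H1 \<Gamma> \<nu> \<T> U z * nH w"
  proof -
    have "\<bar>a_form \<Gamma> \<nu> (U - z) w\<bar> + \<bar>s_form \<Gamma> \<nu> \<T> 1 z w\<bar>
      \<le> seminormH1\<Gamma> \<Gamma> \<nu> (U - z) * seminormH1\<Gamma> \<Gamma> \<nu> w + s_nrm 1 z * s_nrm 1 w"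
      using add_mono[OF A.Cauchy_Schwarz[OF A.mem(4)[OF U zH] wH] S1.Cauchy_Schwarz[OF z w]]
      by (simp add: seminormH1_eq S1.nrm_def)
    also have "\<dots> \<le> seminormH1\<Gamma> \<Gamma> \<nu> (U - z) * normH1\<Gamma> \<Gamma> \<nu> w + s_nrm 1 z * s_nrm 1 w"
      by (intro add_right_mono mult_left_mono seminormH1_le_normH1) (simp add: seminormH1\<Gamma>_def)
    also have "\<dots> \<le> sqrt ((seminormH1\<Gamma> \<Gamma> \<nu> (U - z))\<^sup>2 + (s_nrm 1 z)\<^sup>2)
        * sqrt ((normH1\<Gamma> \<Gamma> \<nu> w)\<^sup>2 + (s_nrm 1 w)\<^sup>2)" by (rule Cauchy_Schwarz_pair)
    also have "\<dots> = E_H1 \<Gamma> \<nu> \<T> U z * nH w"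
      using z w by (simp add: E_H1_def normH1_star_def s_form_nonneg)
    finally show ?thesis .
  qed
  ultimately show ?thesis unfolding eq distrib_right by linarith
qed

text \<open>The estimates at a fixed time, for the values \<open>F\<close>, \<open>U\<close> of \<open>\<partial>\<^sub>t u\<close>, \<open>u\<close>, the values \<open>gh\<close>, \<open>y\<close>
  of \<open>\<partial>\<^sub>t u\<^sub>h\<close>, \<open>u\<^sub>h\<close>, and the values \<open>gz\<close>, \<open>z\<close> of \<open>\<partial>\<^sub>t z\<^sub>h\<close>, \<open>z\<^sub>h\<close> for a competitor \<open>z\<^sub>h\<close>. The quantity
  \<open>Y\<close> has no sign at a fixed time; its weighted integral in time is controlled by the initial error.\<close>

lemma pointwise_estimate:
  assumes P: "P_h_norm \<Gamma> \<nu> \<T> V \<le> ennreal Bp" "0 \<le> Bp"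
    and I: "C_inv \<Gamma> \<nu> \<T> V \<le> ennreal Bi" "0 \<le> Bi"
    and V: "gh \<in> V" "gz \<in> V" "y \<in> V" "z \<in> V" and U: "U \<in> H1\<Gamma> \<Gamma> \<nu>" and F: "F \<in> Hm1\<Gamma> \<Gamma> \<nu>"
    and galerkin: "\<And>w. w \<in> V \<Longrightarrow> ips gh w + a_star \<Gamma> \<nu> \<T> y w = F w + a_form \<Gamma> \<nu> U w"
  defines "R \<equiv> (E_Hm1 \<Gamma> \<nu> \<T> F gz)\<^sup>2 + (E_H1 \<Gamma> \<nu> \<T> U z)\<^sup>2"
    and "Y \<equiv> ips (y - z) (y - z) - ips (gh - gz) (y - z)"
  shows "(E_Hm1 \<Gamma> \<nu> \<T> F gh)\<^sup>2 + (E_H1 \<Gamma> \<nu> \<T> U y)\<^sup>2 \<le> 4 * ((1 + Bp)\<^sup>2 + (1 + Bi)\<^sup>2 + 2) * (2 * R + Y)"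
proof -
  define e where "e = y - z"
  define d where "d = gh - gz"
  define eps where "eps = E_Hm1 \<Gamma> \<nu> \<T> F gz + E_H1 \<Gamma> \<nu> \<T> U z"
  define N where "N = nH e"
  interpret As: psd_form V "a_star \<Gamma> \<nu> \<T>" by (rule psd_form_a_star)
  have eV: "e \<in> V" and dV: "d \<in> V" unfolding e_def d_def by (rule S.mem(4)[OF V(3,4)], rule S.mem(4)[OF V(1,2)])
  have eps: "0 \<le> E_Hm1 \<Gamma> \<nu> \<T> F gz" "0 \<le> E_H1 \<Gamma> \<nu> \<T> U z" "0 \<le> eps"
    using V by (auto simp: E_Hm1_def E_H1_def eps_def s_form_nonneg)
  have N: "0 \<le> N" unfolding N_def by (rule nH_nonneg[OF eV])
  have res: "\<bar>ips d w + a_star \<Gamma> \<nu> \<T> e w\<bar> \<le> eps * nH w" if w: "w \<in> V" for w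
    using consistency[OF V(2,4) w U F] galerkin[OF w]
      S.diff[OF V(1,2) w] As.diff[OF V(3,4) w] by (simp add: d_def e_def eps_def)
  \<comment> \<open>Test with the error itself.\<close>
  have N2: "N\<^sup>2 \<le> eps\<^sup>2 + 2 * Y"
  proof -
    have "N\<^sup>2 = ip\<Gamma> \<Gamma> e e + a_star \<Gamma> \<nu> \<T> e e" unfolding N_def by (rule nH_sq[OF eV])
    also have "\<dots> \<le> ips e e + a_star \<Gamma> \<nu> \<T> e e" using s_form_nonneg[OF eV] by (simp add: ip_star_def)
    also have "\<dots> \<le> ips e e - ips d e + eps * N" using res[OF eV] unfolding N_def by linarith
    finally have "N\<^sup>2 \<le> Y + eps * N" by (simp add: Y_def e_def d_def)
    moreover have "2 * (eps * N) \<le> eps\<^sup>2 + N\<^sup>2"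
      using sum_squares_bound[of eps N] by simp
    ultimately show ?thesis by linarith
  qed
  \<comment> \<open>Test with all \<open>w\<close>: this bounds the discrete dual norm of \<open>d\<close> by \<open>eps + N\<close>.\<close>
  have dual: "\<bar>ips d w\<bar> \<le> (eps + N) * nH w" if w: "w \<in> V" for w
  proof -
    have le: "As.nrm v \<le> nH v" if "v \<in> V" for v
      using ip_nonneg by (simp add: nH_eq H.nrm_def As.nrm_def)
    have "\<bar>a_star \<Gamma> \<nu> \<T> e w\<bar> \<le> As.nrm e * As.nrm w" by (rule As.Cauchy_Schwarz[OF eV w])
    also have "\<dots> \<le> N * nH w"
      unfolding N_def by (intro mult_mono le eV w nH_nonneg As.nrm_nonneg)
    finally show ?thesis using res[OF w] by (simp add: distrib_right)
  qed
  have K: "0 \<le> eps + N" using eps N by simp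
  have gt: "normHm1\<Gamma> \<Gamma> \<nu> (F - ip\<Gamma> \<Gamma> gh) \<le> (1 + Bp) * (eps + N)"
  proof (rule normHm1_least)
    show "0 \<le> (1 + Bp) * (eps + N)" using P K by simp
    fix v assume v: "v \<in> H1\<Gamma> \<Gamma> \<nu>"
    have L: "gh \<in> L2\<Gamma> \<Gamma>" "gz \<in> L2\<Gamma> \<Gamma>" "d \<in> L2\<Gamma> \<Gamma>" "v \<in> L2\<Gamma> \<Gamma>"
      using V dV V_L2 v H1_subset_L2 by blast+
    have "\<bar>(F - ip\<Gamma> \<Gamma> gh) v\<bar> = \<bar>(F - ip\<Gamma> \<Gamma> gz) v - ip\<Gamma> \<Gamma> d v\<bar>"
      unfolding d_def by (simp add: ip_diff_left L)
    also have "\<dots> \<le> \<bar>(F - ip\<Gamma> \<Gamma> gz) v\<bar> + \<bar>ip\<Gamma> \<Gamma> d v\<bar>" by linarith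
    also have "\<dots> \<le> normHm1\<Gamma> \<Gamma> \<nu> (F - ip\<Gamma> \<Gamma> gz) * normH1\<Gamma> \<Gamma> \<nu> v + normHm1\<Gamma> \<Gamma> \<nu> (ip\<Gamma> \<Gamma> d) * normH1\<Gamma> \<Gamma> \<nu> v"
      by (rule add_mono[OF Hm1_bound[OF Hm1_diff[OF F ip_in_Hm1[OF L(2)]] v] Hm1_bound[OF ip_in_Hm1[OF L(3)] v]])
    also have "\<dots> \<le> (eps + N) * normH1\<Gamma> \<Gamma> \<nu> v + (Bp * (eps + N)) * normH1\<Gamma> \<Gamma> \<nu> v"
    proof (rule add_mono; rule mult_right_mono[OF _ normH1_nonneg])
      show "normHm1\<Gamma> \<Gamma> \<nu> (F - ip\<Gamma> \<Gamma> gz) \<le> eps + N"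
        using E_parts(1)[OF V(2), of F] eps N unfolding eps_def by linarith
      show "normHm1\<Gamma> \<Gamma> \<nu> (ip\<Gamma> \<Gamma> d) \<le> Bp * (eps + N)"
        by (rule dual_norm_trace[OF P dV K dual])
    qed
    finally show "\<bar>(F - ip\<Gamma> \<Gamma> gh) v\<bar> \<le> (1 + Bp) * (eps + N) * normH1\<Gamma> \<Gamma> \<nu> v"
      by (simp add: algebra_simps)
  qed
  have gs: "s_nrm (- 1) gh \<le> (1 + Bi) * (eps + N)"
  proof -
    interpret S': psd_form V "s_form \<Gamma> \<nu> \<T> (- 1)" by (rule psd_form_s)
    have "s_nrm (- 1) gh = S'.nrm (gz + d)" by (simp add: d_def S'.nrm_def)
    also have "\<dots> \<le> s_nrm (- 1) gz + s_nrm (- 1) d"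
      using S'.nrm_add[OF V(2) dV] by (simp add: S'.nrm_def)
    also have "\<dots> \<le> (eps + N) + Bi * (eps + N)"
    proof (rule add_mono)
      show "s_nrm (- 1) gz \<le> eps + N"
        using E_parts(2)[OF V(2), of F] eps N unfolding eps_def by linarith
      show "s_nrm (- 1) d \<le> Bi * (eps + N)"
        by (rule dual_norm_stabilization[OF I dV K dual])
    qed
    finally show ?thesis by (simp add: algebra_simps)
  qed
  have yt: "seminormH1\<Gamma> \<Gamma> \<nu> (U - y) \<le> eps + N"
  proof -
    interpret A: psd_form "H1\<Gamma> \<Gamma> \<nu>" "a_form \<Gamma> \<nu>" by (rule psd_form_a)
    have H: "U - z \<in> H1\<Gamma> \<Gamma> \<nu>" "e \<in> H1\<Gamma> \<Gamma> \<nu>" using U V eV V_H1 by (auto intro!: A.mem(4))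
    have "seminormH1\<Gamma> \<Gamma> \<nu> (U - y) = A.nrm ((U - z) - e)" by (simp add: e_def seminormH1_eq)
    also have "\<dots> \<le> seminormH1\<Gamma> \<Gamma> \<nu> (U - z) + seminormH1\<Gamma> \<Gamma> \<nu> e"
      using A.nrm_diff[OF H] by (simp add: seminormH1_eq)
    also have "\<dots> \<le> eps + N"
      using E_parts(3)[OF V(4), of U] seminormH1_le_nH[OF eV] eps by (simp add: eps_def N_def)
    finally show ?thesis .
  qed
  have ys: "s_nrm 1 y \<le> eps + N"
  proof -
    interpret S': psd_form V "s_form \<Gamma> \<nu> \<T> 1" by (rule psd_form_s)
    have "s_nrm 1 y = S'.nrm (z + e)" by (simp add: e_def S'.nrm_def)
    also have "\<dots> \<le> s_nrm 1 z + s_nrm 1 e"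
      using S'.nrm_add[OF V(4) eV] by (simp add: S'.nrm_def)
    also have "\<dots> \<le> eps + N"
      using E_parts(4)[OF V(4), of U] s_nrm_le_nH[OF eV] eps by (simp add: eps_def N_def)
    finally show ?thesis .
  qed
  have "F - ip\<Gamma> \<Gamma> gh \<in> Hm1\<Gamma> \<Gamma> \<nu>" using V V_L2 by (intro Hm1_diff F ip_in_Hm1) auto
  then have "(E_Hm1 \<Gamma> \<nu> \<T> F gh)\<^sup>2 + (E_H1 \<Gamma> \<nu> \<T> U y)\<^sup>2
    \<le> (((1 + Bp) * (eps + N))\<^sup>2 + ((1 + Bi) * (eps + N))\<^sup>2) + ((eps + N)\<^sup>2 + (eps + N)\<^sup>2)"
    unfolding E_sq(1)[OF V(1)] E_sq(2)[OF V(3)]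
    by (intro add_mono power_mono gt gs yt ys)
       (use V in \<open>auto simp: normHm1_nonneg s_form_nonneg seminormH1\<Gamma>_def\<close>)
  also have "\<dots> = ((1 + Bp)\<^sup>2 + (1 + Bi)\<^sup>2 + 2) * (eps + N)\<^sup>2"
    unfolding power_mult_distrib by (simp add: algebra_simps)
  also have "\<dots> \<le> ((1 + Bp)\<^sup>2 + (1 + Bi)\<^sup>2 + 2) * (4 * (2 * R + Y))"
  proof (rule mult_left_mono)
    have "(eps + N)\<^sup>2 \<le> 2 * eps\<^sup>2 + 2 * N\<^sup>2" by (rule square_add_bound)
    also have "\<dots> \<le> 4 * (eps\<^sup>2 + Y)" using N2 by simp
    also have "eps\<^sup>2 \<le> 2 * R" unfolding eps_def R_def
      using square_add_bound[of "E_Hm1 \<Gamma> \<nu> \<T> F gz" "E_H1 \<Gamma> \<nu> \<T> U z"] by simp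
    finally show "(eps + N)\<^sup>2 \<le> 4 * (2 * R + Y)" by simp
  qed simp
  finally show ?thesis by (simp only: mult.assoc mult.left_commute)
qed

lemma initial_estimate:
  assumes V: "y \<in> V" "z \<in> V" and U: "U \<in> L2\<Gamma> \<Gamma>"
    and galerkin: "\<And>w. w \<in> V \<Longrightarrow> ips y w = ip\<Gamma> \<Gamma> U w"
  shows "ips (y - z) (y - z) \<le> (E_L2 \<Gamma> \<nu> \<T> U z)\<^sup>2"
    and "(E_L2 \<Gamma> \<nu> \<T> U y)\<^sup>2 \<le> 8 * (E_L2 \<Gamma> \<nu> \<T> U z)\<^sup>2"
proof -
  define e where "e = y - z"
  define E where "E = E_L2 \<Gamma> \<nu> \<T> U z"
  interpret ip: psd_form "L2\<Gamma> \<Gamma>" "ip\<Gamma> \<Gamma>" by (rule psd_form_ip)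
  interpret S0: psd_form V "s_form \<Gamma> \<nu> \<T> 0" by (rule psd_form_s)
  have eV: "e \<in> V" unfolding e_def by (rule S.mem(4)[OF V])
  have L: "e \<in> L2\<Gamma> \<Gamma>" "z \<in> L2\<Gamma> \<Gamma>" "y \<in> L2\<Gamma> \<Gamma>" using eV V V_L2 by blast+
  have UzL: "U - z \<in> L2\<Gamma> \<Gamma>" by (rule ip.mem(4)[OF U L(2)])
  have E0: "0 \<le> E" using V by (simp add: E_def E_L2_def s_form_nonneg)
  have "(nS e)\<^sup>2 = ips e e" using eV by (simp add: nS_eq S.nrm_sq)
  also have "\<dots> = ip\<Gamma> \<Gamma> (U - z) e - s_form \<Gamma> \<nu> \<T> 0 z e"
    using S.diff[OF V eV] galerkin[OF eV] ip.diff[OF U L(2) L(1)] by (simp add: e_def ip_star_def)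
  also have "\<dots> \<le> normL2\<Gamma> \<Gamma> (U - z) * normL2\<Gamma> \<Gamma> e + s_nrm 0 z * s_nrm 0 e"
    using ip.Cauchy_Schwarz[OF UzL L(1)] S0.Cauchy_Schwarz[OF V(2) eV]
    by (simp add: normL2_eq S0.nrm_def)
  also have "\<dots> \<le> sqrt ((normL2\<Gamma> \<Gamma> (U - z))\<^sup>2 + (s_nrm 0 z)\<^sup>2) * sqrt ((normL2\<Gamma> \<Gamma> e)\<^sup>2 + (s_nrm 0 e)\<^sup>2)"
    by (rule Cauchy_Schwarz_pair)
  also have "\<dots> = E * nS e"
    using V eV by (simp add: E_def E_L2_def norm_star_def ip_star_def normL2_sq s_form_nonneg)
  finally have "nS e * nS e \<le> E * nS e" by (simp add: power2_eq_square)
  then have nE: "nS e \<le> E"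
    using E0 S.nrm_nonneg[OF eV] by (cases "nS e = 0") (auto simp: nS_eq)
  then have "(nS e)\<^sup>2 \<le> E\<^sup>2"
    using S.nrm_nonneg[OF eV] by (intro power_mono) (auto simp: nS_eq)
  then show "ips (y - z) (y - z) \<le> (E_L2 \<Gamma> \<nu> \<T> U z)\<^sup>2"
    using eV unfolding e_def[symmetric] E_def[symmetric] by (simp add: nS_eq S.nrm_sq)
  have "normL2\<Gamma> \<Gamma> (U - y) \<le> 2 * E"
  proof -
    have "normL2\<Gamma> \<Gamma> (U - y) = ip.nrm ((U - z) - e)" by (simp add: e_def normL2_eq)
    also have "\<dots> \<le> normL2\<Gamma> \<Gamma> (U - z) + normL2\<Gamma> \<Gamma> e"
      using ip.nrm_diff[OF UzL L(1)] by (simp add: normL2_eq)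
    also have "\<dots> \<le> 2 * E"
      using E_parts(5)[OF V(2), of U] normL2_le_nS[OF eV] nE by (simp add: E_def)
    finally show ?thesis .
  qed
  moreover have "s_nrm 0 y \<le> 2 * E"
  proof -
    have "s_nrm 0 y = S0.nrm (z + e)" by (simp add: e_def S0.nrm_def)
    also have "\<dots> \<le> s_nrm 0 z + s_nrm 0 e"
      using S0.nrm_add[OF V(2) eV] by (simp add: S0.nrm_def)
    also have "s_nrm 0 e \<le> nS e" by (simp add: norm_star_def ip_star_def ip_nonneg)
    finally show ?thesis using E_parts(6)[OF V(2), of U] nE by (simp add: E_def)
  qed
  ultimately have "(E_L2 \<Gamma> \<nu> \<T> U y)\<^sup>2 \<le> (2 * E)\<^sup>2 + (2 * E)\<^sup>2"
    unfolding E_sq(3)[OF V(1)]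
    by (intro add_mono power_mono) (use V in \<open>auto simp: normL2\<Gamma>_def ip_nonneg s_form_nonneg\<close>)
  then show "(E_L2 \<Gamma> \<nu> \<T> U y)\<^sup>2 \<le> 8 * (E_L2 \<Gamma> \<nu> \<T> U z)\<^sup>2"
    by (simp add: E_def power_mult_distrib)
qed

end

section \<open>Error estimates in time\<close>

context trace_fem begin

lemma nS_zero: "nS 0 = 0"
  using S.zero[OF S.mem(1)] by (simp add: norm_star_def)

text \<open>The time integral in the error of the competitor is one of an integrable function, so that it
  is not \<open>0\<close> by default. For the discrete solution this is not needed.\<close>

lemma error_density_integrable:
  assumes D: "D \<in> L2_time \<tau> (Hm1\<Gamma> \<Gamma> \<nu>) (normHm1\<Gamma> \<Gamma> \<nu>)" and u: "u \<in> L2_time \<tau> (H1\<Gamma> \<Gamma> \<nu>) (normH1\<Gamma> \<Gamma> \<nu>)"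
    and g: "g \<in> L2_time \<tau> V nS" and z: "z \<in> L2_time \<tau> V nS"
  shows "integrable (time_measure \<tau>) (\<lambda>t. (E_Hm1 \<Gamma> \<nu> \<T> (D t) (g t))\<^sup>2 + (E_H1 \<Gamma> \<nu> \<T> (u t) (z t))\<^sup>2)"
proof -
  let ?M = "time_measure \<tau>"
  have s: "integrable ?M (\<lambda>t. (s_nrm j (y t))\<^sup>2)" if y: "y \<in> L2_time \<tau> V nS" for j y
  proof -
    interpret S': psd_form V "s_form \<Gamma> \<nu> \<T> j" by (rule psd_form_s)
    obtain C where C: "\<And>v. v \<in> V \<Longrightarrow> s_nrm j v \<le> C * nS v"
      by (rule seminorm_bounded[OF psd_form_s[of j]], rule that)
    have "(\<lambda>t. s_nrm j (y t)) \<in> borel_measurable ?M"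
    proof (rule L2_time_Lipschitz[OF y])
      fix a a' assume a: "a \<in> V" "a' \<in> V"
      have "\<bar>s_nrm j a' - s_nrm j a\<bar> \<le> s_nrm j (a' - a)"
        using S'.nrm_diff_abs[OF a(2,1)] by (simp add: S'.nrm_def)
      also have "\<dots> \<le> C * nS (a' - a)" by (rule C[OF S.mem(4)[OF a(2,1)]])
      finally show "\<bar>s_nrm j a' - s_nrm j a\<bar> \<le> C * nS (a' - a)" .
    qed
    then show ?thesis
      by (rule L2_time_square_integrable[OF y, of _ C]) (simp add: C s_form_nonneg)
  qed
  have sum: "integrable ?M (\<lambda>t. (f t)\<^sup>2)"
    if f: "f \<in> borel_measurable ?M" and p: "integrable ?M (\<lambda>t. (p t)\<^sup>2)" and q: "integrable ?M (\<lambda>t. (r t)\<^sup>2)"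
      and le: "AE t in ?M. 0 \<le> f t \<and> f t \<le> p t + r t" for f p r :: "real \<Rightarrow> real"
  proof (rule Bochner_Integration.integrable_bound)
    show "integrable ?M (\<lambda>t. 2 * (p t)\<^sup>2 + 2 * (r t)\<^sup>2)" using p q by simp
    show "AE t in ?M. norm ((f t)\<^sup>2) \<le> norm (2 * (p t)\<^sup>2 + 2 * (r t)\<^sup>2)"
      using le
    proof eventually_elim
      case (elim t)
      then have "(f t)\<^sup>2 \<le> (p t + r t)\<^sup>2" by (intro power_mono) auto
      also have "\<dots> \<le> 2 * (p t)\<^sup>2 + 2 * (r t)\<^sup>2" by (rule square_add_bound)
      finally show ?case by simp
    qed
  qed (use f in measurable)
  have "integrable ?M (\<lambda>t. (normHm1\<Gamma> \<Gamma> \<nu> (D t - ip\<Gamma> \<Gamma> (g t)))\<^sup>2)"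
  proof (rule sum[OF _ L2_time_integrable[OF D] L2_time_integrable[OF g]])
    show "(\<lambda>t. normHm1\<Gamma> \<Gamma> \<nu> (D t - ip\<Gamma> \<Gamma> (g t))) \<in> borel_measurable ?M"
    proof (rule L2_time_Lipschitz2[OF D g, of "\<lambda>F v. normHm1\<Gamma> \<Gamma> \<nu> (F - ip\<Gamma> \<Gamma> v)" 1])
      fix F F' v v' assume a: "F \<in> Hm1\<Gamma> \<Gamma> \<nu>" "F' \<in> Hm1\<Gamma> \<Gamma> \<nu>" "v \<in> V" "v' \<in> V"
      have w: "v' - v \<in> V" by (rule S.mem(4)[OF a(4,3)])
      have L: "v \<in> L2\<Gamma> \<Gamma>" "v' \<in> L2\<Gamma> \<Gamma>" "v' - v \<in> L2\<Gamma> \<Gamma>" using a w V_L2 by blast+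
      have FF: "F' - F \<in> Hm1\<Gamma> \<Gamma> \<nu>" by (rule Hm1_diff[OF a(2,1)])
      have "\<bar>normHm1\<Gamma> \<Gamma> \<nu> (F' - ip\<Gamma> \<Gamma> v') - normHm1\<Gamma> \<Gamma> \<nu> (F - ip\<Gamma> \<Gamma> v)\<bar>
        \<le> normHm1\<Gamma> \<Gamma> \<nu> ((F' - ip\<Gamma> \<Gamma> v') - (F - ip\<Gamma> \<Gamma> v))"
        by (intro normHm1_diff_abs Hm1_diff a ip_in_Hm1 L)
      also have "\<dots> \<le> normHm1\<Gamma> \<Gamma> \<nu> (F' - F) + nS (v' - v)"
      proof (rule normHm1_least)
        show "0 \<le> normHm1\<Gamma> \<Gamma> \<nu> (F' - F) + nS (v' - v)"
          using normHm1_nonneg[OF FF] S.nrm_nonneg[OF w] by (simp add: nS_eq)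
        fix y assume y: "y \<in> H1\<Gamma> \<Gamma> \<nu>"
        have "\<bar>((F' - ip\<Gamma> \<Gamma> v') - (F - ip\<Gamma> \<Gamma> v)) y\<bar> = \<bar>(F' - F) y - ip\<Gamma> \<Gamma> (v' - v) y\<bar>"
          using L y H1_subset_L2[of \<Gamma> \<nu>] by (simp add: ip_diff_left subset_iff)
        also have "\<dots> \<le> \<bar>(F' - F) y\<bar> + \<bar>ip\<Gamma> \<Gamma> (v' - v) y\<bar>" by linarith
        also have "\<dots> \<le> normHm1\<Gamma> \<Gamma> \<nu> (F' - F) * normH1\<Gamma> \<Gamma> \<nu> y + normL2\<Gamma> \<Gamma> (v' - v) * normH1\<Gamma> \<Gamma> \<nu> y"
          by (rule add_mono[OF Hm1_bound[OF FF y] ip_le_normL2_normH1[OF L(3) y]])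
        also have "\<dots> \<le> normHm1\<Gamma> \<Gamma> \<nu> (F' - F) * normH1\<Gamma> \<Gamma> \<nu> y + nS (v' - v) * normH1\<Gamma> \<Gamma> \<nu> y"
          by (intro add_left_mono mult_right_mono normL2_le_nS[OF w] normH1_nonneg)
        finally show "\<bar>((F' - ip\<Gamma> \<Gamma> v') - (F - ip\<Gamma> \<Gamma> v)) y\<bar>
          \<le> (normHm1\<Gamma> \<Gamma> \<nu> (F' - F) + nS (v' - v)) * normH1\<Gamma> \<Gamma> \<nu> y" by (simp add: distrib_right)
      qed
      finally show "\<bar>normHm1\<Gamma> \<Gamma> \<nu> (F' - ip\<Gamma> \<Gamma> v') - normHm1\<Gamma> \<Gamma> \<nu> (F - ip\<Gamma> \<Gamma> v)\<bar>
        \<le> 1 * normHm1\<Gamma> \<Gamma> \<nu> (F' - F) + 1 * nS (v' - v)" by simp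
    qed
    show "AE t in ?M. 0 \<le> normHm1\<Gamma> \<Gamma> \<nu> (D t - ip\<Gamma> \<Gamma> (g t)) \<and>
      normHm1\<Gamma> \<Gamma> \<nu> (D t - ip\<Gamma> \<Gamma> (g t)) \<le> normHm1\<Gamma> \<Gamma> \<nu> (D t) + nS (g t)"
      using L2_time_AE[OF D] L2_time_AE[OF g]
    proof eventually_elim
      case (elim t)
      have L: "g t \<in> L2\<Gamma> \<Gamma>" using elim V_L2 by blast
      have "normHm1\<Gamma> \<Gamma> \<nu> (D t - ip\<Gamma> \<Gamma> (g t)) \<le> normHm1\<Gamma> \<Gamma> \<nu> (D t) + normHm1\<Gamma> \<Gamma> \<nu> (ip\<Gamma> \<Gamma> (g t))"
        by (rule normHm1_diff[OF elim(1) ip_in_Hm1[OF L]])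
      then show ?case
        using normHm1_nonneg[OF Hm1_diff[OF elim(1) ip_in_Hm1[OF L]]]
          normHm1_ip_le[OF L, of \<nu>] normL2_le_nS[OF elim(2)] by linarith
    qed
  qed
  moreover have "integrable ?M (\<lambda>t. (seminormH1\<Gamma> \<Gamma> \<nu> (u t - z t))\<^sup>2)"
  proof -
    interpret A: psd_form "H1\<Gamma> \<Gamma> \<nu>" "a_form \<Gamma> \<nu>" by (rule psd_form_a)
    obtain C where C: "0 \<le> C" "\<And>v. v \<in> V \<Longrightarrow> sqrt (a_form \<Gamma> \<nu> v v) \<le> C * nS v"
      by (rule seminorm_bounded[OF psd_form_aV], rule that)
    have zC: "integrable ?M (\<lambda>t. (C * nS (z t))\<^sup>2)"
      using L2_time_integrable[OF z] by (simp add: power_mult_distrib)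
    show ?thesis
    proof (rule sum[OF _ L2_time_integrable[OF u] zC])
      show "(\<lambda>t. seminormH1\<Gamma> \<Gamma> \<nu> (u t - z t)) \<in> borel_measurable ?M"
      proof (rule L2_time_Lipschitz2[OF u z, of "\<lambda>a b. seminormH1\<Gamma> \<Gamma> \<nu> (a - b)" "1 + C"])
        fix a a' b b' assume a: "a \<in> H1\<Gamma> \<Gamma> \<nu>" "a' \<in> H1\<Gamma> \<Gamma> \<nu>" "b \<in> V" "b' \<in> V"
        have bH: "b \<in> H1\<Gamma> \<Gamma> \<nu>" "b' \<in> H1\<Gamma> \<Gamma> \<nu>" using a V_H1 by blast+
        have w: "b' - b \<in> V" by (rule S.mem(4)[OF a(4,3)])
        have "\<bar>seminormH1\<Gamma> \<Gamma> \<nu> (a' - b') - seminormH1\<Gamma> \<Gamma> \<nu> (a - b)\<bar> \<le> A.nrm ((a' - b') - (a - b))"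
          unfolding seminormH1_eq by (intro A.nrm_diff_abs A.mem(4) a bH)
        also have "(a' - b') - (a - b) = (a' - a) - (b' - b)" by simp
        also have "A.nrm \<dots> \<le> A.nrm (a' - a) + A.nrm (b' - b)"
          by (intro A.nrm_diff A.mem(4) a bH)
        also have "\<dots> \<le> normH1\<Gamma> \<Gamma> \<nu> (a' - a) + C * nS (b' - b)"
          using seminormH1_le_normH1[of \<Gamma> \<nu> "a' - a"] C(2)[OF w] by (simp add: seminormH1_eq A.nrm_def)
        also have "\<dots> \<le> (1 + C) * normH1\<Gamma> \<Gamma> \<nu> (a' - a) + (1 + C) * nS (b' - b)"
          using C(1) normH1_nonneg[of \<Gamma> \<nu> "a' - a"] S.nrm_nonneg[OF w]
          by (simp add: nS_eq distrib_right)
        finally show "\<bar>seminormH1\<Gamma> \<Gamma> \<nu> (a' - b') - seminormH1\<Gamma> \<Gamma> \<nu> (a - b)\<bar>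
          \<le> (1 + C) * normH1\<Gamma> \<Gamma> \<nu> (a' - a) + (1 + C) * nS (b' - b)" .
      qed
      show "AE t in ?M. 0 \<le> seminormH1\<Gamma> \<Gamma> \<nu> (u t - z t) \<and>
        seminormH1\<Gamma> \<Gamma> \<nu> (u t - z t) \<le> normH1\<Gamma> \<Gamma> \<nu> (u t) + C * nS (z t)"
        using L2_time_AE[OF u] L2_time_AE[OF z]
      proof eventually_elim
        case (elim t)
        then have zH: "z t \<in> H1\<Gamma> \<Gamma> \<nu>" using V_H1 by blast
        have "seminormH1\<Gamma> \<Gamma> \<nu> (u t - z t) \<le> A.nrm (u t) + A.nrm (z t)"
          unfolding seminormH1_eq by (rule A.nrm_diff[OF elim(1) zH])
        then show ?case
          using seminormH1_le_normH1[of \<Gamma> \<nu> "u t"] C(2)[OF elim(2)]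
          by (simp add: seminormH1_eq A.nrm_def a_form_nonneg)
      qed
    qed
  qed
  ultimately have i: "integrable ?M (\<lambda>t. ((normHm1\<Gamma> \<Gamma> \<nu> (D t - ip\<Gamma> \<Gamma> (g t)))\<^sup>2 + (s_nrm (- 1) (g t))\<^sup>2)
      + ((seminormH1\<Gamma> \<Gamma> \<nu> (u t - z t))\<^sup>2 + (s_nrm 1 (z t))\<^sup>2))"
    by (intro Bochner_Integration.integrable_add s g z)
  show ?thesis
    by (rule integrable_time_cong_AE[OF i])
       (use L2_time_AE[OF g] L2_time_AE[OF z] in \<open>eventually_elim, simp only: E_sq\<close>)
qed

text \<open>Test functions \<open>w\<close> times the indicator of a set of times localize a variational equation in
  time. By linearity and a finite basis of \<open>V\<close> the null set of exceptional times can be chosen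
  independently of \<open>w\<close>.\<close>

lemma galerkin_AE:
  assumes D: "D \<in> L2_time \<tau> (Hm1\<Gamma> \<Gamma> \<nu>) (normHm1\<Gamma> \<Gamma> \<nu>)" and u: "u \<in> L2_time \<tau> (H1\<Gamma> \<Gamma> \<nu>) (normH1\<Gamma> \<Gamma> \<nu>)"
    and g: "g \<in> L2_time \<tau> V nS" and y: "y \<in> L2_time \<tau> V nS"
    and eq: "\<And>w A. w \<in> V \<Longrightarrow> A \<in> sets (time_measure \<tau>) \<Longrightarrow>
      (LINT t|time_measure \<tau>. ips (g t) (if t \<in> A then w else 0) + a_star \<Gamma> \<nu> \<T> (y t) (if t \<in> A then w else 0))
      = (LINT t|time_measure \<tau>. D t (if t \<in> A then w else 0) + a_form \<Gamma> \<nu> (u t) (if t \<in> A then w else 0))"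
  shows "AE t in time_measure \<tau>. \<forall>w\<in>V. ips (g t) w + a_star \<Gamma> \<nu> \<T> (y t) w = D t w + a_form \<Gamma> \<nu> (u t) w"
proof -
  let ?M = "time_measure \<tau>"
  interpret As: psd_form V "a_star \<Gamma> \<nu> \<T>" by (rule psd_form_a_star)
  interpret A: psd_form "H1\<Gamma> \<Gamma> \<nu>" "a_form \<Gamma> \<nu>" by (rule psd_form_a)
  let ?p = "\<lambda>w t. ips (g t) w + a_star \<Gamma> \<nu> \<T> (y t) w"
  let ?q = "\<lambda>w t. D t w + a_form \<Gamma> \<nu> (u t) w"
  have p: "integrable ?M (?p w)" if w: "w \<in> V" for w
    by (intro Bochner_Integration.integrable_add functional_time(3)[OF g S.functional_left[OF w]]
        functional_time(3)[OF y As.functional_left[OF w]])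
  have q: "integrable ?M (?q w)" if w: "w \<in> V" for w
  proof (rule Bochner_Integration.integrable_add)
    have wH: "w \<in> H1\<Gamma> \<Gamma> \<nu>" using w V_H1 by blast
    have Dw: "\<bar>F w\<bar> \<le> normH1\<Gamma> \<Gamma> \<nu> w * normHm1\<Gamma> \<Gamma> \<nu> F" if "F \<in> Hm1\<Gamma> \<Gamma> \<nu>" for F
      using Hm1_bound[OF that wH] by (simp add: mult.commute)
    have m: "(\<lambda>t. D t w) \<in> borel_measurable ?M"
      by (rule L2_time_Lipschitz[OF D, of "\<lambda>F. F w"]) (use Dw[OF Hm1_diff] in simp)
    show "integrable ?M (\<lambda>t. D t w)"
      by (rule integrable_time_square[OF m L2_time_square_integrable[OF D m, of "normH1\<Gamma> \<Gamma> \<nu> w"]])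
         (use Dw in simp)
    have aw: "\<bar>a_form \<Gamma> \<nu> v w\<bar> \<le> A.nrm w * normH1\<Gamma> \<Gamma> \<nu> v" if v: "v \<in> H1\<Gamma> \<Gamma> \<nu>" for v
    proof -
      have "\<bar>a_form \<Gamma> \<nu> v w\<bar> \<le> A.nrm v * A.nrm w" by (rule A.Cauchy_Schwarz[OF v wH])
      also have "\<dots> \<le> normH1\<Gamma> \<Gamma> \<nu> v * A.nrm w"
        using seminormH1_le_normH1[of \<Gamma> \<nu> v]
        by (intro mult_right_mono A.nrm_nonneg[OF wH]) (simp add: seminormH1_eq)
      finally show ?thesis by (simp add: mult.commute)
    qed
    have m: "(\<lambda>t. a_form \<Gamma> \<nu> (u t) w) \<in> borel_measurable ?M"
    proof (rule L2_time_Lipschitz[OF u, of "\<lambda>v. a_form \<Gamma> \<nu> v w"])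
      fix a a' assume a: "a \<in> H1\<Gamma> \<Gamma> \<nu>" "a' \<in> H1\<Gamma> \<Gamma> \<nu>"
      show "\<bar>a_form \<Gamma> \<nu> a' w - a_form \<Gamma> \<nu> a w\<bar> \<le> A.nrm w * normH1\<Gamma> \<Gamma> \<nu> (a' - a)"
        using aw[OF A.mem(4)[OF a(2,1)]] A.diff[OF a(2,1) wH] by simp
    qed
    show "integrable ?M (\<lambda>t. a_form \<Gamma> \<nu> (u t) w)"
      by (rule integrable_time_square[OF m L2_time_square_integrable[OF u m, of "A.nrm w"]])
         (use aw in simp)
  qed
  have cut: "integrable ?M (\<lambda>t. if t \<in> A then f t else 0)"
    if "integrable ?M f" "A \<in> sets ?M" for f :: "real \<Rightarrow> real" and A
  proof -
    have "(\<lambda>t. if t \<in> A then f t else 0) = (\<lambda>t. f t * indicator A t)"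
      by (auto simp: indicator_def)
    then show ?thesis using integrable_real_mult_indicator[OF that(2,1)] by simp
  qed
  have AEw: "AE t in ?M. ?p w t = ?q w t" if w: "w \<in> V" for w
  proof (rule AE_eq_from_tests[OF p[OF w] q[OF w]])
    fix A assume A: "A \<in> sets ?M"
    have "(LINT t|?M. (if t \<in> A then ?p w t else 0))
      = (LINT t|?M. ips (g t) (if t \<in> A then w else 0) + a_star \<Gamma> \<nu> \<T> (y t) (if t \<in> A then w else 0))"
    proof (rule integral_time_cong_AE[symmetric])
      show "AE t in ?M. ips (g t) (if t \<in> A then w else 0) + a_star \<Gamma> \<nu> \<T> (y t) (if t \<in> A then w else 0)
        = (if t \<in> A then ?p w t else 0)"
        using L2_time_AE[OF g] L2_time_AE[OF y]
        by eventually_elim (simp add: S.zero_right As.zero_right)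
    qed (use cut[OF p[OF w] A] in simp)
    also have "\<dots> = (LINT t|?M. D t (if t \<in> A then w else 0) + a_form \<Gamma> \<nu> (u t) (if t \<in> A then w else 0))"
      by (rule eq[OF w A])
    also have "\<dots> = (LINT t|?M. (if t \<in> A then ?q w t else 0))"
    proof (rule integral_time_cong_AE)
      have D0: "F 0 = 0" if "F \<in> Hm1\<Gamma> \<Gamma> \<nu>" for F
        using Hm1_bound[OF that A.mem(1)] by (simp add: normH1_zero)
      show "AE t in ?M. D t (if t \<in> A then w else 0) + a_form \<Gamma> \<nu> (u t) (if t \<in> A then w else 0)
        = (if t \<in> A then ?q w t else 0)"
        using L2_time_AE[OF D] L2_time_AE[OF u]
        by eventually_elim (simp add: D0 A.zero_right)
    qed (use cut[OF q[OF w] A] in simp)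
    finally show "(LINT t|?M. (if t \<in> A then ?p w t else 0)) = (LINT t|?M. (if t \<in> A then ?q w t else 0))" .
  qed
  obtain E where E: "finite E" "E \<subseteq> V" "\<And>v. v \<in> V \<Longrightarrow> v = (\<Sum>e\<in>E. fscale (ips v e) e)"
    by (rule orthonormal_basis_V) (rule that)
  have "AE t in ?M. \<forall>e\<in>E. ?p e t = ?q e t"
    by (rule AE_finite_allI[OF E(1)]) (use AEw E(2) in auto)
  then show ?thesis
    using L2_time_AE[OF g] L2_time_AE[OF y] L2_time_AE[OF D] L2_time_AE[OF u]
  proof eventually_elim
    case (elim t)
    have fp: "functional_on V (\<lambda>w. ?p w t)"
      by (intro functional_on_add S.functional_right As.functional_right elim)
    have fq: "functional_on V (\<lambda>w. ?q w t)"
      by (intro functional_on_subset[OF _ V_H1] functional_on_add functional_on_Hm1 A.functional_right elim)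
    show ?case
    proof
      fix w assume w: "w \<in> V"
      have EV: "e \<in> V" if "e \<in> E" for e using that E(2) by blast
      have "?p w t = ?p (\<Sum>e\<in>E. fscale (ips w e) e) t" by (simp only: E(3)[OF w, symmetric])
      also have "\<dots> = (\<Sum>e\<in>E. ips w e * ?p e t)" by (rule functional_on_sum[OF fp subspace_V EV])
      also have "\<dots> = (\<Sum>e\<in>E. ips w e * ?q e t)" using elim(1) by (intro sum.cong) auto
      also have "\<dots> = ?q (\<Sum>e\<in>E. fscale (ips w e) e) t"
        by (rule functional_on_sum[OF fq subspace_V EV, symmetric])
      also have "\<dots> = ?q w t" by (simp only: E(3)[OF w, symmetric])
      finally show "?p w t = ?q w t" .
    qed
  qed
qed

lemma continuous_in_functional:
  assumes u: "continuous_in \<tau> V nS u" and L: "functional_on V L"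
  shows "continuous_on {0..\<tau>} (\<lambda>t. L (u t))"
  unfolding continuous_on_def
proof
  fix t assume t: "t \<in> {0..\<tau>}"
  obtain C where C: "\<And>v. v \<in> V \<Longrightarrow> \<bar>L v\<bar> \<le> C * nS v" by (rule functional_bounded[OF L], rule that)
  have uV: "\<And>s. s \<in> {0..\<tau>} \<Longrightarrow> u s \<in> V" and lim: "((\<lambda>s. nS (u s - u t)) \<longlongrightarrow> 0) (at t within {0..\<tau>})"
    using u t by (auto simp: continuous_in_def)
  have "((\<lambda>s. L (u s) - L (u t)) \<longlongrightarrow> 0) (at t within {0..\<tau>})"
  proof (rule Lim_null_comparison)
    show "((\<lambda>s. C * nS (u s - u t)) \<longlongrightarrow> 0) (at t within {0..\<tau>})"
      using tendsto_mult_left[OF lim, of C] by simp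
    show "\<forall>\<^sub>F s in at t within {0..\<tau>}. norm (L (u s) - L (u t)) \<le> C * nS (u s - u t)"
      unfolding eventually_at_filter
    proof (intro always_eventually allI impI)
      fix s assume "s \<in> {0..\<tau>}"
      then show "norm (L (u s) - L (u t)) \<le> C * nS (u s - u t)"
        using C[OF S.mem(4)[OF uV uV[OF t]]] functional_on_diff[OF L subspace_V uV uV[OF t]] by simp
    qed
  qed
  then show "((\<lambda>t. L (u t)) \<longlongrightarrow> L (u t)) (at t within {0..\<tau>})"
    by (simp add: LIM_zero_iff)
qed

text \<open>The weighted energy inequality, applied to the coordinates of the difference of two discrete
  functions in an orthonormal basis.\<close>

lemma energy_estimate:
  assumes \<tau>: "0 < \<tau>"
    and y: "continuous_in \<tau> V nS y" "y \<in> L2_time \<tau> V nS" "is_dt_h \<Gamma> \<nu> \<T> V \<tau> y g"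
    and z: "continuous_in \<tau> V nS z" "z \<in> L2_time \<tau> V nS" "is_dt_h \<Gamma> \<nu> \<T> V \<tau> z k"
  defines "Y \<equiv> \<lambda>t. ips (y t - z t) (y t - z t) - ips (g t - k t) (y t - z t)"
  shows "integrable (time_measure \<tau>) (\<lambda>t. exp (- 2 * t) * Y t)"
    and "2 * (LINT t|time_measure \<tau>. exp (- 2 * t) * Y t) \<le> ips (y 0 - z 0) (y 0 - z 0)"
proof -
  let ?M = "time_measure \<tau>"
  have gL: "g \<in> L2_time \<tau> V nS" and kL: "k \<in> L2_time \<tau> V nS" using y z by (auto simp: is_dt_h_def)
  obtain E where E: "finite E" "E \<subseteq> V" "\<And>v. v \<in> V \<Longrightarrow> v = (\<Sum>e\<in>E. fscale (ips v e) e)"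
    by (rule orthonormal_basis_V) (rule that)
  have EV: "e \<in> V" if "e \<in> E" for e using that E(2) by blast
  define F where "F e t = ips (y t) e - ips (z t) e" for e t
  define G where "G e t = ips (g t) e - ips (k t) e" for e t
  have fl: "functional_on V (\<lambda>v. ips v e)" if "e \<in> E" for e by (rule S.functional_left[OF EV[OF that]])
  have Fc: "continuous_on {0..\<tau>} (F e)" if "e \<in> E" for e
    unfolding F_def by (intro continuous_on_diff continuous_in_functional[OF _ fl[OF that]] y z)
  have Gi: "integrable ?M (G e)" if "e \<in> E" for e
    unfolding G_def by (intro Bochner_Integration.integrable_diff functional_time(3)[OF _ fl[OF that]] gL kL)
  have wd: "weak_deriv \<tau> (F e) (G e)" if "e \<in> E" for e
    unfolding F_def [abs_def] G_def [abs_def]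
    by (intro weak_deriv_diff functional_time(3)[OF _ fl[OF that]] functional_weak_deriv[OF _ _ fl[OF that]] y z gL kL)
  have parseval: "ips v w = (\<Sum>e\<in>E. ips v e * ips w e)" if v: "v \<in> V" and w: "w \<in> V" for v w
  proof -
    have "ips v w = ips (\<Sum>e\<in>E. fscale (ips v e) e) w" by (simp only: E(3)[OF v, symmetric])
    also have "\<dots> = (\<Sum>e\<in>E. ips v e * ips e w)" by (rule S.sum_left[OF EV w])
    also have "\<dots> = (\<Sum>e\<in>E. ips v e * ips w e)"
      by (intro sum.cong refl) (simp only: S.sym[OF EV w])
    finally show ?thesis .
  qed
  have YE: "AE t in ?M. exp (- 2 * t) * Y t = - (\<Sum>e\<in>E. exp (- 2 * t) * (F e t * G e t - (F e t)\<^sup>2))"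
    using L2_time_AE[OF y(2)] L2_time_AE[OF z(2)] L2_time_AE[OF gL] L2_time_AE[OF kL]
  proof eventually_elim
    case (elim t)
    have V: "y t - z t \<in> V" "g t - k t \<in> V" using elim by (auto intro: S.mem(4))
    have "ips (y t - z t) e = F e t" "ips (g t - k t) e = G e t" if "e \<in> E" for e
      using elim EV[OF that] by (simp_all add: F_def G_def S.diff)
    then have "Y t = (\<Sum>e\<in>E. (F e t)\<^sup>2 - F e t * G e t)"
      unfolding Y_def parseval[OF V(1,1)] parseval[OF V(2,1)]
      by (simp add: sum_subtractf power2_eq_square mult.commute)
    then show ?case
      by (simp add: sum_distrib_left right_diff_distrib flip: sum_negf)
  qed
  have we: "integrable ?M (\<lambda>t. exp (- 2 * t) * (F e t * G e t - (F e t)\<^sup>2))"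
    "- (F e 0)\<^sup>2 \<le> 2 * (LINT t|?M. exp (- 2 * t) * (F e t * G e t - (F e t)\<^sup>2))" if "e \<in> E" for e
    using weighted_energy[OF Fc[OF that] Gi[OF that] wd[OF that] \<tau>] .
  have i: "integrable ?M (\<lambda>t. - (\<Sum>e\<in>E. exp (- 2 * t) * (F e t * G e t - (F e t)\<^sup>2)))"
    by (intro Bochner_Integration.integrable_minus Bochner_Integration.integrable_sum we)
  show "integrable ?M (\<lambda>t. exp (- 2 * t) * Y t)" by (rule integrable_time_cong_AE[OF i YE])
  have yz0: "y 0 \<in> V" "z 0 \<in> V" using y(1) z(1) \<tau> by (auto simp: continuous_in_def)
  have "2 * (LINT t|?M. exp (- 2 * t) * Y t)
    = 2 * (LINT t|?M. - (\<Sum>e\<in>E. exp (- 2 * t) * (F e t * G e t - (F e t)\<^sup>2)))"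
    by (subst integral_time_cong_AE[OF _ YE]) (use i in auto)
  also have "\<dots> = (\<Sum>e\<in>E. - (2 * (LINT t|?M. exp (- 2 * t) * (F e t * G e t - (F e t)\<^sup>2))))"
    by (simp only: Bochner_Integration.integral_minus Bochner_Integration.integral_sum[OF we(1)])
       (simp add: sum_negf sum_distrib_left)
  also have "\<dots> \<le> (\<Sum>e\<in>E. (F e 0)\<^sup>2)"
    using we(2) by (intro sum_mono) (simp add: minus_le_iff)
  also have "\<dots> = ips (y 0 - z 0) (y 0 - z 0)"
    unfolding parseval[OF S.mem(4)[OF yz0] S.mem(4)[OF yz0]]
    using yz0 EV by (intro sum.cong refl) (simp add: F_def S.diff power2_eq_square)
  finally show "2 * (LINT t|?M. exp (- 2 * t) * Y t) \<le> ips (y 0 - z 0) (y 0 - z 0)" .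
qed

text \<open>The discrete solution is as good as any competitor \<open>z\<close>, up to a constant that depends on the
  mesh only through the bounds for \<open>P_h_norm\<close> and \<open>C_inv\<close>.\<close>

lemma quasi_optimality:
  assumes \<tau>: "0 < \<tau>"
    and P: "P_h_norm \<Gamma> \<nu> \<T> V \<le> ennreal Bp" "0 \<le> Bp"
    and I: "C_inv \<Gamma> \<nu> \<T> V \<le> ennreal Bi" "0 \<le> Bi"
    and u: "u \<in> U_space \<Gamma> \<nu> \<tau>" and y: "y \<in> U_h_space \<Gamma> \<nu> \<T> V \<tau>" and z: "z \<in> U_h_space \<Gamma> \<nu> \<T> V \<tau>"
    and galerkin: "\<And>v. v \<in> V_h_space \<Gamma> \<nu> \<T> V \<tau> \<Longrightarrow> v \<in> V_space \<Gamma> \<nu> \<tau> \<Longrightarrow>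
      b_h_form \<Gamma> \<nu> \<T> V \<tau> y v = b_form \<Gamma> \<nu> \<tau> u v"
  shows "(E_err \<Gamma> \<nu> \<T> V \<tau> u y)\<^sup>2
    \<le> (8 + 8 * exp (2 * \<tau>) * ((1 + Bp)\<^sup>2 + (1 + Bi)\<^sup>2 + 2)) * (E_err \<Gamma> \<nu> \<T> V \<tau> u z)\<^sup>2"
proof -
  let ?M = "time_measure \<tau>"
  define D where "D = dt \<Gamma> \<nu> \<tau> u"
  define g where "g = dt_h \<Gamma> \<nu> \<T> V \<tau> y"
  define k where "k = dt_h \<Gamma> \<nu> \<T> V \<tau> z"
  have uc: "continuous_in \<tau> (L2\<Gamma> \<Gamma>) (normL2\<Gamma> \<Gamma>) u" and uL: "u \<in> L2_time \<tau> (H1\<Gamma> \<Gamma> \<nu>) (normH1\<Gamma> \<Gamma> \<nu>)"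
    and exD: "\<exists>g. is_dt \<Gamma> \<nu> \<tau> u g" using u by (auto simp: U_space_def)
  have "is_dt \<Gamma> \<nu> \<tau> u D" unfolding D_def dt_def by (rule someI_ex[OF exD])
  then have DL: "D \<in> L2_time \<tau> (Hm1\<Gamma> \<Gamma> \<nu>) (normHm1\<Gamma> \<Gamma> \<nu>)" by (simp add: is_dt_def)
  have yc: "continuous_in \<tau> V nS y" and yL: "y \<in> L2_time \<tau> V nS" and exg: "\<exists>g. is_dt_h \<Gamma> \<nu> \<T> V \<tau> y g"
    using y by (auto simp: U_h_space_def)
  have yg: "is_dt_h \<Gamma> \<nu> \<T> V \<tau> y g" unfolding g_def dt_h_def by (rule someI_ex[OF exg])
  have zc: "continuous_in \<tau> V nS z" and zL: "z \<in> L2_time \<tau> V nS" and exk: "\<exists>g. is_dt_h \<Gamma> \<nu> \<T> V \<tau> z g"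
    using z by (auto simp: U_h_space_def)
  have zk: "is_dt_h \<Gamma> \<nu> \<T> V \<tau> z k" unfolding k_def dt_h_def by (rule someI_ex[OF exk])
  have gL: "g \<in> L2_time \<tau> V nS" and kL: "k \<in> L2_time \<tau> V nS" using yg zk by (auto simp: is_dt_h_def)
  have V0: "y 0 \<in> V" "z 0 \<in> V" and u0: "u 0 \<in> L2\<Gamma> \<Gamma>"
    using yc zc uc \<tau> by (auto simp: continuous_in_def)

  have test: "ips (y 0) v + (LINT t|?M. ips (g t) (if t \<in> A then w else 0) + a_star \<Gamma> \<nu> \<T> (y t) (if t \<in> A then w else 0))
    = ip\<Gamma> \<Gamma> (u 0) v + (LINT t|?M. D t (if t \<in> A then w else 0) + a_form \<Gamma> \<nu> (u t) (if t \<in> A then w else 0))"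
    if v: "v \<in> V" and w: "w \<in> V" and A: "A \<in> sets ?M" for v w A
  proof -
    have "(\<lambda>t. if t \<in> A then w else 0) \<in> L2_time \<tau> V nS"
      by (rule L2_time_indicator[where N = nS, OF w S.mem(1) nS_zero A])
    moreover have "(\<lambda>t. if t \<in> A then w else 0) \<in> L2_time \<tau> (H1\<Gamma> \<Gamma> \<nu>) (normH1\<Gamma> \<Gamma> \<nu>)"
      by (rule L2_time_indicator[where N = "normH1\<Gamma> \<Gamma> \<nu>", OF _ fun_space.subspace_0[OF subspace_H1] normH1_zero A]) (use w V_H1 in blast)
    ultimately have "(v, \<lambda>t. if t \<in> A then w else 0) \<in> V_h_space \<Gamma> \<nu> \<T> V \<tau>"
      "(v, \<lambda>t. if t \<in> A then w else 0) \<in> V_space \<Gamma> \<nu> \<tau>"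
      using v V_L2 by (auto simp: V_h_space_def V_space_def)
    from galerkin[OF this] show ?thesis
      by (simp add: b_h_form_def b_form_def D_def g_def)
  qed
  have init: "ips (y 0) v = ip\<Gamma> \<Gamma> (u 0) v" if v: "v \<in> V" for v
  proof -
    interpret As: psd_form V "a_star \<Gamma> \<nu> \<T>" by (rule psd_form_a_star)
    interpret A: psd_form "H1\<Gamma> \<Gamma> \<nu>" "a_form \<Gamma> \<nu>" by (rule psd_form_a)
    have D0: "F 0 = 0" if "F \<in> Hm1\<Gamma> \<Gamma> \<nu>" for F
      using Hm1_bound[OF that A.mem(1)] by (simp add: normH1_zero)
    have "(LINT t|?M. ips (g t) 0 + a_star \<Gamma> \<nu> \<T> (y t) 0) = (LINT t|?M. 0)"
      by (rule integral_time_cong_AE) (use L2_time_AE[OF gL] L2_time_AE[OF yL] in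
          \<open>simp, eventually_elim, simp add: S.zero_right As.zero_right\<close>)
    moreover have "(LINT t|?M. D t 0 + a_form \<Gamma> \<nu> (u t) 0) = (LINT t|?M. 0)"
      by (rule integral_time_cong_AE) (use L2_time_AE[OF DL] L2_time_AE[OF uL] in
          \<open>simp, eventually_elim, simp add: D0 A.zero_right\<close>)
    ultimately show ?thesis using test[OF v S.mem(1), of "{}"] by simp
  qed
  have gal: "AE t in ?M. \<forall>w\<in>V. ips (g t) w + a_star \<Gamma> \<nu> \<T> (y t) w = D t w + a_form \<Gamma> \<nu> (u t) w"
    by (rule galerkin_AE[OF DL uL gL yL]) (use test[OF S.mem(1)] init[OF S.mem(1)] in simp)

  define R where "R t = (E_Hm1 \<Gamma> \<nu> \<T> (D t) (k t))\<^sup>2 + (E_H1 \<Gamma> \<nu> \<T> (u t) (z t))\<^sup>2" for t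
  define X where "X t = (E_Hm1 \<Gamma> \<nu> \<T> (D t) (g t))\<^sup>2 + (E_H1 \<Gamma> \<nu> \<T> (u t) (y t))\<^sup>2" for t
  define Y where "Y t = ips (y t - z t) (y t - z t) - ips (g t - k t) (y t - z t)" for t
  define K where "K = (1 + Bp)\<^sup>2 + (1 + Bi)\<^sup>2 + 2"
  define E where "E = (E_L2 \<Gamma> \<nu> \<T> (u 0) (z 0))\<^sup>2"
  have K: "0 < K" unfolding K_def by (simp add: add_nonneg_pos)
  have Ri: "integrable ?M R" unfolding R_def by (rule error_density_integrable[OF DL uL kL zL])
  have R0: "0 \<le> R t" for t by (simp add: R_def)
  have Yi: "integrable ?M (\<lambda>t. exp (- 2 * t) * Y t)"
    and Yle: "2 * (LINT t|?M. exp (- 2 * t) * Y t) \<le> ips (y 0 - z 0) (y 0 - z 0)"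
    unfolding Y_def using energy_estimate[OF \<tau> yc yL yg zc zL zk] by auto
  have e0: "ips (y 0 - z 0) (y 0 - z 0) \<le> E" and E8: "(E_L2 \<Gamma> \<nu> \<T> (u 0) (y 0))\<^sup>2 \<le> 8 * E"
    unfolding E_def using initial_estimate[OF V0 u0 init] by auto
  have XE: "AE t in ?M. X t \<le> 4 * K * (2 * R t + Y t)"
    using gal L2_time_AE[OF gL] L2_time_AE[OF kL] L2_time_AE[OF yL] L2_time_AE[OF zL]
      L2_time_AE[OF uL] L2_time_AE[OF DL]
  proof eventually_elim
    case (elim t)
    show ?case unfolding X_def R_def Y_def K_def
      by (rule pointwise_estimate[OF P I elim(2-7)]) (use elim(1) in blast)
  qed
  define W where "W t = 4 * K * exp (2 * \<tau>) * (2 * R t + exp (- 2 * t) * Y t)" for t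
  \<comment> \<open>The factor \<open>exp (2 \<tau>)\<close> compensates the weight \<open>exp (- 2 t)\<close>.\<close>
  have XW: "AE t in ?M. X t \<le> W t \<and> 0 \<le> W t"
    using XE AE_space
  proof eventually_elim
    case (elim t)
    have X0: "0 \<le> X t" by (simp add: X_def)
    then have "0 \<le> 4 * K * (2 * R t + Y t)" using elim(1) by linarith
    then have pos: "0 \<le> 2 * R t + Y t" using K by (simp add: zero_le_mult_iff)
    have t: "0 < t" "t < \<tau>" using elim(2) by auto
    have "4 * K * (2 * R t + Y t) \<le> 4 * K * (exp (2 * \<tau> - 2 * t) * (2 * R t + Y t))"
      using K pos t mult_right_mono[of 1 "exp (2 * \<tau> - 2 * t)" "2 * R t + Y t"]
      by (intro mult_left_mono) auto
    also have "exp (2 * \<tau> - 2 * t) = exp (2 * \<tau>) * exp (- 2 * t)" by (simp flip: exp_add)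
    also have "4 * K * (exp (2 * \<tau>) * exp (- 2 * t) * (2 * R t + Y t))
        = 4 * K * exp (2 * \<tau>) * (exp (- 2 * t) * (2 * R t) + exp (- 2 * t) * Y t)"
      by (simp add: algebra_simps)
    also have "\<dots> \<le> W t" unfolding W_def
    proof (intro mult_left_mono add_right_mono)
      show "exp (- 2 * t) * (2 * R t) \<le> 2 * R t"
        using R0[of t] t by (intro mult_left_le_one_le) auto
    qed (use K in simp)
    finally show ?case using elim(1) X0 by linarith
  qed
  have Wi: "integrable ?M W" unfolding W_def using Ri Yi by simp
  have "(LINT t|?M. X t) \<le> (LINT t|?M. W t)"
    by (rule integral_mono_AE'[OF Wi]) (use XW in \<open>auto elim: eventually_mono\<close>)
  also have "\<dots> = 4 * K * exp (2 * \<tau>) * (2 * (LINT t|?M. R t) + (LINT t|?M. exp (- 2 * t) * Y t))"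
    unfolding W_def using Ri Yi by (simp add: Bochner_Integration.integral_add)
  also have "\<dots> \<le> 4 * K * exp (2 * \<tau>) * (2 * (E + (LINT t|?M. R t)))"
  proof (rule mult_left_mono)
    have "0 \<le> E" by (simp add: E_def)
    then show "2 * (LINT t|?M. R t) + (LINT t|?M. exp (- 2 * t) * Y t) \<le> 2 * (E + (LINT t|?M. R t))"
      using Yle e0 by argo
  qed (use K in simp)
  finally have XR: "(LINT t|?M. X t) \<le> 8 * exp (2 * \<tau>) * K * (E + (LINT t|?M. R t))" by (simp add: algebra_simps)
  have Rn: "0 \<le> (LINT t|?M. R t)" by (rule Bochner_Integration.integral_nonneg) (simp add: R0)
  have Xn: "0 \<le> (LINT t|?M. X t)" by (rule Bochner_Integration.integral_nonneg) (simp add: X_def)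
  have "(E_err \<Gamma> \<nu> \<T> V \<tau> u y)\<^sup>2 = (E_L2 \<Gamma> \<nu> \<T> (u 0) (y 0))\<^sup>2 + (LINT t|?M. X t)"
    using Xn by (simp add: E_err_def X_def D_def g_def)
  also have "\<dots> \<le> 8 * (E + (LINT t|?M. R t)) + 8 * exp (2 * \<tau>) * K * (E + (LINT t|?M. R t))"
    using E8 XR Rn by argo
  also have "\<dots> = (8 + 8 * exp (2 * \<tau>) * K) * (E_err \<Gamma> \<nu> \<T> V \<tau> u z)\<^sup>2"
    using Rn by (simp add: E_err_def E_def R_def D_def k_def distrib_right)
  finally show ?thesis by (simp add: K_def)
qed

end

section \<open>Convergence\<close>

lemma trace_fem_mesh:
  assumes "closed_C2_hypersurface \<Gamma>" "unit_normal_field \<Gamma> \<nu>" "mesh_around \<Gamma> \<M>"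
    and \<T>: "\<T> = cut_elements \<Gamma> \<M>" and "resolves_geometry C \<Gamma> \<nu> \<T>" "fe_space \<T> V"
    and "V \<subseteq> H1\<Gamma> \<Gamma> \<nu>" "inner_product_on V (ip_star \<Gamma> \<nu> \<T>)"
  shows "trace_fem \<Gamma> \<nu> \<T> V"
proof unfold_locales
  have sub: "\<T> \<subseteq> \<M>" by (auto simp: \<T> cut_elements_def)
  have m: "finite \<M>" "\<And>T. T \<in> \<T> \<Longrightarrow> T \<noteq> {} \<and> compact T \<and> T = closure (interior T) \<and> negligible (frontier T)"
    using assms(3) sub unfolding mesh_around_def by blast+
  show "compact \<Gamma>" "\<Gamma> \<noteq> {}" using assms(1) by (auto simp: closed_C2_hypersurface_def)
  show "continuous_on \<Gamma> \<nu>" using assms(2) by (simp add: unit_normal_field_def)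
  show "finite \<T>" using m(1) sub finite_subset by blast
  show "compact T" "interior T \<noteq> {}" "negligible (frontier T)" if "T \<in> \<T>" for T
    using m(2)[OF that] closure_empty by metis+
  show "\<exists>!y. y \<in> \<Gamma> \<and> (\<forall>z\<in>\<Gamma>. dist x y \<le> dist x z)" if "x \<in> \<Union>\<T>" for x
    using assms(5) that unfolding resolves_geometry_def by blast
qed (rule assms)+

theorem proposition4p12:
  fixes \<Gamma> :: "'a::euclidean_space set"
    and \<nu> :: "'a \<Rightarrow> 'a"
    and \<M> \<T> :: "nat \<Rightarrow> 'a set set"
    and V :: "nat \<Rightarrow> ('a \<Rightarrow> real) set"
    and C \<tau> :: real
    and u0 :: "'a \<Rightarrow> real"
    and f :: "real \<Rightarrow> ('a \<Rightarrow> real) \<Rightarrow> real"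
    and u :: "real \<Rightarrow> 'a \<Rightarrow> real"
    and uh :: "nat \<Rightarrow> real \<Rightarrow> 'a \<Rightarrow> real"
  assumes "closed_C2_hypersurface \<Gamma>" and "unit_normal_field \<Gamma> \<nu>"
    and "\<tau> > 0" and "C > 0"
    and "\<And>k. mesh_around \<Gamma> (\<M> k)"
    and "\<And>k. \<T> k = cut_elements \<Gamma> (\<M> k)"
    and "\<And>k. resolves_geometry C \<Gamma> \<nu> (\<T> k)"
    and "(\<lambda>k. mesh_size (\<T> k)) \<longlonglongrightarrow> 0"
    and "\<And>k. fe_space (\<T> k) (V k)"
    and "\<And>k. V k \<subseteq> H1\<Gamma> \<Gamma> \<nu>"
    and "\<And>k. inner_product_on (V k) (ip_star \<Gamma> \<nu> (\<T> k))"
    and "\<exists>B::real. \<forall>k. P_h_norm \<Gamma> \<nu> (\<T> k) (V k) \<le> ennreal B"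
    and "\<exists>B::real. \<forall>k. C_inv \<Gamma> \<nu> (\<T> k) (V k) \<le> ennreal B"
    and "\<And>w. w \<in> U_space \<Gamma> \<nu> \<tau> \<Longrightarrow>
           (\<lambda>k. INF z\<in>U_h_space \<Gamma> \<nu> (\<T> k) (V k) \<tau>. E_err \<Gamma> \<nu> (\<T> k) (V k) \<tau> w z) \<longlonglongrightarrow> 0"
    and "u0 \<in> L2\<Gamma> \<Gamma>"
    and "f \<in> L2_time \<tau> (Hm1\<Gamma> \<Gamma> \<nu>) (normHm1\<Gamma> \<Gamma> \<nu>)"
    and "\<And>k. uh k \<in> U_h_space \<Gamma> \<nu> (\<T> k) (V k) \<tau>"
    and "\<And>k v. v \<in> V_h_space \<Gamma> \<nu> (\<T> k) (V k) \<tau> \<Longrightarrow>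
           b_h_form \<Gamma> \<nu> (\<T> k) (V k) \<tau> (uh k) v = l_form \<Gamma> \<tau> u0 f v"
    and "u \<in> U_space \<Gamma> \<nu> \<tau>"
    and "\<And>v. v \<in> V_space \<Gamma> \<nu> \<tau> \<Longrightarrow> b_form \<Gamma> \<nu> \<tau> u v = l_form \<Gamma> \<tau> u0 f v"
  shows "(\<lambda>k. E_err \<Gamma> \<nu> (\<T> k) (V k) \<tau> u (uh k)) \<longlonglongrightarrow> 0"
proof -
  obtain Bp' where Bp': "\<And>k. P_h_norm \<Gamma> \<nu> (\<T> k) (V k) \<le> ennreal Bp'" using assms(12) by blast
  obtain Bi' where Bi': "\<And>k. C_inv \<Gamma> \<nu> (\<T> k) (V k) \<le> ennreal Bi'" using assms(13) by blast
  \<comment> \<open>The given bounds may be negative, in which case \<open>ennreal\<close> sends them to \<open>0\<close>.\<close>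
  define Bp where "Bp = max 0 Bp'"
  define Bi where "Bi = max 0 Bi'"
  have Bp: "P_h_norm \<Gamma> \<nu> (\<T> k) (V k) \<le> ennreal Bp" "0 \<le> Bp" for k
    using order_trans[OF Bp'[of k] ennreal_leI[of Bp' Bp]] by (auto simp: Bp_def)
  have Bi: "C_inv \<Gamma> \<nu> (\<T> k) (V k) \<le> ennreal Bi" "0 \<le> Bi" for k
    using order_trans[OF Bi'[of k] ennreal_leI[of Bi' Bi]] by (auto simp: Bi_def)
  define K where "K = sqrt (8 + 8 * exp (2 * \<tau>) * ((1 + Bp)\<^sup>2 + (1 + Bi)\<^sup>2 + 2))"
  have K: "0 < K" unfolding K_def by (intro real_sqrt_gt_zero add_pos_nonneg) auto
  let ?E = "\<lambda>k. E_err \<Gamma> \<nu> (\<T> k) (V k) \<tau> u"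
  let ?I = "\<lambda>k. INF z\<in>U_h_space \<Gamma> \<nu> (\<T> k) (V k) \<tau>. ?E k z"
  have le: "?E k (uh k) \<le> K * ?I k" for k
  proof -
    interpret trace_fem \<Gamma> \<nu> "\<T> k" "V k"
      by (rule trace_fem_mesh[OF assms(1,2,5,6,7,9,10,11)])
    have "?E k (uh k) / K \<le> ?I k"
    proof (rule cINF_greatest)
      show "U_h_space \<Gamma> \<nu> (\<T> k) (V k) \<tau> \<noteq> {}" using assms(17)[of k] by blast
      fix z assume z: "z \<in> U_h_space \<Gamma> \<nu> (\<T> k) (V k) \<tau>"
      have K2: "K\<^sup>2 = 8 + 8 * exp (2 * \<tau>) * ((1 + Bp)\<^sup>2 + (1 + Bi)\<^sup>2 + 2)"
        unfolding K_def by simp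
      have "(?E k (uh k))\<^sup>2 \<le> K\<^sup>2 * (?E k z)\<^sup>2"
        unfolding K2 by (rule quasi_optimality[OF \<open>\<tau> > 0\<close> Bp Bi assms(19,17) z])
          (simp only: assms(18,20))
      then have sq: "(?E k (uh k))\<^sup>2 \<le> (K * ?E k z)\<^sup>2" by (simp only: power_mult_distrib)
      have "0 \<le> ?E k z"
      proof -
        have "z 0 \<in> V k" using z \<open>\<tau> > 0\<close> by (auto simp: U_h_space_def continuous_in_def)
        then show ?thesis unfolding E_err_def
          by (intro real_sqrt_ge_zero add_nonneg_nonneg Bochner_Integration.integral_nonneg zero_le_power2)
      qed
      then have "?E k (uh k) \<le> K * ?E k z"
        using K by (intro power2_le_imp_le[OF sq] mult_nonneg_nonneg) simp_all
      then show "?E k (uh k) / K \<le> ?E k z" using K by (simp add: divide_le_eq mult.commute)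
    qed
    then show ?thesis using K by (simp add: divide_le_eq mult.commute)
  qed
  have nonneg: "0 \<le> ?E k (uh k)" for k
    unfolding E_err_def
    by (intro real_sqrt_ge_zero add_nonneg_nonneg Bochner_Integration.integral_nonneg zero_le_power2)
  have "(\<lambda>k. K * ?I k) \<longlonglongrightarrow> 0"
    using tendsto_mult_left[OF assms(14)[OF assms(19)], of K] by simp
  then show ?thesis
    by (rule tendsto_sandwich[OF always_eventually always_eventually tendsto_const, rotated 2])
       (use le nonneg in auto)
qed

end
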